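(* For every $p\in(0,1)$ the following inequalities hold: $$\frac{(1+p)^2\pi}{4p}\le A_p\le \tilde A_p<\frac{1+p^2}{p}\left(1+\sqrt2+\frac{20}{3p}\right)^2\log 2 .$$
   Context: Let $\mathbb D=\{\zeta\in\mathbb C:|\zeta|<1\}$, let $\mathbb T^-=\{\zeta\in\mathbb C:|\zeta|=1,\ \operatorname{Re}\zeta<0\}$ be the open left half of the unit circle, and let $\mathbb I_1=\{iv:-1<v<1\}$ be the vertical diameter of $\mathbb D$. For a curve $\gamma$ in $\mathbb C$, $\ell(\gamma)\in[0,+\infty]$ denotes its Euclidean length (equal to $\int_a^b|\gamma'(t)|\,dt$ when $\gamma:(a,b)\to\mathbb C$ is piecewise $C^1$); $\ell(f(\mathbb T^-))$ and $\ell(f(\mathbb I_1))$ denote the lengths of the image curves of $\mathbb T^-$ and $\mathbb I_1$ under $f$. For $p\in(0,1)$ put $\alpha=\frac{2p}{1+p^2}$ and $\overline{\Delta}_p=\{\zeta\in\mathbb C:|\zeta-\alpha^{-1}|\le\sqrt{\alpha^{-2}-1}\}$. $\mathcal M_p$ is the class of meromorphic univalent (injective) functions on $\mathbb D$ with a simple pole at $p$ that extend continuously to $\mathbb T^-$, and $\mathcal M_p^0=\{f\in\mathcal M_p:\ell(f(\mathbb T^-))<+\infty\}$. $\tilde{\mathcal M}_p$ is the class of analytic univalent functions on the domain $\mathbb D\setminus\overline{\Delta}_p$ that extend continuously to $\mathbb T^-$, and $\tilde{\mathcal M}_p^0=\{f\in\tilde{\mathcal M}_p:\ell(f(\mathbb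 T^-))<+\infty\}$. Define $$A_p=\sup_{f\in\mathcal M_p^0}\frac{\ell(f(\mathbb I_1))}{\ell(f(\mathbb T^-))},\qquad \tilde A_p=\sup_{f\in\tilde{\mathcal M}_p^0}\frac{\ell(f(\mathbb I_1))}{\ell(f(\mathbb T^-))}.$$ *)

theory Defs
  imports "HOL-Complex_Analysis.Complex_Analysis"
begin

text \<open>
  The curve is parametrised by \<open>\<gamma>\<close> on \<open>I\<close> (possibly an open interval); its length is the
  supremum of the lengths of inscribed polygons, so arcs that are traversed several times are
  counted with multiplicity.  For piecewise continuously differentiable curves this is the
  integral of the norm of the derivative.
\<close>

definition curve_length :: "real set \<Rightarrow> (real \<Rightarrow> 'a::metric_space) \<Rightarrow> ennreal" where
  "curve_length I \<gamma> =
     (SUP ts \<in> {ts. sorted ts \<and> set ts \<subseteq> I}.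
        \<Sum>i<length ts - 1. ennreal (dist (\<gamma> (ts ! i)) (\<gamma> (ts ! Suc i))))"

abbreviation unit_disc :: "complex set" where
  "unit_disc \<equiv> ball 0 1"

definition left_semicircle :: "complex set" where
  "left_semicircle = {\<zeta>. norm \<zeta> = 1 \<and> Re \<zeta> < 0}"

definition length_image_semicircle :: "(complex \<Rightarrow> complex) \<Rightarrow> ennreal" where
  "length_image_semicircle f = curve_length {pi/2<..<3*pi/2} (\<lambda>t. f (cis t))"

definition length_image_diameter :: "(complex \<Rightarrow> complex) \<Rightarrow> ennreal" where
  "length_image_diameter f = curve_length {-1<..<1} (\<lambda>v. f (\<i> * complex_of_real v))"

definition alpha :: "real \<Rightarrow> real" where
  "alpha p = 2 * p / (1 + p\<^sup>2)"

definition closed_Delta :: "real \<Rightarrow> complex set" where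
  "closed_Delta p =
     {\<zeta>. norm (\<zeta> - complex_of_real (inverse (alpha p))) \<le> sqrt ((inverse (alpha p))\<^sup>2 - 1)}"

text \<open>
  Functions are total, so the values of \<open>f\<close> on the left semicircle are taken to be those of the
  continuous extension; all values elsewhere outside \<open>D\<close> are irrelevant.
\<close>

definition extends_continuously :: "complex set \<Rightarrow> (complex \<Rightarrow> complex) \<Rightarrow> bool" where
  "extends_continuously D f \<longleftrightarrow>
     (\<forall>\<zeta>\<in>left_semicircle. continuous (at \<zeta> within D \<union> left_semicircle) f)"

text \<open>The value of a meromorphic function in the Riemann sphere; \<open>None\<close> is the point at infinity.\<close>

definition sphere_value :: "(complex \<Rightarrow> complex) \<Rightarrow> complex \<Rightarrow> complex option" where
  "sphere_value f z = (if is_pole f z then None else Some (f z))"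

text \<open>
  Nice meromorphy only normalises the values at isolated points: removable singularities are
  removed, and the (meaningless) complex value at a pole is 0.
\<close>

definition M_class :: "real \<Rightarrow> (complex \<Rightarrow> complex) set" where
  "M_class p =
     {f. f nicely_meromorphic_on unit_disc \<and>
         inj_on (sphere_value f) unit_disc \<and>
         is_pole f (complex_of_real p) \<and> zorder f (complex_of_real p) = -1 \<and>
         extends_continuously unit_disc f}"

definition M0_class :: "real \<Rightarrow> (complex \<Rightarrow> complex) set" where
  "M0_class p = {f \<in> M_class p. length_image_semicircle f < \<infinity>}"

definition Mt_class :: "real \<Rightarrow> (complex \<Rightarrow> complex) set" where
  "Mt_class p =
     {f. f holomorphic_on (unit_disc - closed_Delta p) \<and>
         inj_on f (unit_disc - closed_Delta p) \<and>
         extends_continuously (unit_disc - closed_Delta p) f}"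

definition Mt0_class :: "real \<Rightarrow> (complex \<Rightarrow> complex) set" where
  "Mt0_class p = {f \<in> Mt_class p. length_image_semicircle f < \<infinity>}"

text \<open>
  The denominators below never vanish: a function in one of the classes is not constant on the
  left semicircle.
\<close>

definition A_const :: "real \<Rightarrow> ennreal" where
  "A_const p = (SUP f \<in> M0_class p. length_image_diameter f / length_image_semicircle f)"

definition At_const :: "real \<Rightarrow> ennreal" where
  "At_const p = (SUP f \<in> Mt0_class p. length_image_diameter f / length_image_semicircle f)"

end

theory Submission
  imports Defs
begin

text \<open>
  The middle inequality holds because \<open>p\<close> lies on the boundary of the removed closed disc: away from
  that disc a function of the meromorphic class has no pole left, so it belongs to the analytic
  class, with the same two lengths.  The lower bound is attained by the univalent map
  \<open>z \<mapsto> z / ((1 - z/p) (1 - p z))\<close> of the disc onto the complement of a real slit: it takes the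
  left semicircle to a piece of the slit, run through twice, and the diameter to a full circle.

  For the upper bound, the disc without the removed disc contains the lens between the left
  semicircle and the circular arc through \<open>\<i>\<close>, \<open>p\<close> and \<open>-\<i>\<close>.  A logarithm maps this lens to the strip
  \<open>0 < Im w < \<pi>\<close>; the semicircle becomes the line \<open>Im w = \<pi>\<close> and the diameter a line \<open>Im w = \<phi>\<close>.
  The translations of the strip preserve both lines, so it suffices to bound the derivative of a
  univalent function \<open>F\<close> at one point \<open>x + \<i> \<phi>\<close> by the length of the image of the window of radius
  \<open>ln 4\<close> about \<open>x + \<i> \<pi>\<close> (\<open>strip_derivative_bound\<close>).  Windows whose centres differ by multiples of
  \<open>ln 16\<close> are disjoint, and integrating over one period gives a bound for the whole line
  (\<open>strip_line_length_bound\<close>).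

  The pointwise bound is proved after mapping the strip to the half-plane and the window to the
  negative axis (\<open>half_plane_derivative_bound\<close>).  Let \<open>a\<close> be a boundary value on the window, let
  \<open>\<bar>F - a\<bar> \<le> s\<close> there, and let \<open>M = \<bar>F - a\<bar>\<close> at the given point.  Koebe's one-quarter theorem
  bounds the derivative by \<open>M\<close>, because \<open>F\<close> omits \<open>a\<close>.  Conversely \<open>M\<close> is bounded by \<open>s\<close> and the
  derivative, by a length-area argument (\<open>slit_disc_radial_bound\<close>): the half-plane is the conformal
  image of a disc with a radial slit in which every other radius ends on the negative axis.  Regard
  \<open>F\<close> as a function on this slit disc, with the given point at its centre.  With
  \<open>k = (F - F 0) / (F - a)\<close>, the function \<open>ln \<bar>k\<bar>\<close> climbs along each radius from about
  \<open>ln (\<epsilon> \<bar>k' 0\<bar>)\<close> to at least \<open>ln ((M - s) / s)\<close>, whereas the univalence of \<open>k\<close> bounds the area of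
  the image under \<open>ln k\<close> between two levels by \<open>2 \<pi>\<close> times their difference
  (\<open>log_image_area\<close>, \<open>emeasure_log_annulus_le\<close>).  By Cauchy-Schwarz this forces
  \<open>M (M - s) \<le> s \<bar>F' 0\<bar>\<close>.  Both bounds together give \<open>M \<le> C s\<close> with an explicit \<open>C\<close>.
  Koebe's theorem itself follows from the same area count, applied to a Bieberbach-Eilenberg
  function \<open>b\<close>, whose image is disjoint from that of \<open>1 / b\<close>.

  With the window radius \<open>ln 4\<close> the resulting constant is
  \<open>(1 + p\<^sup>2) / p (20 + 400 / (9 p\<^sup>2)) ln 2\<close>.  Since \<open>400 / (9 p\<^sup>2) = (20 / (3 p))\<^sup>2\<close>, it lies
  strictly below the required one.
\<close>

section \<open>Area of conformal images in the plane\<close>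

text \<open>
  A map that only permutes coordinates preserves boxes and their volumes.  This transports Lebesgue
  measure between \<open>complex\<close>, \<open>real \<times> real\<close> (for Fubini) and \<open>real^2\<close> (for the change of variables).
\<close>

lemma distr_lborel_basis_bij:
  fixes T :: "'a::euclidean_space \<Rightarrow> 'b::euclidean_space"
  assumes T: "T \<in> borel_measurable borel" and \<sigma>: "bij_betw \<sigma> Basis Basis"
    and coord: "\<And>x b. b \<in> Basis \<Longrightarrow> T x \<bullet> \<sigma> b = x \<bullet> b"
  shows "distr lborel borel T = lborel"
proof (rule lborel_eqI[symmetric])
  have B: "(\<forall>c\<in>Basis. P c) \<longleftrightarrow> (\<forall>b\<in>Basis. P (\<sigma> b))" for P
    using \<sigma> by (metis bij_betwE bij_betw_imp_surj_on imageE)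
  fix l u :: 'b
  assume lu: "\<And>b. b \<in> Basis \<Longrightarrow> l \<bullet> b \<le> u \<bullet> b"
  define l' u' :: 'a where "l' = (\<Sum>b\<in>Basis. (l \<bullet> \<sigma> b) *\<^sub>R b)" and "u' = (\<Sum>b\<in>Basis. (u \<bullet> \<sigma> b) *\<^sub>R b)"
  have l': "l' \<bullet> b = l \<bullet> \<sigma> b" and u': "u' \<bullet> b = u \<bullet> \<sigma> b" if "b \<in> Basis" for b
    using that by (simp_all add: l'_def u'_def)
  have pre: "T -` box l u = box l' u'"
    by (auto simp: mem_box B coord l' u')
  have "emeasure (distr lborel borel T) (box l u) = emeasure lborel (box l' u')"
    using T by (simp add: emeasure_distr pre)
  also have "\<dots> = (\<Prod>b\<in>Basis. (u' - l') \<bullet> b)"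
  proof (rule emeasure_lborel_box)
    show "l' \<bullet> b \<le> u' \<bullet> b" if "b \<in> Basis" for b
      using that \<sigma> by (simp add: l' u' lu bij_betwE)
  qed
  also have "(\<Prod>b\<in>Basis. (u' - l') \<bullet> b) = (\<Prod>b\<in>Basis. (u - l) \<bullet> \<sigma> b)"
    by (intro prod.cong) (auto simp: inner_diff_left l' u')
  also have "\<dots> = (\<Prod>b\<in>Basis. (u - l) \<bullet> b)"
    using prod.reindex_bij_betw[OF \<sigma>, of "\<lambda>b. (u - l) \<bullet> b"] .
  finally show "emeasure (distr lborel borel T) (box l u) = ennreal (\<Prod>b\<in>Basis. (u - l) \<bullet> b)" .
qed simp

lemma distr_lborel_Complex_prod:
  "distr (lborel :: (real \<times> real) measure) borel (\<lambda>(x, y). Complex x y) = lborel"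
proof (rule distr_lborel_basis_bij)
  show "(\<lambda>(x, y). Complex x y) \<in> borel_measurable borel"
    unfolding Complex_eq case_prod_unfold
    by (intro borel_measurable_continuous_onI continuous_intros)
  have B: "(Basis :: (real \<times> real) set) = {(1, 0), (0, 1)}"
    by (auto simp: Basis_prod_def)
  show "bij_betw (\<lambda>(x, y). Complex x y) Basis Basis"
    by (auto simp: bij_betw_def B Basis_complex_def inj_on_def complex_eq_iff)
  show "(case x of (x, y) \<Rightarrow> Complex x y) \<bullet> (case b of (x, y) \<Rightarrow> Complex x y) = x \<bullet> b"
    if "b \<in> Basis" for x b :: "real \<times> real"
    by (cases x, cases b) (simp add: inner_complex_def)
qed

lemma nn_integral_complex_iterated:
  fixes f :: "complex \<Rightarrow> ennreal"
  assumes [measurable]: "f \<in> borel_measurable borel"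
  shows "(\<integral>\<^sup>+z. f z \<partial>lborel) = (\<integral>\<^sup>+x. \<integral>\<^sup>+y. f (Complex x y) \<partial>lborel \<partial>lborel)"
    and "(\<integral>\<^sup>+z. f z \<partial>lborel) = (\<integral>\<^sup>+y. \<integral>\<^sup>+x. f (Complex x y) \<partial>lborel \<partial>lborel)"
proof -
  have [measurable]: "(\<lambda>(x, y). Complex x y) \<in> borel_measurable borel"
    unfolding Complex_eq case_prod_unfold
    by (intro borel_measurable_continuous_onI continuous_intros)
  have [measurable]: "(\<lambda>(x, y). Complex x y) \<in> borel_measurable (lborel \<Otimes>\<^sub>M lborel)"
    unfolding lborel_prod by measurable
  have 1: "(\<integral>\<^sup>+z. f z \<partial>lborel) = (\<integral>\<^sup>+p. f (case p of (x, y) \<Rightarrow> Complex x y) \<partial>(lborel \<Otimes>\<^sub>M lborel))"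
    by (subst distr_lborel_Complex_prod[symmetric], subst nn_integral_distr) (auto simp: lborel_prod)
  have m: "(\<lambda>p. f (case p of (x, y) \<Rightarrow> Complex x y)) \<in> borel_measurable (lborel \<Otimes>\<^sub>M lborel)"
    by measurable
  show "(\<integral>\<^sup>+z. f z \<partial>lborel) = (\<integral>\<^sup>+x. \<integral>\<^sup>+y. f (Complex x y) \<partial>lborel \<partial>lborel)"
    unfolding 1 by (subst lborel.nn_integral_fst[OF m, symmetric]) simp
  show "(\<integral>\<^sup>+z. f z \<partial>lborel) = (\<integral>\<^sup>+y. \<integral>\<^sup>+x. f (Complex x y) \<partial>lborel \<partial>lborel)"
    unfolding 1
    by (subst lborel_pair.nn_integral_snd[symmetric]) (use m in \<open>auto simp: case_prod_unfold\<close>)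
qed

definition vec_to_complex :: "real^2 \<Rightarrow> complex" where
  "vec_to_complex x = Complex (x $ 1) (x $ 2)"

definition complex_to_vec :: "complex \<Rightarrow> real^2" where
  "complex_to_vec z = vector [Re z, Im z]"

lemma vec_to_complex_inverse [simp]:
  "complex_to_vec (vec_to_complex x) = x" "vec_to_complex (complex_to_vec z) = z"
  by (simp_all add: vec_to_complex_def complex_to_vec_def vec_eq_iff forall_2)

lemma bounded_linear_vec_to_complex: "bounded_linear vec_to_complex"
  by (rule linear_conv_bounded_linear[THEN iffD1])
     (auto simp: linear_iff vec_to_complex_def complex_eq_iff)

lemma bounded_linear_complex_to_vec: "bounded_linear complex_to_vec"
  by (rule linear_conv_bounded_linear[THEN iffD1])
     (auto simp: linear_iff complex_to_vec_def vec_eq_iff forall_2)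

lemma distr_lborel_vec_to_complex: "distr lborel borel vec_to_complex = lborel"
proof (rule distr_lborel_basis_bij)
  show "vec_to_complex \<in> borel_measurable borel"
    by (intro borel_measurable_continuous_onI linear_continuous_on bounded_linear_vec_to_complex)
  have B: "(Basis :: (real^2) set) = {axis 1 1, axis 2 1}"
    by (auto simp: Basis_vec_def exhaust_2) (metis exhaust_2)
  show "bij_betw vec_to_complex Basis Basis"
    by (auto simp: bij_betw_def B Basis_complex_def inj_on_def vec_to_complex_def complex_eq_iff axis_eq_axis axis_def)
  show "vec_to_complex x \<bullet> vec_to_complex b = x \<bullet> b" if "b \<in> Basis" for x b
    by (simp add: vec_to_complex_def inner_vec_def sum_2 inner_complex_def)
qed

lemma det_complex_mult:
  "det (matrix (\<lambda>x. complex_to_vec (c * vec_to_complex x))) = (norm c)\<^sup>2"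
  by (simp add: det_2 matrix_def complex_to_vec_def vec_to_complex_def axis_def norm_complex_def power2_eq_square)

lemma borel_measurable_ennreal_indicator:
  fixes f :: "'a::topological_space \<Rightarrow> real"
  assumes "open S" "continuous_on S f"
  shows "(\<lambda>z. ennreal (f z) * indicator S z) \<in> borel_measurable borel"
proof -
  have "(\<lambda>z. indicator S z *\<^sub>R f z) \<in> borel_measurable borel"
    using assms by (intro borel_measurable_continuous_on_indicator) auto
  hence "(\<lambda>z. ennreal (indicator S z *\<^sub>R f z)) \<in> borel_measurable borel"
    by (rule measurable_compose[OF _ measurable_ennreal])
  also have "(\<lambda>z. ennreal (indicator S z *\<^sub>R f z)) = (\<lambda>z. ennreal (f z) * indicator S z)"
    by (auto simp: indicator_def)
  finally show ?thesis .
qed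

text \<open>
  The change of variables formula in \<open>real^2\<close>; the Jacobian of a holomorphic map is the squared
  modulus of its derivative.  Boundedness makes the integral finite.
\<close>

lemma emeasure_holomorphic_image:
  assumes S: "open S" and hol: "g holomorphic_on S" and inj: "inj_on g S" and bnd: "bounded (g ` S)"
  shows "emeasure lborel (g ` S) = (\<integral>\<^sup>+z\<in>S. ennreal ((norm (deriv g z))\<^sup>2) \<partial>lborel)"
proof -
  define S' where "S' = vec_to_complex -` S"
  define h where "h = (\<lambda>x. complex_to_vec (g (vec_to_complex x)))"
  have [measurable]: "vec_to_complex \<in> borel_measurable borel"
    by (intro borel_measurable_continuous_onI linear_continuous_on bounded_linear_vec_to_complex)
  have [measurable]: "complex_to_vec \<in> borel_measurable borel"
    by (intro borel_measurable_continuous_onI linear_continuous_on bounded_linear_complex_to_vec)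
  have oS': "open S'"
    unfolding S'_def by (intro open_vimage S linear_continuous_on bounded_linear_vec_to_complex)
  have der: "(h has_derivative (\<lambda>x. complex_to_vec (deriv g (vec_to_complex v) * vec_to_complex x))) (at v within S')"
    if "v \<in> S'" for v
  proof -
    have "(g has_derivative (\<lambda>x. deriv g (vec_to_complex v) * x)) (at (vec_to_complex v))"
      using holomorphic_derivI[OF hol S] that unfolding S'_def has_field_derivative_def by auto
    hence "((\<lambda>x. g (vec_to_complex x)) has_derivative (\<lambda>x. deriv g (vec_to_complex v) * vec_to_complex x)) (at v within S')"
      by (rule has_derivative_compose[OF bounded_linear_imp_has_derivative[OF bounded_linear_vec_to_complex]])
    from bounded_linear.has_derivative[OF bounded_linear_complex_to_vec this]
    show ?thesis by (simp add: h_def)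
  qed
  have injh: "inj_on h S'"
    unfolding h_def S'_def inj_on_def
    by (metis inj inj_onD vec_to_complex_inverse vimageD)
  have img: "h ` S' = vec_to_complex -` (g ` S)"
  proof (intro equalityI subsetI)
    fix y assume "y \<in> vec_to_complex -` (g ` S)"
    then obtain z where z: "z \<in> S" "vec_to_complex y = g z" by auto
    have "y = h (complex_to_vec z)"
      unfolding h_def by (simp flip: z(2))
    thus "y \<in> h ` S'"
      using z(1) by (auto simp: S'_def)
  qed (auto simp: h_def S'_def)
  have ogS: "open (g ` S)"
    using open_mapping_thm3[OF hol S inj] .
  have ohS: "open (h ` S')"
    unfolding img by (intro open_vimage ogS linear_continuous_on bounded_linear_vec_to_complex)
  have "h ` S' = complex_to_vec ` (g ` S)"
    unfolding h_def S'_def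
    by (simp add: image_image[symmetric] surj_image_vimage_eq surj_def) (metis vec_to_complex_inverse(2) image_image surjI surj_image_vimage_eq)
  hence bhS: "bounded (h ` S')"
    using bounded_linear_image[OF bnd bounded_linear_complex_to_vec] by simp
  have lm: "h ` S' \<in> lmeasurable"
    by (rule bounded_set_imp_lmeasurable[OF bhS]) (use ohS in auto)
  have "emeasure lborel (g ` S) = emeasure (distr lborel borel vec_to_complex) (g ` S)"
    by (simp add: distr_lborel_vec_to_complex)
  also have "\<dots> = emeasure lborel (h ` S')"
    using ogS by (subst emeasure_distr) (auto simp: img)
  also have "\<dots> = ennreal (measure lebesgue (h ` S'))"
    using lm emeasure_eq_measure2[OF lm] ohS by (simp add: measure_def)
  finally have 1: "emeasure lborel (g ` S) = ennreal (measure lebesgue (h ` S'))" .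
  have "((\<lambda>x. \<bar>det (matrix (\<lambda>y. complex_to_vec (deriv g (vec_to_complex x) * vec_to_complex y)))\<bar>) has_integral 
      measure lebesgue (h ` S')) S'"
    using has_measure_differentiable_image[of S' h, THEN iffD1, OF _ der injh] lm oS' by auto
  hence "((\<lambda>x. (norm (deriv g (vec_to_complex x)))\<^sup>2) has_integral measure lebesgue (h ` S')) S'"
    by (simp add: det_complex_mult)
  from nn_integral_has_integral_lebesgue'[OF _ this]
  have 2: "(\<integral>\<^sup>+x. ennreal ((norm (deriv g (vec_to_complex x)))\<^sup>2) * indicator S' x \<partial>lborel) = ennreal (measure lebesgue (h ` S'))"
    by simp
  have "continuous_on S (\<lambda>z. (norm (deriv g z))\<^sup>2)"
    by (intro continuous_intros holomorphic_on_imp_continuous_on holomorphic_deriv hol S)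
  hence m: "(\<lambda>z. ennreal ((norm (deriv g z))\<^sup>2) * indicator S z) \<in> borel_measurable borel"
    using S by (rule borel_measurable_ennreal_indicator[rotated])
  have "(\<integral>\<^sup>+z\<in>S. ennreal ((norm (deriv g z))\<^sup>2) \<partial>lborel) = 
     (\<integral>\<^sup>+x. ennreal ((norm (deriv g (vec_to_complex x)))\<^sup>2) * indicator S (vec_to_complex x) \<partial>lborel)"
    by (subst distr_lborel_vec_to_complex[symmetric], subst nn_integral_distr) (use m in auto)
  also have "\<dots> = (\<integral>\<^sup>+x. ennreal ((norm (deriv g (vec_to_complex x)))\<^sup>2) * indicator S' x \<partial>lborel)"
    by (intro nn_integral_cong) (auto simp: S'_def indicator_def)
  finally have "(\<integral>\<^sup>+z\<in>S. ennreal ((norm (deriv g z))\<^sup>2) \<partial>lborel) = \<dots>" .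
  with 1 2 show ?thesis by simp
qed

text \<open>
  The set \<open>A\<close> is the image of \<open>X\<close> under the principal branch of \<open>Ln g\<close>.  Its cut is harmless: the
  points that \<open>g\<close> sends to the negative axis form a null set, being the image of a null set under
  the holomorphic inverse of \<open>g\<close>.  The second property of \<open>A\<close> allows one to conclude that the sets
  belonging to functions with disjoint images are disjoint.
\<close>

lemma log_image_area:
  assumes X: "open X" and hol: "g holomorphic_on X" and inj: "inj_on g X" 
    and m: "0 < m" and bd: "\<And>z. z \<in> X \<Longrightarrow> m < norm (g z) \<and> norm (g z) < T"
  obtains A where "A \<in> sets borel" "exp ` A \<subseteq> g ` X"
    "A \<subseteq> {w. Re w \<in> {ln m<..<ln T} \<and> Im w \<in> {-pi<..<pi}}"
    "emeasure lborel A = (\<integral>\<^sup>+z\<in>X. ennreal ((norm (deriv g z / g z))\<^sup>2) \<partial>lborel)"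
proof -
  define X' where "X' = X \<inter> g -` (- \<real>\<^sub>\<le>\<^sub>0)"
  have nz: "g z \<noteq> 0" if "z \<in> X" for z
    using bd[OF that] m by auto
  have cg: "continuous_on X g"
    using hol by (rule holomorphic_on_imp_continuous_on)
  have X': "open X'"
    unfolding X'_def by (intro continuous_open_preimage cg X open_Compl closed_nonpos_Reals_complex)
  have sub: "X' \<subseteq> X" by (auto simp: X'_def)
  define L where "L = (\<lambda>z. Ln (g z))"
  have expL: "exp (L z) = g z" if "z \<in> X" for z
    using nz[OF that] by (simp add: L_def)
  have holL: "L holomorphic_on X'"
    unfolding L_def
    by (rule holomorphic_on_Ln') (use holomorphic_on_subset[OF hol sub] in \<open>auto simp: X'_def\<close>)
  have injL: "inj_on L X'"
    using sub by (intro inj_onI) (metis expL inj inj_onD subsetD)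
  have derL: "deriv L z = deriv g z / g z" if "z \<in> X'" for z
  proof (rule DERIV_imp_deriv)
    have "(g has_field_derivative deriv g z) (at z)"
      using holomorphic_derivI[OF hol X] sub that by auto
    thus "(L has_field_derivative deriv g z / g z) (at z)"
      unfolding L_def using that by (auto intro!: derivative_eq_intros simp: X'_def field_simps)
  qed
  have rng: "L ` X' \<subseteq> {w. Re w \<in> {ln m<..<ln T} \<and> Im w \<in> {-pi<..<pi}}"
  proof
    fix w assume "w \<in> L ` X'"
    then obtain z where z: "z \<in> X'" "w = Ln (g z)" by (auto simp: L_def)
    have "z \<in> X" using sub z by auto
    have "g z \<noteq> 0" "m < norm (g z)" "norm (g z) < T" 
      using nz bd \<open>z \<in> X\<close> by auto
    moreover have "Im (Ln (g z)) < pi"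
      using \<open>g z \<noteq> 0\<close> z(1) Im_Ln_eq_pi[of "g z"] Im_Ln_le_pi[of "g z"]
      by (force simp: X'_def complex_nonpos_Reals_iff)
    ultimately show "w \<in> {w. Re w \<in> {ln m<..<ln T} \<and> Im w \<in> {-pi<..<pi}}"
      using z m mpi_less_Im_Ln[of "g z"] by auto
  qed
  have "{w. Re w \<in> {ln m<..<ln T} \<and> Im w \<in> {-pi<..<pi}} = box (Complex (ln m) (-pi)) (Complex (ln T) pi)"
    by (auto simp: in_box_complex_iff)
  hence bnd: "bounded (L ` X')"
    using rng bounded_subset[OF bounded_box] by metis
  obtain h where h: "h holomorphic_on (g ` X)" "\<And>z. z \<in> X \<Longrightarrow> h (g z) = z"
    using holomorphic_has_inverse[OF hol X inj] by metis
  have "negligible (g ` X \<inter> \<real>\<^sub>\<le>\<^sub>0)"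
    by (rule negligible_subset[OF negligible_hyperplane[of \<i> 0]])
       (auto simp: inner_complex_def complex_nonpos_Reals_iff)
  hence "negligible (h ` (g ` X \<inter> \<real>\<^sub>\<le>\<^sub>0))"
    by (rule negligible_differentiable_image_negligible[rotated])
       (use h(1) open_mapping_thm3[OF hol X inj] in \<open>auto intro!: differentiable_on_subset[OF holomorphic_on_imp_differentiable_on]\<close>)
  moreover have "h ` (g ` X \<inter> \<real>\<^sub>\<le>\<^sub>0) = X - X'"
    using h(2) by (force simp: X'_def image_iff)
  ultimately have neg: "negligible (X - X')" by simp
  have "X - X' \<in> sets borel" using X X' by auto
  with neg have null: "X - X' \<in> null_sets lborel"
    by (simp add: negligible_iff_null_sets null_sets_completion_iff)
  show ?thesis
  proof
    show "L ` X' \<in> sets borel"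
      using open_mapping_thm3[OF holL X' injL] by auto
    show "exp ` L ` X' \<subseteq> g ` X" using expL sub by auto
    show "L ` X' \<subseteq> {w. Re w \<in> {ln m<..<ln T} \<and> Im w \<in> {-pi<..<pi}}" by (rule rng)
    have "emeasure lborel (L ` X') = (\<integral>\<^sup>+z\<in>X'. ennreal ((norm (deriv L z))\<^sup>2) \<partial>lborel)"
      by (rule emeasure_holomorphic_image) fact+
    also have "\<dots> = (\<integral>\<^sup>+z\<in>X. ennreal ((norm (deriv g z / g z))\<^sup>2) \<partial>lborel)"
      by (rule nn_integral_cong_AE, rule AE_mp[OF AE_not_in[OF null]])
         (use sub in \<open>auto simp: derL indicator_def\<close>)
    finally show "emeasure lborel (L ` X') = (\<integral>\<^sup>+z\<in>X. ennreal ((norm (deriv g z / g z))\<^sup>2) \<partial>lborel)" .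
  qed
qed

lemma emeasure_log_annulus_le:
  assumes "A \<in> sets borel" "A \<subseteq> {w. Re w \<in> {a<..<b} \<and> Im w \<in> {-pi<..<pi}}" "a \<le> b"
  shows "emeasure lborel A \<le> ennreal (2 * pi * (b - a))"
proof -
  have "{w. Re w \<in> {a<..<b} \<and> Im w \<in> {-pi<..<pi}} = box (Complex a (-pi)) (Complex b pi)"
    by (auto simp: in_box_complex_iff)
  hence "emeasure lborel A \<le> emeasure lborel (box (Complex a (-pi)) (Complex b pi))"
    using assms by (intro emeasure_mono) auto
  also have "\<dots> = ennreal (\<Prod>b'\<in>Basis. (Complex b pi - Complex a (-pi)) \<bullet> b')"
    using \<open>a \<le> b\<close> by (intro emeasure_lborel_box) (auto simp: Basis_complex_def)
  also have "(\<Prod>b'\<in>Basis. (Complex b pi - Complex a (-pi)) \<bullet> b') = (2 * pi * (b - a))"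
    by (simp add: Basis_complex_def algebra_simps)
  finally show ?thesis .
qed

section \<open>Koebe's one-quarter theorem\<close>

text \<open>
  The mean of \<open>q\<close> over a circle is \<open>q 0 = 1\<close>, and \<open>\<bar>q\<bar>\<^sup>2 \<ge> 2 Re q - 1\<close>.
\<close>

lemma mean_norm_square_ge:
  assumes q: "q holomorphic_on ball 0 1" "q 0 = 1" and r: "0 < r" "r < 1"
  shows "ennreal (2 * pi) \<le> (\<integral>\<^sup>+y\<in>{0<..<2*pi}. ennreal ((norm (q (of_real r * cis y)))\<^sup>2) \<partial>lborel)"
proof -
  have cq: "continuous_on (ball 0 1) q"
    using q(1) by (rule holomorphic_on_imp_continuous_on)
  have inb: "of_real r * cis y \<in> ball 0 1" for y
    using r by (simp add: norm_mult)
  have "((\<lambda>u. q u/(u-0)) has_contour_integral (2 * of_real pi * \<i> * q 0)) (circlepath 0 r)"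
    by (rule Cauchy_integral_circlepath)
       (use r in \<open>auto intro!: continuous_on_subset[OF cq] holomorphic_on_subset[OF q(1)]\<close>)
  hence "((\<lambda>t. q (of_real r * cis t) * \<i>) has_integral (2 * pi * \<i>)) {0..2*pi}"
    unfolding circlepath_def using r
    by (subst (asm) has_contour_integral_part_circlepath_iff) (auto simp: q(2) field_simps)
  from has_integral_Im[OF this]
  have "((\<lambda>t. Re (q (of_real r * cis t))) has_integral (2 * pi)) {0..2*pi}"
    by simp
  hence "((\<lambda>t. 2 * Re (q (of_real r * cis t)) - 1) has_integral (2 * (2 * pi) - 1 * (2 * pi - 0))) {0..2*pi}"
    by (intro has_integral_diff has_integral_mult_right) (use has_integral_const_real[of "1::real" 0 "2*pi"] in auto)
  hence 1: "((\<lambda>t. 2 * Re (q (of_real r * cis t)) - 1) has_integral (2 * pi)) {0..2*pi}"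
    by simp
  have "continuous_on {0..2*pi} (\<lambda>y. (norm (q (of_real r * cis y)))\<^sup>2)"
    by (intro continuous_intros continuous_on_compose2[OF cq]) (use inb in auto)
  hence "(\<lambda>y. (norm (q (of_real r * cis y)))\<^sup>2) integrable_on {0..2*pi}"
    by (rule integrable_continuous_real)
  then obtain J where J: "((\<lambda>y. (norm (q (of_real r * cis y)))\<^sup>2) has_integral J) {0..2*pi}"
    by blast
  have "2 * pi \<le> J"
  proof (rule has_integral_le[OF 1 J])
    fix y
    have "0 \<le> (norm (q (of_real r * cis y) - 1))\<^sup>2" by simp
    also have "\<dots> = (norm (q (of_real r * cis y)))\<^sup>2 - 2 * Re (q (of_real r * cis y)) + 1"
      by (simp only: cmod_power2) (simp add: power2_eq_square algebra_simps)
    finally show "2 * Re (q (of_real r * cis y)) - 1 \<le> (norm (q (of_real r * cis y)))\<^sup>2" by simp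
  qed
  moreover have "((\<lambda>y. (norm (q (of_real r * cis y)))\<^sup>2) has_integral J) {0<..<2*pi}"
    using J has_integral_Icc_iff_Ioo by blast
  from nn_integral_has_integral_lebesgue'[OF _ this]
  have "(\<integral>\<^sup>+y\<in>{0<..<2*pi}. ennreal ((norm (q (of_real r * cis y)))\<^sup>2) \<partial>lborel) = ennreal J" by simp
  ultimately show ?thesis by (simp add: ennreal_leI)
qed

text \<open>
  The exponential maps this rectangle bijectively to the annulus \<open>\<epsilon> < \<bar>z\<bar> < 1\<close> without its positive
  radius, so polar coordinates become Cartesian ones.
\<close>

definition log_rect :: "real \<Rightarrow> complex set" where
  "log_rect \<epsilon> = {\<eta>. Re \<eta> \<in> {ln \<epsilon><..<0} \<and> Im \<eta> \<in> {0<..<2*pi}}"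

lemma open_log_rect: "open (log_rect \<epsilon>)"
proof -
  have "log_rect \<epsilon> = box (Complex (ln \<epsilon>) 0) (Complex 0 (2 * pi))"
    by (auto simp: log_rect_def in_box_complex_iff)
  thus ?thesis by (simp add: open_box)
qed

lemma inj_on_exp_log_rect: "inj_on exp (log_rect \<epsilon>)"
proof (rule inj_onI)
  fix x y assume xy: "x \<in> log_rect \<epsilon>" "y \<in> log_rect \<epsilon>" "exp x = exp y"
  then obtain n :: int where n: "x = y + (of_int (2 * n) * pi) * \<i>"
    by (auto simp: exp_eq)
  hence I: "Im x = Im y + 2 * pi * of_int n" by simp
  have "\<bar>Im x - Im y\<bar> < 2 * pi"
    using xy unfolding log_rect_def by auto
  hence "2 * pi * \<bar>of_int n\<bar> < 2 * pi * 1"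
    using I by (simp add: abs_mult)
  hence "\<bar>real_of_int n\<bar> < 1"
    by (subst (asm) mult_less_cancel_left_pos) auto
  hence "n = 0" by linarith
  thus "x = y" using n by simp
qed


lemma exp_log_rect:
  assumes "\<eta> \<in> log_rect \<epsilon>" "0 < \<epsilon>"
  shows "\<epsilon> < norm (exp \<eta>) \<and> norm (exp \<eta>) < 1"
proof -
  have "exp (ln \<epsilon>) < exp (Re \<eta>)" "exp (Re \<eta>) < exp 0"
    using assms by (simp_all only: exp_less_cancel_iff log_rect_def mem_Collect_eq greaterThanLessThan_iff)
  thus ?thesis using assms by (simp add: norm_exp_eq_Re)
qed

text \<open>
  On the annulus \<open>\<epsilon> < \<bar>z\<bar> < 1\<close> the image under \<open>ln b\<close> has area at least \<open>2 \<pi> ln (1/\<epsilon>)\<close>, since the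
  logarithmic derivative \<open>z b' z / b z\<close> has mean 1 over every circle.  The images of \<open>b\<close> and \<open>1 / b\<close>
  are disjoint and both lie in \<open>m \<le> \<bar>w\<bar> \<le> 1 / m\<close>, where \<open>m\<close> is the minimum of \<open>\<bar>b\<bar>\<close> on
  \<open>\<bar>z\<bar> = \<epsilon>\<close>; this leaves for each at most the area \<open>2 \<pi> ln (1/m)\<close>.  Hence \<open>m \<le> \<epsilon>\<close>, and \<open>m / \<epsilon>\<close>
  tends to \<open>\<bar>b' 0\<bar>\<close>.
\<close>

lemma bieberbach_eilenberg_univalent:
  assumes hol: "b holomorphic_on ball 0 1" and inj: "inj_on b (ball 0 1)" and b0: "b 0 = 0"
    and BE: "\<And>z w. z \<in> ball 0 1 \<Longrightarrow> w \<in> ball 0 1 \<Longrightarrow> b z * b w \<noteq> 1"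
  shows "norm (deriv b 0) \<le> 1"
proof -
  let ?D = "ball (0::complex) 1"
  have cb: "continuous_on ?D b" using hol by (rule holomorphic_on_imp_continuous_on)
  have bnz: "b z \<noteq> 0" if "z \<in> ?D" "z \<noteq> 0" for z
    using inj_onD[OF inj, of z 0] that b0 by auto
  define c where "c = (\<lambda>z. if z = 0 then deriv b 0 else (b z - b 0) / (z - 0))"
  have holc: "c holomorphic_on ?D"
    unfolding c_def by (rule pole_lemma_open) (use hol in auto)
  have bc: "b z = z * c z" for z using b0 by (simp add: c_def)
  have d0: "deriv b 0 \<noteq> 0"
    by (rule holomorphic_injective_imp_regular[OF hol _ inj]) auto
  have cnz: "c z \<noteq> 0" if "z \<in> ?D" for z
    using bnz[OF that] d0 by (auto simp: c_def b0)
  define q where "q = (\<lambda>z. 1 + z * deriv c z / c z)"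
  have q: "q holomorphic_on ?D" "q 0 = 1"
    unfolding q_def using cnz by (auto intro!: holomorphic_intros holc holomorphic_deriv)
  have dbq: "z * deriv b z / b z = q z" if z: "z \<in> ?D" "z \<noteq> 0" for z
  proof -
    have "(c has_field_derivative deriv c z) (at z)"
      using holomorphic_derivI[OF holc _ z(1)] by simp
    hence "((\<lambda>z. z * c z) has_field_derivative z * deriv c z + 1 * c z) (at z)"
      by (auto intro!: derivative_eq_intros)
    hence "deriv (\<lambda>z. z * c z) z = z * deriv c z + c z" by (simp add: DERIV_imp_deriv)
    moreover have "b = (\<lambda>z. z * c z)" using bc by auto
    ultimately show ?thesis using z cnz[OF z(1)] bc by (simp add: q_def field_simps)
  qed
  have key: "\<exists>z. norm z = \<epsilon> \<and> norm (b z) \<le> \<epsilon>" if \<epsilon>: "0 < \<epsilon>" "\<epsilon> < 1" for \<epsilon>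
  proof -
    have "continuous_on (sphere 0 \<epsilon>) (\<lambda>z. norm (b z))"
      by (intro continuous_intros continuous_on_subset[OF cb]) (use \<epsilon> in auto)
    from continuous_attains_inf[OF _ _ this]
    obtain z0 where z0: "norm z0 = \<epsilon>" "\<And>z. norm z = \<epsilon> \<Longrightarrow> norm (b z0) \<le> norm (b z)"
      using \<epsilon> by auto
    define m where "m = norm (b z0)"
    have m: "0 < m" using bnz[of z0] z0 \<epsilon> by (auto simp: m_def)
    have cov: "ball 0 m \<subseteq> b ` ball 0 \<epsilon>"
    proof -
      have "ball (b 0) m \<subseteq> b ` ball 0 \<epsilon>"
      proof (rule ball_subset_open_map_image)
        have sub: "ball (0::complex) \<epsilon> \<subseteq> ?D" using \<epsilon> by auto
        show "continuous_on (closure (ball 0 \<epsilon>)) b"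
          by (rule continuous_on_subset[OF cb]) (use \<epsilon> in auto)
        show "open (b ` interior (ball 0 \<epsilon>))"
          using open_mapping_thm3[OF holomorphic_on_subset[OF hol sub] _ inj_on_subset[OF inj sub]] by simp
        show "m \<le> norm (b z - b 0)" if "z \<in> frontier (ball 0 \<epsilon>)" for z
          using that z0 \<epsilon> by (simp add: m_def b0 frontier_ball)
      qed (use \<epsilon> m in auto)
      thus ?thesis by (simp add: b0)
    qed
    \<comment> \<open>Values of modulus less than \<open>m\<close> are taken in \<open>\<bar>z\<bar> < \<epsilon>\<close>, hence by injectivity nowhere else.\<close>
    have low: "m \<le> norm (b z)" if z: "z \<in> ?D" "\<epsilon> \<le> norm z" for z
    proof (rule ccontr)
      assume "\<not> m \<le> norm (b z)"
      hence "b z \<in> ball 0 m" by simp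
      then obtain y where y: "norm y < \<epsilon>" "b z = b y" using cov by force
      hence "z = y" using inj_onD[OF inj, of z y] z \<epsilon> by auto
      thus False using y z by auto
    qed
    have up: "norm (b z) \<le> 1 / m" if z: "z \<in> ?D" "z \<noteq> 0" for z
    proof (rule ccontr)
      assume "\<not> norm (b z) \<le> 1 / m"
      hence "1 < m * norm (b z)" using m by (simp add: field_simps)
      hence "1 / b z \<in> ball 0 m" using bnz[OF z] by (simp add: norm_divide divide_less_eq)
      then obtain y where y: "norm y < \<epsilon>" "1 / b z = b y" using cov by force
      hence "b z * b y = 1" using bnz[OF z] by (metis nonzero_eq_divide_eq mult.commute)
      thus False using BE[of z y] z y \<epsilon> by auto
    qed
    define E where "E = (\<lambda>\<eta>. b (exp \<eta>))"
    let ?X = "log_rect \<epsilon>"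
    have expX: "exp \<eta> \<in> ?D" "\<epsilon> \<le> norm (exp \<eta>)" if "\<eta> \<in> ?X" for \<eta>
      using exp_log_rect[OF that] \<epsilon> by auto
    have img: "exp ` ?X \<subseteq> ?D" using expX(1) by blast
    have holE: "E holomorphic_on ?X"
      unfolding E_def using holomorphic_on_compose_gen[OF holomorphic_on_exp hol img]
      by (simp add: o_def)
    have injE: "inj_on E ?X"
      unfolding E_def using comp_inj_on[OF inj_on_exp_log_rect inj_on_subset[OF inj img]]
      by (simp add: o_def)
    have Enz: "E \<eta> \<noteq> 0" if "\<eta> \<in> ?X" for \<eta>
      using bnz expX[OF that] by (auto simp: E_def)
    have dE: "deriv E \<eta> / E \<eta> = q (exp \<eta>)" if "\<eta> \<in> ?X" for \<eta>
    proof -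
      have "(b has_field_derivative deriv b (exp \<eta>)) (at (exp \<eta>))"
        using holomorphic_derivI[OF hol _ expX(1)[OF that]] by simp
      hence "(E has_field_derivative deriv b (exp \<eta>) * exp \<eta>) (at \<eta>)"
        unfolding E_def by (rule DERIV_chain2) (rule DERIV_exp)
      hence "deriv E \<eta> = deriv b (exp \<eta>) * exp \<eta>" by (rule DERIV_imp_deriv)
      thus ?thesis using dbq[OF expX(1)[OF that]] by (simp add: E_def mult.commute)
    qed
    define J where "J = (\<integral>\<^sup>+\<eta>\<in>?X. ennreal ((norm (q (exp \<eta>)))\<^sup>2) \<partial>lborel)"
    have JE: "(\<integral>\<^sup>+\<eta>\<in>?X. ennreal ((norm (deriv E \<eta> / E \<eta>))\<^sup>2) \<partial>lborel) = J"
      unfolding J_def by (intro nn_integral_cong) (auto simp: indicator_def dE)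
    \<comment> \<open>Strict bounds \<open>m' < \<bar>E\<bar> < 1 / m'\<close> are needed, hence \<open>m'\<close> slightly below \<open>m\<close>.\<close>
    have upper: "J \<le> ennreal (2 * pi * (- ln m'))" if m': "0 < m'" "m' < m" for m'
    proof -
      have "m' < norm (E \<eta>) \<and> norm (E \<eta>) < 1 / m'" if "\<eta> \<in> ?X" for \<eta>
      proof -
        have "1 / m < 1 / m'" using m' by (simp add: frac_less2)
        thus ?thesis
          using low[OF expX[OF that]] up[OF expX(1)[OF that]] m' by (auto simp: E_def)
      qed note bd = this
      obtain A where A: "A \<in> sets borel" "exp ` A \<subseteq> E ` ?X"
         "A \<subseteq> {w. Re w \<in> {ln m'<..<ln (1/m')} \<and> Im w \<in> {-pi<..<pi}}" "emeasure lborel A = J"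
        by (rule log_image_area[OF open_log_rect holE injE m'(1) bd, unfolded JE]) (assumption, rule that)
      define E2 where "E2 = (\<lambda>\<eta>. inverse (E \<eta>))"
      have E2: "E2 holomorphic_on ?X" "inj_on E2 ?X"
        using holE Enz injE unfolding E2_def by (auto intro!: holomorphic_intros simp: inj_on_def)
      have "m' < norm (E2 \<eta>) \<and> norm (E2 \<eta>) < 1 / m'" if "\<eta> \<in> ?X" for \<eta>
        using bd[OF that] m'(1) less_imp_inverse_less[of m' "norm (E \<eta>)"]
          less_imp_inverse_less[of "norm (E \<eta>)" "1 / m'"] Enz[OF that]
        by (auto simp: E2_def norm_divide inverse_eq_divide)
      note bd2 = this
      have "deriv E2 \<eta> / E2 \<eta> = - (deriv E \<eta> / E \<eta>)" if "\<eta> \<in> ?X" for \<eta>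
      proof -
        have "(E has_field_derivative deriv E \<eta>) (at \<eta>)"
          using holomorphic_derivI[OF holE open_log_rect that] .
        hence "(E2 has_field_derivative - (inverse (E \<eta>) * deriv E \<eta> * inverse (E \<eta>))) (at \<eta>)"
          unfolding E2_def using Enz[OF that] by (rule DERIV_inverse')
        hence "deriv E2 \<eta> = - (inverse (E \<eta>) * deriv E \<eta> * inverse (E \<eta>))" by (rule DERIV_imp_deriv)
        thus ?thesis using Enz[OF that] by (simp add: E2_def field_simps)
      qed
      hence nE2: "norm (deriv E2 \<eta> / E2 \<eta>) = norm (q (exp \<eta>))" if "\<eta> \<in> ?X" for \<eta>
        using that by (simp only: dE norm_minus_cancel)
      have JE2: "(\<integral>\<^sup>+\<eta>\<in>?X. ennreal ((norm (deriv E2 \<eta> / E2 \<eta>))\<^sup>2) \<partial>lborel) = J"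
        unfolding J_def
      proof (intro nn_integral_cong)
        fix \<eta> show "ennreal ((norm (deriv E2 \<eta> / E2 \<eta>))\<^sup>2) * indicator ?X \<eta> = ennreal ((norm (q (exp \<eta>)))\<^sup>2) * indicator ?X \<eta>"
          by (cases "\<eta> \<in> ?X") (simp_all only: nE2 indicator_simps(2) mult_zero_right not_False_eq_True)
      qed
      obtain B where B: "B \<in> sets borel" "exp ` B \<subseteq> E2 ` ?X"
         "B \<subseteq> {w. Re w \<in> {ln m'<..<ln (1/m')} \<and> Im w \<in> {-pi<..<pi}}" "emeasure lborel B = J"
        by (rule log_image_area[OF open_log_rect E2 m'(1) bd2, unfolded JE2]) (assumption, rule that)
      have disj: "A \<inter> B = {}"
      proof (rule equals0I)
        fix w assume "w \<in> A \<inter> B"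
        hence "exp w \<in> E ` ?X" "exp w \<in> E2 ` ?X" using A(2) B(2) by blast+
        then obtain x y where xy: "x \<in> ?X" "y \<in> ?X" "exp w = E x" "exp w = E2 y" by blast
        hence "E x = inverse (E y)" by (simp add: E2_def)
        hence "E x * E y = 1" using Enz[OF xy(2)] by simp
        thus False using BE[of "exp x" "exp y"] expX xy by (auto simp: E_def)
      qed
      have "2 * J = emeasure lborel A + emeasure lborel B" using A B by (simp add: mult_2)
      also have "\<dots> = emeasure lborel (A \<union> B)"
        using A B disj by (intro plus_emeasure) auto
      also have "\<dots> \<le> ennreal (2 * pi * (ln (1 / m') - ln m'))"
      proof (rule emeasure_log_annulus_le)
        have "m' < 1 / m'" 
          using bd[of "Complex (ln \<epsilon> / 2) pi"] \<epsilon> by (auto simp: log_rect_def)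
        thus "ln m' \<le> ln (1 / m')" using m' by (subst ln_le_cancel_iff) auto
      qed (use A B in auto)
      also have "ln (1 / m') - ln m' = 2 * (- ln m')" using m' by (simp add: ln_div)
      also have "2 * pi * (2 * (- ln m')) = 2 * (2 * pi * (- ln m'))" by simp
      also have "ennreal \<dots> = 2 * ennreal (2 * pi * (- ln m'))"
        by (subst ennreal_mult') simp_all
      finally show ?thesis by (simp add: ennreal_mult_le_mult_iff)
    qed
    have lower: "ennreal (2 * pi * (- ln \<epsilon>)) \<le> J"
    proof -
      have "continuous_on ?X (\<lambda>\<eta>. (norm (q (exp \<eta>)))\<^sup>2)"
        using expX by (intro continuous_intros continuous_on_compose2[OF holomorphic_on_imp_continuous_on[OF q(1)]]) auto
      from borel_measurable_ennreal_indicator[OF open_log_rect this]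
      have "J = (\<integral>\<^sup>+x. \<integral>\<^sup>+y. ennreal ((norm (q (exp (Complex x y))))\<^sup>2) * indicator ?X (Complex x y) \<partial>lborel \<partial>lborel)"
        unfolding J_def by (rule nn_integral_complex_iterated)
      also have "\<dots> \<ge> (\<integral>\<^sup>+x. ennreal (2 * pi) * indicator {ln \<epsilon><..<0} x \<partial>lborel)"
      proof (intro nn_integral_mono)
        fix x :: real
        show "ennreal (2 * pi) * indicator {ln \<epsilon><..<0} x \<le> 
           (\<integral>\<^sup>+y. ennreal ((norm (q (exp (Complex x y))))\<^sup>2) * indicator ?X (Complex x y) \<partial>lborel)"
        proof (cases "x \<in> {ln \<epsilon><..<0}")
          case True
          have "ennreal (2 * pi) \<le> (\<integral>\<^sup>+y\<in>{0<..<2*pi}. ennreal ((norm (q (of_real (exp x) * cis y)))\<^sup>2) \<partial>lborel)"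
            by (rule mean_norm_square_ge) (use True q in auto)
          also have "\<dots> = (\<integral>\<^sup>+y. ennreal ((norm (q (exp (Complex x y))))\<^sup>2) * indicator ?X (Complex x y) \<partial>lborel)"
            using True by (intro nn_integral_cong) (auto simp: indicator_def log_rect_def exp_eq_polar)
          finally show ?thesis using True by simp
        qed auto
      qed
      also have "(\<integral>\<^sup>+x. ennreal (2 * pi) * indicator {ln \<epsilon><..<0} x \<partial>lborel) = ennreal (2 * pi * (- ln \<epsilon>))"
        using \<epsilon> by (simp add: nn_integral_cmult_indicator ennreal_mult'[symmetric])
      finally show ?thesis .
    qed
    have "m' \<le> \<epsilon>" if m': "0 < m'" "m' < m" for m'
    proof -
      have "ennreal (2 * pi * (- ln \<epsilon>)) \<le> ennreal (2 * pi * (- ln m'))"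
        using lower upper[OF m'] by (rule order_trans)
      moreover have "0 < 2 * pi * (- ln \<epsilon>)"
        using \<epsilon> by (intro mult_pos_pos) auto
      ultimately have "2 * pi * (- ln \<epsilon>) \<le> 2 * pi * (- ln m')"
        unfolding ennreal_le_iff2 by linarith
      hence "- ln \<epsilon> \<le> - ln m'" by (subst (asm) mult_le_cancel_left_pos) auto
      thus ?thesis using m' \<epsilon> by simp
    qed
    hence "m \<le> \<epsilon>" using m by (intro dense_le_bounded[of 0 m]) auto
    thus ?thesis using z0 by (auto simp: m_def)
  qed
  show ?thesis
  proof (rule ccontr)
    assume "\<not> norm (deriv b 0) \<le> 1"
    hence "1 < norm (c 0)" by (simp add: c_def)
    moreover have "isCont c 0"
      using holc by (intro continuous_on_interior[OF holomorphic_on_imp_continuous_on[OF holc]]) auto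
    hence "((\<lambda>z. norm (c z)) \<longlongrightarrow> norm (c 0)) (at 0)"
      by (intro tendsto_norm) (simp add: isCont_def)
    ultimately have "eventually (\<lambda>z. 1 < norm (c z)) (at 0)"
      by (intro order_tendstoD)
    then obtain d where d: "d > 0" "\<And>z. z \<noteq> 0 \<Longrightarrow> norm z < d \<Longrightarrow> 1 < norm (c z)"
      unfolding eventually_at by (auto simp: dist_norm)
    define \<epsilon> where "\<epsilon> = min (d / 2) (1 / 2)"
    have \<epsilon>: "0 < \<epsilon>" "\<epsilon> < 1" "\<epsilon> < d" using d by (auto simp: \<epsilon>_def)
    then obtain z where z: "norm z = \<epsilon>" "norm (b z) \<le> \<epsilon>" using key by blast
    have "1 < norm (c z)" using d(2)[of z] z \<epsilon> by auto
    hence "\<epsilon> < norm z * norm (c z)" using z \<epsilon> by auto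
    thus False using z by (simp add: bc norm_mult)
  qed
qed

text \<open>
  If \<open>g\<close> is a square root of \<open>F - a\<close>, then \<open>g\<close> never takes opposite values, so
  \<open>(g - g 0) / (g + g 0)\<close> is a univalent Bieberbach-Eilenberg function.
\<close>

theorem Koebe_quarter_omitted_value:
  assumes hol: "F holomorphic_on ball 0 1" and inj: "inj_on F (ball 0 1)" and a: "a \<notin> F ` ball 0 1"
  shows "norm (deriv F 0) \<le> 4 * norm (F 0 - a)"
proof -
  let ?D = "ball (0::complex) 1"
  obtain g where g: "g holomorphic_on ?D" "\<And>z. z \<in> ?D \<Longrightarrow> F z - a = g z ^ 2"
  proof (rule contractible_imp_holomorphic_sqrt[of "\<lambda>z. F z - a" ?D])
    show "(\<lambda>z. F z - a) holomorphic_on ?D" by (intro holomorphic_intros hol)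
    show "F z - a \<noteq> 0" if "z \<in> ?D" for z using a that by auto
  qed (auto intro: convex_imp_contractible)
  have gnz: "g z \<noteq> 0" if "z \<in> ?D" for z using g(2)[OF that] a that by auto
  have sq: "z = w" if "z \<in> ?D" "w \<in> ?D" "g z ^ 2 = g w ^ 2" for z w
    using inj_onD[OF inj, of z w] g(2) that by (metis diff_add_cancel)
  have neg: "g z + g w \<noteq> 0" if "z \<in> ?D" "w \<in> ?D" for z w
  proof
    assume "g z + g w = 0"
    hence e: "g z = - g w" by (simp add: eq_neg_iff_add_eq_0)
    hence "z = w" using sq[OF that] by simp
    thus False using e gnz[OF that(1)] by simp
  qed
  have 0: "(0::complex) \<in> ?D" by simp
  define b where "b = (\<lambda>z. (g z - g 0) / (g z + g 0))"
  have der: "(b has_field_derivative deriv g 0 / (2 * g 0)) (at 0)"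
  proof -
    have "(g has_field_derivative deriv g 0) (at 0)"
      using holomorphic_derivI[OF g(1)] by simp
    thus ?thesis unfolding b_def using gnz[OF 0]
      by (auto intro!: derivative_eq_intros simp: field_simps)
  qed
  have "norm (deriv b 0) \<le> 1"
  proof (rule bieberbach_eilenberg_univalent)
    show "b holomorphic_on ?D"
      unfolding b_def using neg[OF _ 0] by (intro holomorphic_intros g) auto
    show "inj_on b ?D"
    proof (rule inj_onI)
      fix z w assume zw: "z \<in> ?D" "w \<in> ?D" "b z = b w"
      hence "g z = g w" using neg[OF zw(1) 0] neg[OF zw(2) 0] gnz[OF 0]
        by (simp add: b_def divide_simps) (simp add: algebra_simps)
      thus "z = w" using sq zw by simp
    qed
    show "b 0 = 0" by (simp add: b_def)
    show "b z * b w \<noteq> 1" if zw: "z \<in> ?D" "w \<in> ?D" for z w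
    proof
      assume "b z * b w = 1"
      hence "(g z - g 0) * (g w - g 0) = (g z + g 0) * (g w + g 0)"
        using neg[OF zw(1) 0] neg[OF zw(2) 0] by (simp add: b_def divide_simps)
      hence "2 * g 0 * (g z + g w) = 0" by (simp add: algebra_simps)
      thus False using neg[OF zw] gnz[OF 0] by simp
    qed
  qed
  hence 1: "norm (deriv g 0) \<le> 2 * norm (g 0)"
    using gnz[OF 0] unfolding DERIV_imp_deriv[OF der] by (simp add: norm_divide norm_mult)
  have "(g has_field_derivative deriv g 0) (at 0)"
    using holomorphic_derivI[OF g(1)] by simp
  hence "((\<lambda>z. g z ^ 2 + a) has_field_derivative 2 * g 0 * deriv g 0) (at 0)"
    by (auto intro!: derivative_eq_intros)
  hence "(F has_field_derivative 2 * g 0 * deriv g 0) (at 0)"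
    by (rule DERIV_cong_ev[THEN iffD1, rotated 3]) 
       (use g(2) in \<open>auto simp: eventually_nhds algebra_simps intro!: exI[of _ "?D"]\<close>)
  hence "norm (deriv F 0) = 2 * norm (g 0) * norm (deriv g 0)"
    by (simp add: DERIV_imp_deriv norm_mult)
  also have "\<dots> \<le> 2 * norm (g 0) * (2 * norm (g 0))"
    using 1 by (intro mult_left_mono) auto
  also have "\<dots> = 4 * norm (g 0 ^ 2)" by (simp add: norm_mult power2_eq_square)
  finally show ?thesis using g(2)[OF 0] by simp
qed

section \<open>Length and area in a slit disc\<close>

text \<open>
  A function that climbs from \<open>\<alpha>\<close> to \<open>\<beta>\<close> within length \<open>\<Lambda>\<close> has energy at least \<open>(\<beta> - \<alpha>)\<^sup>2 / \<Lambda>\<close>, by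
  Cauchy-Schwarz; a single interval between the two levels already carries this energy.
\<close>

lemma crossing_energy_ge:
  fixes u u' v :: "real \<Rightarrow> real"
  assumes der: "\<And>x. x \<in> {x1..x2} \<Longrightarrow> (u has_real_derivative u' x) (at x within {x1..x2})"
    and v: "continuous_on {x1..x2} v" "\<And>x. x \<in> {x1..x2} \<Longrightarrow> \<bar>u' x\<bar> \<le> v x"
    and lv: "u x1 \<le> \<alpha>" "\<alpha> < \<beta>" "\<beta> \<le> u x2" and len: "x1 \<le> x2" "x2 - x1 \<le> \<Lambda>" "0 < \<Lambda>"
  shows "ennreal ((\<beta> - \<alpha>)\<^sup>2 / \<Lambda>) \<le> (\<integral>\<^sup>+x\<in>{x\<in>{x1<..<x2}. \<alpha> < u x \<and> u x < \<beta>}. ennreal ((v x)\<^sup>2) \<partial>lborel)"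
proof -
  have cu: "continuous_on {x1..x2} u"
    using der by (intro DERIV_continuous_on) auto
  have "compact ({x1..x2} \<inter> u -` {\<beta>..})"
    by (intro compact_eq_bounded_closed[THEN iffD2] conjI continuous_closed_preimage[OF cu] bounded_subset[OF bounded_closed_interval]) auto
  moreover have "x2 \<in> {x1..x2} \<inter> u -` {\<beta>..}" using lv len by auto
  ultimately obtain d where d: "d \<in> {x1..x2}" "\<beta> \<le> u d" "\<And>x. x \<in> {x1..x2} \<Longrightarrow> \<beta> \<le> u x \<Longrightarrow> d \<le> x"
    using compact_attains_inf[of "{x1..x2} \<inter> u -` {\<beta>..}"] by fastforce
  have cu': "continuous_on {x1..d} u" by (rule continuous_on_subset[OF cu]) (use d in auto)
  have "compact ({x1..d} \<inter> u -` {..\<alpha>})"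
    by (intro compact_eq_bounded_closed[THEN iffD2] conjI continuous_closed_preimage[OF cu'] bounded_subset[OF bounded_closed_interval]) auto
  moreover have "x1 \<in> {x1..d} \<inter> u -` {..\<alpha>}" using lv d by auto
  ultimately obtain c where c: "c \<in> {x1..d}" "u c \<le> \<alpha>" "\<And>x. x \<in> {x1..d} \<Longrightarrow> u x \<le> \<alpha> \<Longrightarrow> x \<le> c"
    using compact_attains_sup[of "{x1..d} \<inter> u -` {..\<alpha>}"] by fastforce
  have cd: "c < d" using c d lv by (cases "c = d") auto
  have sub: "{c..d} \<subseteq> {x1..x2}" using c d by auto
  have btw: "\<alpha> < u x \<and> u x < \<beta>" if "x \<in> {c<..<d}" for x
    using that c(1) d(1) c(3)[of x] d(3)[of x] by fastforce
  \<comment> \<open>The optimal \<open>\<mu>\<close> in \<open>u'\<^sup>2 \<ge> 2 \<mu> u' - \<mu>\<^sup>2\<close>, which is Cauchy-Schwarz in linearised form.\<close>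
  define \<mu> where "\<mu> = (\<beta> - \<alpha>) / \<Lambda>"
  have "0 < \<mu>" using lv len by (simp add: \<mu>_def)
  have "(u has_real_derivative u' x) (at x within {c..d})" if "x \<in> {c..d}" for x
    using that sub by (intro DERIV_subset[OF der sub]) auto
  hence "(u' has_integral (u d - u c)) {c..d}"
    using cd
    by (intro fundamental_theorem_of_calculus)
       (auto simp: has_real_derivative_iff_has_vector_derivative[symmetric])
  hence 1: "((\<lambda>x. 2 * \<mu> * u' x - \<mu>\<^sup>2) has_integral (2 * \<mu> * (u d - u c) - \<mu>\<^sup>2 * (d - c))) {c..d}"
    using cd has_integral_const_real[of "\<mu>\<^sup>2" c d]
    by (intro has_integral_diff has_integral_mult_right) (auto simp: mult.commute)
  have "continuous_on {c..d} (\<lambda>x. (v x)\<^sup>2)"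
    by (intro continuous_intros continuous_on_subset[OF v(1)] sub)
  then obtain J where J: "((\<lambda>x. (v x)\<^sup>2) has_integral J) {c..d}"
    using integrable_continuous_real by blast
  have J': "((\<lambda>x. (v x)\<^sup>2) has_integral J) {c<..<d}"
    using J has_integral_Icc_iff_Ioo by blast
  have "2 * \<mu> * (u d - u c) - \<mu>\<^sup>2 * (d - c) \<le> J"
  proof (rule has_integral_le[OF 1 J])
    fix x assume "x \<in> {c..d}"
    have "0 \<le> (u' x - \<mu>)\<^sup>2" by simp
    hence "2 * \<mu> * u' x - \<mu>\<^sup>2 \<le> (u' x)\<^sup>2" by (simp add: power2_eq_square algebra_simps)
    also have "\<dots> \<le> (v x)\<^sup>2"
      using v(2)[of x] sub \<open>x \<in> {c..d}\<close> by (metis abs_ge_zero power2_abs power_mono subsetD)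
    finally show "2 * \<mu> * u' x - \<mu>\<^sup>2 \<le> (v x)\<^sup>2" .
  qed
  moreover have "2 * \<mu> * (\<beta> - \<alpha>) - \<mu>\<^sup>2 * \<Lambda> \<le> 2 * \<mu> * (u d - u c) - \<mu>\<^sup>2 * (d - c)"
    using c d len \<open>0 < \<mu>\<close> by (intro diff_mono mult_left_mono) auto
  moreover have "2 * \<mu> * (\<beta> - \<alpha>) - \<mu>\<^sup>2 * \<Lambda> = (\<beta> - \<alpha>)\<^sup>2 / \<Lambda>"
    using len by (simp add: \<mu>_def power2_eq_square field_simps)
  ultimately have "(\<beta> - \<alpha>)\<^sup>2 / \<Lambda> \<le> J" by linarith
  hence "ennreal ((\<beta> - \<alpha>)\<^sup>2 / \<Lambda>) \<le> ennreal J" by (rule ennreal_leI)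
  also have "\<dots> = (\<integral>\<^sup>+x\<in>{c<..<d}. ennreal ((v x)\<^sup>2) \<partial>lborel)"
    using nn_integral_has_integral_lebesgue'[OF _ J'] by simp
  also have "\<dots> \<le> (\<integral>\<^sup>+x\<in>{x\<in>{x1<..<x2}. \<alpha> < u x \<and> u x < \<beta>}. ennreal ((v x)\<^sup>2) \<partial>lborel)"
    using btw sub cd by (intro nn_integral_mono) (auto simp: indicator_def)
  finally show ?thesis .
qed

definition slit_disc :: "real \<Rightarrow> complex set" where
  "slit_disc b = ball 0 1 - of_real ` {b..}"

lemma open_slit_disc: "open (slit_disc b)"
proof -
  have "slit_disc b = ball 0 1 \<inter> - (\<real> \<inter> {z. b \<le> Re z})"
    by (auto simp: slit_disc_def complex_is_Real_iff image_iff complex_eq_iff)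
  moreover have "open (ball 0 1 \<inter> - (\<real> \<inter> {z. b \<le> Re z}))"
    by (intro open_Int open_Compl closed_Int closed_complex_Reals closed_halfspace_Re_ge) auto
  ultimately show ?thesis by simp
qed

lemma polar_notin_positive_ray:
  assumes "0 < r" "y \<in> {0<..<2*pi}" "0 < b"
  shows "of_real r * cis y \<notin> complex_of_real ` {b..}"
proof
  assume "of_real r * cis y \<in> complex_of_real ` {b..}"
  then obtain t where t: "of_real r * cis y = of_real t" "b \<le> t" by auto
  have *: "r * sin y = 0" "r * cos y = t"
    using t(1) by (simp_all add: complex_eq_iff)
  have s: "sin y = 0" using *(1) assms(1) by simp
  have "0 < r * cos y" using *(2) t(2) assms by simp
  hence c: "0 < cos y" using assms(1) by (rule zero_less_mult_pos)
  show False
  proof (cases "y < pi")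
    case True
    thus False using sin_gt_zero[of y] assms(2) s by auto
  next
    case False
    hence "y = pi" using sin_lt_zero[of y] assms(2) s by fastforce
    thus False using c by simp
  qed
qed

text \<open>
  This is the length-area argument.  Let \<open>m\<close> be the maximum of \<open>\<bar>k\<bar>\<close> on \<open>\<bar>z\<bar> = \<epsilon>\<close>, and suppose
  \<open>m < T\<close>.  On every radius but the slit one, \<open>ln \<bar>k\<bar>\<close> climbs from \<open>ln m\<close> to \<open>ln T\<close> within
  logarithmic length \<open>ln (1/\<epsilon>)\<close>, so the image under \<open>ln k\<close> has between these levels at least the area
  \<open>2 \<pi> (ln T - ln m)\<^sup>2 / ln (1/\<epsilon>)\<close>.  It has at most \<open>2 \<pi> (ln T - ln m)\<close>.  Hence \<open>T \<epsilon> \<le> m\<close>, and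
  \<open>m / \<epsilon>\<close> tends to \<open>\<bar>k' 0\<bar>\<close>.
\<close>

lemma radial_growth_energy:
  assumes b: "0 < b" "b < 1" and hol: "k holomorphic_on slit_disc b" and inj: "inj_on k (slit_disc b)"
    and k0: "k 0 = 0" and T: "0 < T"
    and grow: "\<And>y. y \<in> {0<..<2*pi} \<Longrightarrow> \<exists>r\<in>{b..<1}. T < norm (k (of_real r * cis y))"
  shows "T \<le> norm (deriv k 0)"
proof -
  let ?S = "slit_disc b"
  have ck: "continuous_on ?S k" using hol by (rule holomorphic_on_imp_continuous_on)
  have small: "z \<in> ?S" if "norm z < b" for z
    using that b by (force simp: slit_disc_def)
  have 0: "0 \<in> ?S" using small b by simp
  have knz: "k z \<noteq> 0" if "z \<in> ?S" "z \<noteq> 0" for z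
    using inj_onD[OF inj, of z 0] that 0 k0 by auto
  have key: "\<exists>z. norm z = \<epsilon> \<and> T * \<epsilon> \<le> norm (k z)" if \<epsilon>: "0 < \<epsilon>" "\<epsilon> < b" for \<epsilon>
  proof -
    have "continuous_on (sphere 0 \<epsilon>) (\<lambda>z. norm (k z))"
      by (intro continuous_intros continuous_on_subset[OF ck]) (use \<epsilon> small in auto)
    from continuous_attains_sup[OF _ _ this]
    obtain z0 where z0: "norm z0 = \<epsilon>" "\<And>z. norm z = \<epsilon> \<Longrightarrow> norm (k z) \<le> norm (k z0)"
      using \<epsilon> by auto
    define m where "m = norm (k z0)"
    have m: "0 < m" using knz[OF small, of z0] z0 \<epsilon> by (auto simp: m_def)
    show ?thesis
    proof (cases "T \<le> m")
      case True
      have "T * \<epsilon> \<le> T * 1" using \<epsilon> b T by (intro mult_left_mono) auto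
      thus ?thesis using z0 True by (auto simp: m_def)
    next
      case False
      define W where "W = {\<eta>. Re \<eta> < 0 \<and> Im \<eta> \<in> {0<..<2*pi}}"
      have "W = {\<eta>. Re \<eta> < 0} \<inter> ({\<eta>. Im \<eta> > 0} \<inter> {\<eta>. Im \<eta> < 2*pi})" by (auto simp: W_def)
      hence oW: "open W"
        by (auto intro!: open_Int open_halfspace_Re_lt open_halfspace_Im_gt open_halfspace_Im_lt)
      have expW: "exp \<eta> \<in> ?S" if "\<eta> \<in> W" for \<eta>
      proof -
        have "exp \<eta> \<notin> of_real ` {b..}"
          unfolding exp_eq_polar using that b
          by (intro polar_notin_positive_ray) (auto simp: W_def)
        thus ?thesis using that by (simp add: slit_disc_def W_def norm_exp_eq_Re)
      qed
      define E where "E = (\<lambda>\<eta>. k (exp \<eta>))"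
      have "exp ` W \<subseteq> ?S" using expW by blast
      hence holE: "E holomorphic_on W"
        unfolding E_def using holomorphic_on_compose_gen[OF holomorphic_on_exp hol] by (simp add: o_def)
      have Enz: "E \<eta> \<noteq> 0" if "\<eta> \<in> W" for \<eta>
        using knz[OF expW[OF that]] by (simp add: E_def)
      have cE: "continuous_on W E" using holE by (rule holomorphic_on_imp_continuous_on)
      have subW: "log_rect \<epsilon> \<subseteq> W" by (auto simp: log_rect_def W_def)
      define X where "X = log_rect \<epsilon> \<inter> E -` {w. m < norm w \<and> norm w < T}"
      have "open {w::complex. m < norm w \<and> norm w < T}"
        by (intro open_Collect_conj open_Collect_less continuous_intros)
      hence oX: "open X"
        unfolding X_def
        by (intro continuous_open_preimage continuous_on_subset[OF cE] open_log_rect subW)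
      have subX: "X \<subseteq> log_rect \<epsilon>" "X \<subseteq> W" using subW by (auto simp: X_def)
      have injE: "inj_on E X"
      proof (rule inj_onI)
        fix x y assume xy: "x \<in> X" "y \<in> X" "E x = E y"
        have "exp x = exp y"
          using inj_onD[OF inj, of "exp x" "exp y"] expW xy subX by (auto simp: E_def)
        thus "x = y" using inj_onD[OF inj_on_exp_log_rect, of x y \<epsilon>] xy subX by auto
      qed
      let ?f = "\<lambda>\<eta>. (norm (deriv E \<eta> / E \<eta>))\<^sup>2"
      define J where "J = (\<integral>\<^sup>+\<eta>\<in>X. ennreal (?f \<eta>) \<partial>lborel)"
      define D where "D = ln T - ln m"
      have D: "0 < D" using False m T by (simp add: D_def)
      define \<Lambda> where "\<Lambda> = - ln \<epsilon>"
      have \<Lambda>: "0 < \<Lambda>" using \<epsilon> b by (simp add: \<Lambda>_def)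
      have upper: "J \<le> ennreal (2 * pi * D)"
      proof -
        obtain A where A: "A \<in> sets borel" "exp ` A \<subseteq> E ` X"
           "A \<subseteq> {w. Re w \<in> {ln m<..<ln T} \<and> Im w \<in> {-pi<..<pi}}" "emeasure lborel A = J"
          unfolding J_def
          by (rule log_image_area[OF oX holomorphic_on_subset[OF holE subX(2)] injE m, of T]) (auto simp: X_def)
        have "J \<le> ennreal (2 * pi * (ln T - ln m))"
          unfolding A(4)[symmetric] by (rule emeasure_log_annulus_le[OF A(1,3)]) (use D in \<open>auto simp: D_def\<close>)
        thus ?thesis by (simp add: D_def)
      qed
      have cf: "continuous_on W (\<lambda>\<eta>. norm (deriv E \<eta> / E \<eta>))"
        using Enz by (intro continuous_intros cE holomorphic_on_imp_continuous_on[OF holomorphic_deriv[OF holE oW]]) auto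
      have radial: "ennreal (D\<^sup>2 / \<Lambda>) \<le> (\<integral>\<^sup>+x. ennreal (?f (Complex x y)) * indicator X (Complex x y) \<partial>lborel)"
        if y: "y \<in> {0<..<2*pi}" for y
      proof -
        obtain r where r: "r \<in> {b..<1}" "T < norm (k (of_real r * cis y))" using grow[OF y] by blast
        define u where "u = (\<lambda>x. ln (norm (E (Complex x y))))"
        define u' where "u' = (\<lambda>x. Re (deriv E (Complex x y) / E (Complex x y)))"
        have inW: "Complex x y \<in> W" if "x < 0" for x using that y by (auto simp: W_def)
        have "ennreal ((ln T - ln m)\<^sup>2 / \<Lambda>) \<le> 
           (\<integral>\<^sup>+x\<in>{x\<in>{ln \<epsilon><..<ln r}. ln m < u x \<and> u x < ln T}. ennreal (?f (Complex x y)) \<partial>lborel)"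
        proof (rule crossing_energy_ge)
          show "(u has_real_derivative u' x) (at x within {ln \<epsilon>..ln r})" if "x \<in> {ln \<epsilon>..ln r}" for x
          proof -
            have "ln r < 0" using r b by simp
            hence xW: "Complex x y \<in> W" using that by (intro inW) auto
            have E': "(E has_field_derivative deriv E (Complex x y)) (at (Complex x y))"
              by (rule holomorphic_derivI[OF holE oW xW])
            have "((\<lambda>x. Complex x y) has_vector_derivative 1) (at x within {ln \<epsilon>..ln r})"
              unfolding Complex_eq by (auto intro!: derivative_eq_intros)
            from field_vector_diff_chain_within[OF this has_field_derivative_at_within[OF E']]
            have "((\<lambda>x. E (Complex x y)) has_vector_derivative (1 * deriv E (Complex x y))) (at x within {ln \<epsilon>..ln r})"
              by (simp only: o_def)
            hence dE: "((\<lambda>x. E (Complex x y)) has_vector_derivative (deriv E (Complex x y))) (at x within {ln \<epsilon>..ln r})"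
              by simp
            let ?w = "E (Complex x y)" and ?d = "deriv E (Complex x y)"
            have "((\<lambda>x. ln (norm (E (Complex x y)))) has_derivative (\<lambda>h. h * u' x)) (at x within {ln \<epsilon>..ln r})"
            proof -
              have "((\<lambda>x. norm (E (Complex x y))) has_derivative (\<lambda>h. (h *\<^sub>R ?d) \<bullet> sgn ?w)) (at x within {ln \<epsilon>..ln r})"
                using has_derivative_compose[OF dE[unfolded has_vector_derivative_def] has_derivative_norm[OF Enz[OF xW]]]
                by simp
              from has_derivative_ln[OF _ this]
              have D: "((\<lambda>x. ln (norm (E (Complex x y)))) has_derivative (\<lambda>h. ((h *\<^sub>R ?d) \<bullet> sgn ?w) * inverse (norm ?w))) (at x within {ln \<epsilon>..ln r})"
                using Enz[OF xW] by simp
              have "((h *\<^sub>R ?d) \<bullet> sgn ?w) * inverse (norm ?w) = h * u' x" for h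
              proof -
                have "u' x = (?d \<bullet> ?w) / (norm ?w)\<^sup>2"
                  unfolding u'_def Re_divide cmod_power2 by (simp add: inner_complex_def)
                thus ?thesis by (simp add: sgn_div_norm power2_eq_square divide_simps)
              qed
              thus ?thesis by (intro has_derivative_eq_rhs[OF D] ext)
            qed
            hence "(u has_real_derivative u' x) (at x within {ln \<epsilon>..ln r})"
              unfolding u_def has_field_derivative_def by (simp add: mult.commute[of _ "u' x"])
            thus ?thesis .
          qed
          have "ln r < 0" using r b by simp
          moreover have "continuous_on {ln \<epsilon>..ln r} (\<lambda>x. Complex x y)"
            unfolding Complex_eq by (intro continuous_intros)
          ultimately show "continuous_on {ln \<epsilon>..ln r} (\<lambda>x. norm (deriv E (Complex x y) / E (Complex x y)))"
            by (intro continuous_on_compose2[OF cf]) (auto intro: inW)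
          show "\<bar>u' x\<bar> \<le> norm (deriv E (Complex x y) / E (Complex x y))" for x
            unfolding u'_def by (rule abs_Re_le_cmod)
          have e: "exp (Complex (ln t) y) = of_real t * cis y" if "0 < t" for t
            using that by (simp add: exp_eq_polar)
          have "norm (k (of_real \<epsilon> * cis y)) \<le> m"
            unfolding m_def by (rule z0(2)) (use \<epsilon> in \<open>simp add: norm_mult\<close>)
          moreover have "E (Complex (ln \<epsilon>) y) \<noteq> 0" by (rule Enz[OF inW]) (use \<epsilon> b in auto)
          ultimately show "u (ln \<epsilon>) \<le> ln m"
            unfolding u_def using m \<epsilon> by (subst ln_le_cancel_iff) (auto simp: E_def e)
          show "ln T \<le> u (ln r)"
            unfolding u_def using r b T \<open>ln r < 0\<close> Enz[OF inW, of "ln r"] by (subst ln_le_cancel_iff) (auto simp: E_def e)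
          show "ln \<epsilon> \<le> ln r" using \<epsilon> r b by simp
          show "ln r - ln \<epsilon> \<le> \<Lambda>" using r b by (simp add: \<Lambda>_def)
          show "ln m < ln T" using D by (simp add: D_def)
        qed fact
        also have "\<dots> \<le> (\<integral>\<^sup>+x. ennreal (?f (Complex x y)) * indicator X (Complex x y) \<partial>lborel)"
        proof (intro nn_integral_mono)
          fix x
          have "Complex x y \<in> X" if x: "x \<in> {ln \<epsilon><..<ln r}" "ln m < u x" "u x < ln T"
          proof -
            have "ln r < 0" using r b by simp
            hence "x < 0" using x by auto
            moreover have "0 < norm (E (Complex x y))" using Enz[OF inW[OF \<open>x < 0\<close>]] by simp
            ultimately show ?thesis using x y m T by (auto simp: X_def log_rect_def u_def)
          qed
          thus "ennreal (?f (Complex x y)) * indicator {x\<in>{ln \<epsilon><..<ln r}. ln m < u x \<and> u x < ln T} x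
             \<le> ennreal (?f (Complex x y)) * indicator X (Complex x y)"
            by (auto simp: indicator_def)
        qed
        finally show ?thesis by (simp add: D_def)
      qed
      have lower: "ennreal (2 * pi * (D\<^sup>2 / \<Lambda>)) \<le> J"
      proof -
        have "continuous_on X ?f"
          by (intro continuous_intros continuous_on_subset[OF cf subX(2)])
        from borel_measurable_ennreal_indicator[OF oX this]
        have "J = (\<integral>\<^sup>+y. \<integral>\<^sup>+x. ennreal (?f (Complex x y)) * indicator X (Complex x y) \<partial>lborel \<partial>lborel)"
          unfolding J_def by (rule nn_integral_complex_iterated)
        also have "\<dots> \<ge> (\<integral>\<^sup>+y. ennreal (D\<^sup>2 / \<Lambda>) * indicator {0<..<2*pi} y \<partial>lborel)"
          by (intro nn_integral_mono) (use radial in \<open>auto simp: indicator_def\<close>)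
        also have "(\<integral>\<^sup>+y. ennreal (D\<^sup>2 / \<Lambda>) * indicator {0<..<2*pi} y \<partial>lborel) = ennreal (2 * pi * (D\<^sup>2 / \<Lambda>))"
          using \<Lambda> by (simp add: nn_integral_cmult_indicator ennreal_mult'[symmetric] mult.commute)
        finally show ?thesis .
      qed
      have "ennreal (2 * pi * (D\<^sup>2 / \<Lambda>)) \<le> ennreal (2 * pi * D)"
        using lower upper by (rule order_trans)
      hence "2 * pi * (D\<^sup>2 / \<Lambda>) \<le> 2 * pi * D" using D by (subst (asm) ennreal_le_iff) auto
      hence "D\<^sup>2 / \<Lambda> \<le> D" by (subst (asm) mult_le_cancel_left_pos) auto
      hence "D \<le> \<Lambda>" using D \<Lambda> by (simp add: power2_eq_square field_simps)
      hence "ln (T * \<epsilon>) \<le> ln m" using T \<epsilon> by (simp add: D_def \<Lambda>_def ln_mult)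
      hence "T * \<epsilon> \<le> m" using T \<epsilon> m by (subst (asm) ln_le_cancel_iff) auto
      thus ?thesis using z0 by (auto simp: m_def)
    qed
  qed
  show ?thesis
  proof (rule ccontr)
    assume "\<not> T \<le> norm (deriv k 0)"
    hence *: "norm (deriv k 0) < T" by simp
    have "(k has_field_derivative deriv k 0) (at 0)"
      by (rule holomorphic_derivI[OF hol open_slit_disc 0])
    hence "((\<lambda>z. norm ((k z - k 0) / (z - 0))) \<longlongrightarrow> norm (deriv k 0)) (at 0)"
      unfolding has_field_derivative_iff by (intro tendsto_norm) simp
    hence "eventually (\<lambda>z. norm ((k z - k 0) / (z - 0)) < T) (at 0)"
      using * by (rule order_tendstoD)
    then obtain d where d: "d > 0" "\<And>z. z \<noteq> 0 \<Longrightarrow> norm z < d \<Longrightarrow> norm (k z / z) < T"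
      unfolding eventually_at by (auto simp: dist_norm k0)
    define \<epsilon> where "\<epsilon> = min (d / 2) (b / 2)"
    have \<epsilon>: "0 < \<epsilon>" "\<epsilon> < b" "\<epsilon> < d" using d b by (auto simp: \<epsilon>_def)
    then obtain z where z: "norm z = \<epsilon>" "T * \<epsilon> \<le> norm (k z)" using key by blast
    have "norm (k z / z) < T" using d(2)[of z] z \<epsilon> by auto
    thus False using z \<epsilon> by (simp add: norm_divide field_simps)
  qed
qed

text \<open>
  The map \<open>(K - K 0) / (K - a)\<close> has a zero at the centre and is at least about \<open>(M - s) / s\<close> in
  modulus near the end of each radius, where \<open>M = \<bar>K 0 - a\<bar>\<close>.
\<close>

theorem slit_disc_radial_bound:
  assumes b: "0 < b" "b < 1" and hol: "K holomorphic_on slit_disc b" and inj: "inj_on K (slit_disc b)"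
    and a: "a \<notin> K ` slit_disc b" and s: "0 < s"
    and lim: "\<And>y s'. y \<in> {0<..<2*pi} \<Longrightarrow> s < s' \<Longrightarrow> 
       eventually (\<lambda>r. norm (K (of_real r * cis y) - a) < s') (at_left 1)"
  shows "norm (K 0 - a) * (norm (K 0 - a) - s) \<le> s * norm (deriv K 0)"
proof (cases "norm (K 0 - a) \<le> s")
  case True
  hence "norm (K 0 - a) * (norm (K 0 - a) - s) \<le> 0"
    by (intro mult_nonneg_nonpos) auto
  also have "0 \<le> s * norm (deriv K 0)" using s by simp
  finally show ?thesis .
next
  case False
  let ?S = "slit_disc b"
  define M where "M = norm (K 0 - a)"
  have M: "s < M" using False by (simp add: M_def)
  have 0: "0 \<in> ?S" using b by (auto simp: slit_disc_def)
  have Ka: "K z \<noteq> a" if "z \<in> ?S" for z using a that by auto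
  define k where "k = (\<lambda>z. (K z - K 0) / (K z - a))"
  have hk: "k holomorphic_on ?S" unfolding k_def using Ka by (intro holomorphic_intros hol) auto
  have ik: "inj_on k ?S"
  proof (rule inj_onI)
    fix z w assume zw: "z \<in> ?S" "w \<in> ?S" "k z = k w"
    hence "(K z - K 0) * (K w - a) = (K w - K 0) * (K z - a)"
      using Ka[OF zw(1)] Ka[OF zw(2)] by (simp add: k_def frac_eq_eq)
    hence "(K 0 - a) * (K z - K w) = 0" by (simp add: algebra_simps)
    hence "K z = K w" using Ka[OF 0] by simp
    thus "z = w" using inj_onD[OF inj] zw by auto
  qed
  have der: "deriv k 0 = deriv K 0 / (K 0 - a)"
  proof (rule DERIV_imp_deriv)
    have "(K has_field_derivative deriv K 0) (at 0)"
      by (rule holomorphic_derivI[OF hol open_slit_disc 0])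
    from DERIV_divide[OF DERIV_diff[OF this DERIV_const] DERIV_diff[OF this DERIV_const], of a "K 0"]
    show "(k has_field_derivative deriv K 0 / (K 0 - a)) (at 0)"
      unfolding k_def using Ka[OF 0] by simp
  qed
  have bound: "T \<le> norm (deriv k 0)" if T: "0 < T" "T < (M - s) / s" for T
  proof (rule radial_growth_energy[OF b hk ik _ T(1)])
    fix y assume y: "y \<in> {0<..<2*pi}"
    \<comment> \<open>This \<open>s'\<close> solves \<open>(M - s') / s' = T\<close>.\<close>
    define s' where "s' = M / (1 + T)"
    have "s < s'" using T s M by (simp add: s'_def field_simps)
    have "eventually (\<lambda>r. norm (K (of_real r * cis y) - a) < s') (at_left 1)"
      by (rule lim[OF y \<open>s < s'\<close>])
    moreover have "eventually (\<lambda>r::real. r \<in> {b<..<1}) (at_left 1)"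
      using eventually_at_left_real[OF b(2)] .
    ultimately have "eventually (\<lambda>r::real. r \<in> {b<..<1} \<and> norm (K (of_real r * cis y) - a) < s') (at_left 1)"
      by eventually_elim auto
    then obtain r where r: "r \<in> {b<..<1}" "norm (K (of_real r * cis y) - a) < s'"
      using eventually_happens'[OF trivial_limit_at_left_real] by blast
    let ?z = "of_real r * cis y :: complex"
    have "?z \<in> ?S"
    proof -
      have "?z \<notin> of_real ` {b..}"
        using r b y by (intro polar_notin_positive_ray) auto
      thus ?thesis using r b by (simp add: slit_disc_def norm_mult)
    qed
    hence "0 < norm (K ?z - a)" using Ka by simp
    have "M \<le> norm (K ?z - K 0) + norm (K ?z - a)"
      unfolding M_def using norm_triangle_ineq4[of "K ?z - a" "K ?z - K 0"] by simp
    hence "M - norm (K ?z - a) \<le> norm (K ?z - K 0)" by simp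
    moreover have "T * norm (K ?z - a) < M - norm (K ?z - a)"
      using r(2) T by (simp add: s'_def field_simps)
    ultimately have "T * norm (K ?z - a) < norm (K ?z - K 0)" by linarith
    hence "T < norm (k ?z)" using \<open>0 < norm (K ?z - a)\<close> by (simp add: k_def norm_divide field_simps)
    thus "\<exists>r\<in>{b..<1}. T < norm (k (of_real r * cis y))" using r by force
  qed (simp add: k_def)
  have "(M - s) / s \<le> norm (deriv k 0)"
    using M s by (intro dense_le_bounded[of 0 "(M - s) / s"]) (auto intro: bound)
  also have "\<dots> = norm (deriv K 0) / M" by (simp add: der norm_divide M_def)
  finally show ?thesis using s M unfolding M_def[symmetric] by (simp add: field_simps)
qed

section \<open>A derivative bound in the half-plane\<close>

definition cayley :: "complex \<Rightarrow> complex" where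
  "cayley z = (1 + z) / (1 - z)"

lemma Re_Im_cayley:
  "Re (cayley z) = (1 - (norm z)\<^sup>2) / (norm (1 - z))\<^sup>2"
  "Im (cayley z) = 2 * Im z / (norm (1 - z))\<^sup>2"
  unfolding cayley_def Re_divide Im_divide cmod_power2
  by (simp_all add: power2_eq_square algebra_simps)

lemma Re_cayley_pos: "norm z < 1 \<Longrightarrow> 0 < Re (cayley z)"
  by (auto simp: Re_Im_cayley abs_square_less_1 intro!: divide_pos_pos)

lemma cayley_eq_iff: "z \<noteq> 1 \<Longrightarrow> w \<noteq> 1 \<Longrightarrow> cayley z = cayley w \<longleftrightarrow> z = w"
  unfolding cayley_def by (auto simp: frac_eq_eq algebra_simps)

lemma cayley_has_field_derivative [derivative_intros]:
  assumes "(f has_field_derivative f') (at x)" "f x \<noteq> 1"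
  shows "((\<lambda>x. cayley (f x)) has_field_derivative 2 * f' / (1 - f x)\<^sup>2) (at x)"
  unfolding cayley_def using assms
  by (auto intro!: derivative_eq_intros simp: divide_simps) (simp add: power2_eq_square algebra_simps)

lemma cayley_holomorphic [holomorphic_intros]:
  "f holomorphic_on A \<Longrightarrow> (\<And>z. z \<in> A \<Longrightarrow> f z \<noteq> 1) \<Longrightarrow> (\<lambda>z. cayley (f z)) holomorphic_on A"
  unfolding cayley_def by (intro holomorphic_intros) auto

text \<open>
  The map \<open>Re t0 + \<i> Im t0 (1 + z) / (1 - z)\<close> carries the disc to the half-plane and 0 to \<open>t0\<close>.
\<close>

lemma Koebe_half_plane:
  assumes hol: "G holomorphic_on {t. 0 < Im t}" and inj: "inj_on G {t. 0 < Im t}"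
    and a: "a \<notin> G ` {t. 0 < Im t}" and t0: "0 < Im t0"
  shows "norm (deriv G t0) * Im t0 \<le> 2 * norm (G t0 - a)"
proof -
  define \<mu> where "\<mu> = (\<lambda>z. of_real (Re t0) + \<i> * of_real (Im t0) * cayley z)"
  have ne1: "z \<noteq> 1" if "z \<in> ball 0 1" for z :: complex using that by auto
  have im: "\<mu> ` ball 0 1 \<subseteq> {t. 0 < Im t}"
    using t0 Re_cayley_pos by (auto simp: \<mu>_def)
  have \<mu>0: "\<mu> 0 = t0" by (simp add: \<mu>_def cayley_def complex_eq_iff)
  have hol\<mu>: "\<mu> holomorphic_on ball 0 1"
    unfolding \<mu>_def using ne1 by (intro holomorphic_intros) auto
  have "inj_on \<mu> (ball 0 1)"
    using t0 ne1 by (auto simp: inj_on_def \<mu>_def cayley_eq_iff)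
  hence inj': "inj_on (G \<circ> \<mu>) (ball 0 1)"
    by (rule comp_inj_on[OF _ inj_on_subset[OF inj im]])
  have "norm (deriv (G \<circ> \<mu>) 0) \<le> 4 * norm ((G \<circ> \<mu>) 0 - a)"
  proof (rule Koebe_quarter_omitted_value)
    show "G \<circ> \<mu> holomorphic_on ball 0 1"
      by (rule holomorphic_on_compose_gen[OF hol\<mu> hol im])
    show "a \<notin> (G \<circ> \<mu>) ` ball 0 1" using a im by (auto simp: image_comp[symmetric])
  qed fact
  moreover have "deriv (G \<circ> \<mu>) 0 = deriv G t0 * (2 * \<i> * of_real (Im t0))"
  proof (rule DERIV_imp_deriv)
    have "(G has_field_derivative deriv G t0) (at (\<mu> 0))"
      unfolding \<mu>0 using t0 by (intro holomorphic_derivI[OF hol open_halfspace_Im_gt]) auto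
    moreover have "(\<mu> has_field_derivative (2 * \<i> * of_real (Im t0))) (at 0)"
      unfolding \<mu>_def by (auto intro!: derivative_eq_intros)
    ultimately show "(G \<circ> \<mu> has_field_derivative deriv G t0 * (2 * \<i> * of_real (Im t0))) (at 0)"
      by (rule DERIV_chain)
  qed
  ultimately show ?thesis using t0 by (simp add: norm_mult \<mu>0 mult.commute)
qed

text \<open>
  A disc automorphism moves the tip \<open>b\<close> of the slit to 0, a square root opens the slit disc to the
  upper half of the disc, and the squared Cayley map takes this half disc to the upper half-plane,
  its diameter to the positive and its semicircle to the negative axis.
\<close>

definition slit_to_half_plane :: "real \<Rightarrow> complex \<Rightarrow> complex" where
  "slit_to_half_plane b \<zeta> = (cayley (\<i> * csqrt (- Moebius_function 0 (of_real b) \<zeta>)))\<^sup>2"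

lemma Moebius_slit:
  assumes b: "0 < b" "b < 1" and \<zeta>: "\<zeta> \<in> slit_disc b"
  shows "norm (Moebius_function 0 (of_real b) \<zeta>) < 1" "- Moebius_function 0 (of_real b) \<zeta> \<notin> \<real>\<^sub>\<le>\<^sub>0"
proof -
  let ?\<rho> = "Moebius_function 0 (of_real b) \<zeta>"
  have n\<zeta>: "norm \<zeta> < 1" using \<zeta> by (auto simp: slit_disc_def)
  show n: "norm ?\<rho> < 1" by (rule Moebius_function_norm_lt_1) (use b n\<zeta> in auto)
  show "- ?\<rho> \<notin> \<real>\<^sub>\<le>\<^sub>0"
  proof
    assume "- ?\<rho> \<in> \<real>\<^sub>\<le>\<^sub>0"
    then obtain x where x: "?\<rho> = of_real x" "0 \<le> x"
      by (elim nonpos_Reals_cases) (metis minus_minus of_real_minus neg_0_le_iff_le)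
    have "x < 1" using n x by simp
    have "norm (of_real b * \<zeta>) < 1 * 1"
      unfolding norm_mult using b n\<zeta> by (intro mult_strict_mono) auto
    hence ne: "1 - of_real b * \<zeta> \<noteq> 0" by auto
    have "\<zeta> - of_real b = of_real x * (1 - of_real b * \<zeta>)"
      using x(1) ne by (simp add: Moebius_function_simple field_simps)
    hence "\<zeta> * of_real (1 + b * x) = of_real (x + b)" by (simp add: algebra_simps)
    moreover have pos: "0 < 1 + b * x" using b x by (simp add: add_pos_nonneg)
    ultimately have "\<zeta> = of_real ((x + b) / (1 + b * x))"
      by (simp add: field_simps del: of_real_add of_real_mult)
    moreover have "b \<le> (x + b) / (1 + b * x)"
    proof -
      have "b * b * x \<le> 1 * x" using b x by (intro mult_right_mono mult_le_one) auto
      thus ?thesis using pos by (simp add: pos_le_divide_eq algebra_simps)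
    qed
    ultimately have "\<zeta> \<in> of_real ` {b..}" by (metis atLeast_iff image_eqI)
    thus False using \<zeta> by (simp add: slit_disc_def)
  qed
qed

lemma sqrt_in_upper_half_plane:
  "(\<i> * csqrt (- \<rho>))\<^sup>2 = \<rho>" "norm (\<i> * csqrt (- \<rho>)) ^ 2 = norm \<rho>"
  "- \<rho> \<notin> \<real>\<^sub>\<le>\<^sub>0 \<Longrightarrow> 0 < Im (\<i> * csqrt (- \<rho>))"
proof -
  show 1: "(\<i> * csqrt (- \<rho>))\<^sup>2 = \<rho>" by (simp add: power_mult_distrib)
  show "norm (\<i> * csqrt (- \<rho>)) ^ 2 = norm \<rho>" using 1 by (metis norm_power)
  assume \<rho>: "- \<rho> \<notin> \<real>\<^sub>\<le>\<^sub>0"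
  have "Re (csqrt (- \<rho>)) \<noteq> 0"
  proof
    assume "Re (csqrt (- \<rho>)) = 0"
    hence "(csqrt (- \<rho>))\<^sup>2 = of_real (- (Im (csqrt (- \<rho>)))\<^sup>2)"
      by (simp add: complex_eq_iff power2_eq_square del: csqrt.simps power2_csqrt)
    hence "- \<rho> = of_real (- (Im (csqrt (- \<rho>)))\<^sup>2)" by simp
    moreover have "complex_of_real (- (Im (csqrt (- \<rho>)))\<^sup>2) \<in> \<real>\<^sub>\<le>\<^sub>0"
      by (subst nonpos_Reals_of_real_iff) simp
    ultimately show False using \<rho> by metis
  qed
  moreover have "0 \<le> Re (csqrt (- \<rho>))" using csqrt_principal[of "- \<rho>"] by auto
  ultimately show "0 < Im (\<i> * csqrt (- \<rho>))" by simp
qed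

lemma slit_to_half_plane_props:
  assumes b: "0 < b" "b < 1"
  shows "slit_to_half_plane b ` slit_disc b \<subseteq> {t. 0 < Im t}"
    and "inj_on (slit_to_half_plane b) (slit_disc b)"
    and "slit_to_half_plane b holomorphic_on slit_disc b"
proof -
  define \<rho> where "\<rho> = Moebius_function 0 (of_real b)"
  define r where "r = (\<lambda>\<zeta>. \<i> * csqrt (- \<rho> \<zeta>))"
  have eq: "slit_to_half_plane b = (\<lambda>\<zeta>. (cayley (r \<zeta>))\<^sup>2)"
    by (auto simp: slit_to_half_plane_def r_def \<rho>_def)
  have \<rho>: "norm (\<rho> \<zeta>) < 1" "- \<rho> \<zeta> \<notin> \<real>\<^sub>\<le>\<^sub>0" if "\<zeta> \<in> slit_disc b" for \<zeta>
    using Moebius_slit[OF b that] by (auto simp: \<rho>_def)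
  have r: "norm (r \<zeta>) < 1" "0 < Im (r \<zeta>)" "(r \<zeta>)\<^sup>2 = \<rho> \<zeta>" if "\<zeta> \<in> slit_disc b" for \<zeta>
  proof -
    have "norm (r \<zeta>) ^ 2 < 1 ^ 2"
      using \<rho>(1)[OF that] sqrt_in_upper_half_plane(2)[of "\<rho> \<zeta>"] by (simp add: r_def)
    thus "norm (r \<zeta>) < 1" by (rule power2_less_imp_less) simp
    show "0 < Im (r \<zeta>)" unfolding r_def by (rule sqrt_in_upper_half_plane(3)[OF \<rho>(2)[OF that]])
    show "(r \<zeta>)\<^sup>2 = \<rho> \<zeta>" unfolding r_def by (rule sqrt_in_upper_half_plane(1))
  qed
  have r1: "r \<zeta> \<noteq> 1" if "\<zeta> \<in> slit_disc b" for \<zeta> using r[OF that] by auto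
  have v: "0 < Re (cayley (r \<zeta>))" "0 < Im (cayley (r \<zeta>))" if "\<zeta> \<in> slit_disc b" for \<zeta>
    using r[OF that] r1[OF that] Re_cayley_pos[of "r \<zeta>"] by (auto simp: Re_Im_cayley(2))
  show "slit_to_half_plane b ` slit_disc b \<subseteq> {t. 0 < Im t}"
    unfolding eq using v by (auto simp: power2_eq_square)
  have sub: "slit_disc b \<subseteq> ball 0 1" by (auto simp: slit_disc_def)
  have hol\<rho>: "\<rho> holomorphic_on slit_disc b"
    unfolding \<rho>_def by (rule holomorphic_on_subset[OF Moebius_function_holomorphic sub]) (use b in auto)
  show "slit_to_half_plane b holomorphic_on slit_disc b"
    unfolding eq r_def using r1 \<rho>(2)
    by (intro holomorphic_intros hol\<rho>) (auto simp: r_def)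
  show "inj_on (slit_to_half_plane b) (slit_disc b)"
  proof (rule inj_onI)
    fix z w assume zw: "z \<in> slit_disc b" "w \<in> slit_disc b" "slit_to_half_plane b z = slit_to_half_plane b w"
    hence "cayley (r z) = cayley (r w) \<or> cayley (r z) = - cayley (r w)"
      by (simp add: eq power2_eq_iff)
    hence "cayley (r z) = cayley (r w)" using v(1)[OF zw(1)] v(1)[OF zw(2)] by auto
    hence "r z = r w" using cayley_eq_iff r1 zw by simp
    hence "\<rho> z = \<rho> w" using r(3) zw by metis
    moreover have "norm (of_real b * x) < 1" if "norm x < 1" for x :: complex
      unfolding norm_mult using b that mult_strict_mono[of b 1 "norm x" 1] by auto
    hence "1 - of_real b * x \<noteq> 0" if "norm x < 1" for x :: complex
      using that by fastforce
    moreover have "norm z < 1" "norm w < 1" using sub zw by auto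
    ultimately have "(z - of_real b) * (1 - of_real b * w) = (w - of_real b) * (1 - of_real b * z)"
      by (simp add: \<rho>_def Moebius_function_simple frac_eq_eq)
    hence "(z - w) * (1 - of_real (b * b)) = 0" by (simp add: algebra_simps)
    moreover have "b * b < 1 * 1" using b by (intro mult_strict_mono) auto
    hence "1 - complex_of_real (b * b) \<noteq> 0" by (metis eq_iff_diff_eq_0 less_irrefl mult_1 of_real_1 of_real_eq_iff)
    ultimately show "z = w" by simp
  qed
qed

text \<open>
  The boundary points other than 1 correspond to the semicircle of the half disc, on which the
  Cayley map is imaginary.
\<close>

lemma slit_to_half_plane_boundary:
  assumes b: "0 < b" "b < 1" and y: "y \<in> {0<..<2*pi}"
  obtains x where "x < 0" 
    "filterlim (\<lambda>r. slit_to_half_plane b (of_real r * cis y)) (at (of_real x) within {t. 0 < Im t}) (at_left 1)"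
proof -
  define \<rho> where "\<rho> = Moebius_function 0 (of_real b) (cis y)"
  have y1: "cis y \<noteq> 1"
    using polar_notin_positive_ray[of 1 y 1] y by force
  have "norm (of_real b * cis y) < 1" using b by (simp add: norm_mult)
  hence ne: "1 - of_real b * cis y \<noteq> 0" by auto
  have "norm (cis y - of_real b) = norm (cis y * cnj (1 - of_real b * cis y))"
  proof -
    have "cis y * cis (- y) = 1" by (simp add: cis_mult)
    thus ?thesis by (simp add: cis_cnj right_diff_distrib mult.left_commute[of "cis y"])
  qed
  also have "\<dots> = norm (1 - of_real b * cis y)" by (simp add: norm_mult del: complex_cnj_diff)
  finally have n\<rho>: "norm \<rho> = 1" using ne by (simp add: \<rho>_def Moebius_function_simple norm_divide)
  have \<rho>1: "\<rho> \<noteq> 1"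
  proof
    assume "\<rho> = 1"
    hence "cis y - of_real b = 1 - of_real b * cis y" using ne by (simp add: \<rho>_def Moebius_function_simple)
    hence "(cis y - 1) * of_real (1 + b) = 0" by (simp add: algebra_simps)
    moreover have "complex_of_real (1 + b) \<noteq> 0" using b by (simp only: of_real_eq_0_iff)
    ultimately show False using y1 by simp
  qed
  have np: "- \<rho> \<notin> \<real>\<^sub>\<le>\<^sub>0"
  proof
    assume "- \<rho> \<in> \<real>\<^sub>\<le>\<^sub>0"
    then obtain u where u: "\<rho> = of_real u" "0 \<le> u"
      by (elim nonpos_Reals_cases) (metis minus_minus of_real_minus neg_0_le_iff_le)
    thus False using n\<rho> \<rho>1 by simp
  qed
  define r where "r = \<i> * csqrt (- \<rho>)"
  have r: "norm r = 1" "0 < Im r"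
  proof -
    have "norm r ^ 2 = 1 ^ 2" using sqrt_in_upper_half_plane(2)[of \<rho>] n\<rho> by (simp add: r_def)
    thus "norm r = 1" by (rule power2_eq_imp_eq) auto
    show "0 < Im r" unfolding r_def by (rule sqrt_in_upper_half_plane(3)[OF np])
  qed
  have r1: "r \<noteq> 1" using r by auto
  have v: "Re (cayley r) = 0" "Im (cayley r) \<noteq> 0"
    using r r1 by (simp_all add: Re_Im_cayley)
  define x where "x = - (Im (cayley r))\<^sup>2"
  have x: "x < 0" "slit_to_half_plane b (cis y) = of_real x"
  proof -
    show "x < 0" using v by (simp add: x_def)
    have "(cayley r)\<^sup>2 = of_real x"
      by (simp add: complex_eq_iff power2_eq_square v x_def)
    thus "slit_to_half_plane b (cis y) = of_real x" by (simp add: slit_to_half_plane_def r_def \<rho>_def)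
  qed
  have "isCont (slit_to_half_plane b) (cis y)"
    unfolding slit_to_half_plane_def Moebius_function_simple cayley_def
    using ne np r1 by (intro continuous_intros isCont_csqrt') (auto simp: r_def \<rho>_def Moebius_function_simple)
  hence "((\<lambda>r. slit_to_half_plane b (of_real r * cis y)) \<longlongrightarrow> slit_to_half_plane b (of_real 1 * cis y)) (at_left 1)"
    by (intro isCont_tendsto_compose[of _ "slit_to_half_plane b"] tendsto_intros) simp_all
  hence lim: "((\<lambda>r. slit_to_half_plane b (of_real r * cis y)) \<longlongrightarrow> of_real x) (at_left 1)"
    by (simp add: x(2))
  have "eventually (\<lambda>r::real. r \<in> {0<..<1}) (at_left 1)"
    by (rule eventually_at_left_real) simp
  hence "eventually (\<lambda>r. slit_to_half_plane b (of_real r * cis y) \<in> {t. 0 < Im t}) (at_left 1)"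
  proof eventually_elim
    case (elim r)
    have "of_real r * cis y \<in> slit_disc b"
      using polar_notin_positive_ray[of r y b] elim y b by (auto simp: slit_disc_def norm_mult)
    thus ?case using slit_to_half_plane_props(1)[OF b] by blast
  qed
  hence "filterlim (\<lambda>r. slit_to_half_plane b (of_real r * cis y)) (at (of_real x) within {t. 0 < Im t}) (at_left 1)"
    using lim by (auto simp: filterlim_at elim!: eventually_mono)
  with x(1) show thesis by (rule that)
qed

lemma cayley_i_tan:
  assumes "cos \<delta> \<noteq> 0"
  shows "cayley (\<i> * of_real (tan \<delta>)) = cis (2 * \<delta>)"
proof -
  have "(1 + \<i> * of_real (tan \<delta>)) = cis \<delta> / of_real (cos \<delta>)" 
    using assms by (simp add: tan_def complex_eq_iff)
  moreover have "(1 - \<i> * of_real (tan \<delta>)) = cis (- \<delta>) / of_real (cos \<delta>)" 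
    using assms by (simp add: tan_def complex_eq_iff)
  ultimately have "cayley (\<i> * of_real (tan \<delta>)) = cis \<delta> / cis (- \<delta>)"
    using assms by (simp add: cayley_def)
  also have "\<dots> = cis (\<delta> - - \<delta>)" by (rule cis_divide)
  finally show ?thesis by simp
qed

text \<open>
  The choice of \<open>b\<close> puts the image of the centre at the angle \<open>\<theta>\<close>; any other base point can be
  scaled to the unit circle, which preserves the negative axis.
\<close>

lemma slit_to_half_plane_at_0:
  assumes \<theta>: "0 < \<theta>" "\<theta> < pi" and b: "b = (tan (\<theta> / 4))\<^sup>2"
  shows "0 < b" "b < 1" "slit_to_half_plane b 0 = cis \<theta>"
    "norm (deriv (slit_to_half_plane b) 0) = 4 * cos (\<theta> / 2) / sin (\<theta> / 2)"
proof -
  define q where "q = tan (\<theta> / 4)"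
  have q: "0 < q" "q < 1"
  proof -
    show "0 < q" unfolding q_def using \<theta> by (intro tan_gt_zero) auto
    have "tan (\<theta> / 4) < tan (pi / 4)" using \<theta> by (intro tan_monotone) auto
    thus "q < 1" by (simp add: q_def tan_45)
  qed
  have bq: "b = q\<^sup>2" by (simp add: b q_def)
  show b01: "0 < b" "b < 1" using q by (simp_all add: bq power_less_one_iff)
  have c: "cos (\<theta> / 4) > 0" using \<theta> by (intro cos_gt_zero_pi) auto
  have r0: "csqrt (of_real b) = of_real q"
    using q by (simp add: bq)
  have v: "cayley (\<i> * of_real q) = cis (\<theta> / 2)"
    using cayley_i_tan[of "\<theta> / 4"] c by (simp add: q_def)
  show "slit_to_half_plane b 0 = cis \<theta>"
    by (simp add: slit_to_half_plane_def Moebius_function_simple r0 v power2_eq_square cis_mult)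
  have iq1: "\<i> * complex_of_real q \<noteq> 1" by (simp add: complex_eq_iff)
  have M': "((\<lambda>z. - Moebius_function 0 (of_real b) z) has_field_derivative - of_real (1 - b\<^sup>2)) (at 0)"
    unfolding Moebius_function_simple
    by (auto intro!: derivative_eq_intros simp: power2_eq_square)
  have M0: "- Moebius_function 0 (of_real b) 0 = of_real b" by (simp add: Moebius_function_simple)
  have "((\<lambda>z. csqrt (- Moebius_function 0 (of_real b) z)) has_field_derivative
      (inverse (2 * csqrt (of_real b)) * - of_real (1 - b\<^sup>2))) (at 0)"
    by (rule DERIV_cong[OF has_field_derivative_csqrt'[OF M']])
       (use b01 in \<open>simp_all only: M0 nonpos_Reals_of_real_iff divide_inverse mult.commute not_le\<close>)
  hence "((\<lambda>z. \<i> * csqrt (- Moebius_function 0 (of_real b) z)) has_field_derivative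
      \<i> * (inverse (2 * csqrt (of_real b)) * - of_real (1 - b\<^sup>2))) (at 0)"
    by (rule DERIV_cmult)
  from cayley_has_field_derivative[OF this]
  have "((\<lambda>z. cayley (\<i> * csqrt (- Moebius_function 0 (of_real b) z))) has_field_derivative
      2 * (\<i> * (inverse (2 * of_real q) * - of_real (1 - b\<^sup>2))) / (1 - \<i> * of_real q)\<^sup>2) (at 0)"
    unfolding M0 r0 using iq1 by simp
  from DERIV_power[OF this, of 2]
  have "(slit_to_half_plane b has_field_derivative
      2 * cis (\<theta> / 2) * (2 * (\<i> * (inverse (2 * of_real q) * - of_real (1 - b\<^sup>2))) / (1 - \<i> * of_real q)\<^sup>2)) (at 0)"
    unfolding slit_to_half_plane_def M0 r0 v by (simp add: mult_ac)
  hence "norm (deriv (slit_to_half_plane b) 0) = 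
     norm (2 * cis (\<theta> / 2) * (2 * (\<i> * (inverse (2 * of_real q) * - of_real (1 - b\<^sup>2))) / (1 - \<i> * of_real q)\<^sup>2))"
    by (simp only: DERIV_imp_deriv)
  also have "\<dots> = 2 * (1 - b\<^sup>2) / (q * (1 + q\<^sup>2))"
  proof -
    have "norm (1 - \<i> * complex_of_real q) ^ 2 = 1 + q\<^sup>2" by (simp add: cmod_power2)
    moreover have "norm (complex_of_real (1 - b\<^sup>2)) = 1 - b\<^sup>2"
      using b01 by (simp only: norm_of_real) (simp add: power_le_one_iff)
    moreover have "2 * (2 * (inverse (2 * q) * c) / w) = 2 * c / (q * w)" for c w :: real
      using q by (cases "w = 0") (auto simp: field_simps)
    ultimately show ?thesis using q
      by (simp add: norm_mult norm_divide norm_power norm_inverse del: of_real_diff of_real_power of_real_mult)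
  qed
  also have "\<dots> = 2 * (1 - q\<^sup>2) / q"
  proof -
    have "1 - b\<^sup>2 = (1 - q\<^sup>2) * (1 + q\<^sup>2)" by (simp add: bq algebra_simps power2_eq_square)
    moreover have "1 + q\<^sup>2 \<noteq> 0" by (simp add: add_pos_nonneg less_imp_neq[symmetric])
    ultimately show ?thesis by simp
  qed
  also have "\<dots> = 4 * cos (\<theta> / 2) / sin (\<theta> / 2)"
  proof -
    have s: "sin (\<theta> / 4) > 0" using \<theta> by (intro sin_gt_zero) auto
    have "cos (\<theta> / 2) = (cos (\<theta> / 4))\<^sup>2 - (sin (\<theta> / 4))\<^sup>2" "sin (\<theta> / 2) = 2 * sin (\<theta> / 4) * cos (\<theta> / 4)"
      using cos_double[of "\<theta> / 4"] sin_double[of "\<theta> / 4"] by simp_all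
    thus ?thesis using s c by (simp only: q_def tan_def) (simp add: field_simps power2_eq_square)
  qed
  finally show "norm (deriv (slit_to_half_plane b) 0) = 4 * cos (\<theta> / 2) / sin (\<theta> / 2)" .
qed

text \<open>
  Write \<open>M = \<bar>G - a\<bar>\<close> at \<open>cis \<theta>\<close>.  Koebe's theorem gives \<open>\<bar>G'\<bar> sin \<theta> \<le> 2 M\<close>, and the slit disc
  gives \<open>M (M - s) \<le> 4 s \<bar>G'\<bar> cot (\<theta> / 2)\<close>.  Eliminating \<open>\<bar>G'\<bar>\<close> from the second by the first leaves
  \<open>M \<le> s (1 + 4 / sin\<^sup>2 (\<theta> / 2))\<close>, which is put back into the first.
\<close>

theorem half_plane_derivative_bound:
  assumes hol: "G holomorphic_on {t. 0 < Im t}" and inj: "inj_on G {t. 0 < Im t}"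
    and a: "a \<notin> G ` {t. 0 < Im t}" and s: "0 < s"
    and bdry: "\<And>x s'. x < 0 \<Longrightarrow> s < s' \<Longrightarrow> 
        eventually (\<lambda>t. norm (G t - a) < s') (at (of_real x) within {t. 0 < Im t})"
    and \<theta>: "0 < \<theta>" "\<theta> < pi"
  shows "norm (deriv G (cis \<theta>)) * sin \<theta> \<le> 2 * s * (1 + 4 / (sin (\<theta> / 2))\<^sup>2)"
proof -
  let ?H = "{t. 0 < Im t}"
  define M where "M = norm (G (cis \<theta>) - a)"
  have sin: "0 < sin \<theta>" using \<theta> by (intro sin_gt_zero) auto
  have sc: "0 < sin (\<theta> / 2)" "0 < cos (\<theta> / 2)"
    using \<theta> by (auto intro!: sin_gt_zero cos_gt_zero_pi)
  have dbl: "sin \<theta> = 2 * sin (\<theta> / 2) * cos (\<theta> / 2)" using sin_double[of "\<theta> / 2"] by simp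
  have K: "norm (deriv G (cis \<theta>)) * sin \<theta> \<le> 2 * M"
    using Koebe_half_plane[OF hol inj a, of "cis \<theta>"] sin by (simp add: M_def)
  have M: "0 < M" using a sin by (auto simp: M_def)
  define b where "b = (tan (\<theta> / 4))\<^sup>2"
  note b = slit_to_half_plane_at_0[OF \<theta> b_def]
  let ?\<tau> = "slit_to_half_plane b"
  note \<tau> = slit_to_half_plane_props[OF b(1,2)]
  have 0: "0 \<in> slit_disc b" using b by (auto simp: slit_disc_def)
  have "norm ((G \<circ> ?\<tau>) 0 - a) * (norm ((G \<circ> ?\<tau>) 0 - a) - s) \<le> s * norm (deriv (G \<circ> ?\<tau>) 0)"
  proof (rule slit_disc_radial_bound[OF b(1,2) _ _ _ s])
    show "G \<circ> ?\<tau> holomorphic_on slit_disc b"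
      by (rule holomorphic_on_compose_gen[OF \<tau>(3) hol \<tau>(1)])
    show "inj_on (G \<circ> ?\<tau>) (slit_disc b)"
      by (rule comp_inj_on[OF \<tau>(2) inj_on_subset[OF inj \<tau>(1)]])
    show "a \<notin> (G \<circ> ?\<tau>) ` slit_disc b" using a \<tau>(1) by (auto simp: image_comp[symmetric])
    fix y s' :: real assume y: "y \<in> {0<..<2*pi}" and s': "s < s'"
    from slit_to_half_plane_boundary[OF b(1,2) y] obtain x where x: "x < 0"
       "filterlim (\<lambda>r. ?\<tau> (of_real r * cis y)) (at (of_real x) within {t. 0 < Im t}) (at_left 1)" .
    from eventually_compose_filterlim[OF bdry[OF x(1) s'] x(2)]
    show "eventually (\<lambda>r. norm ((G \<circ> ?\<tau>) (of_real r * cis y) - a) < s') (at_left 1)" by simp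
  qed
  moreover have "deriv (G \<circ> ?\<tau>) 0 = deriv G (cis \<theta>) * deriv ?\<tau> 0"
  proof (rule DERIV_imp_deriv, rule DERIV_chain)
    show "(G has_field_derivative deriv G (cis \<theta>)) (at (?\<tau> 0))"
      unfolding b(3) using sin by (intro holomorphic_derivI[OF hol open_halfspace_Im_gt]) auto
    show "(?\<tau> has_field_derivative deriv ?\<tau> 0) (at 0)"
      by (rule holomorphic_derivI[OF \<tau>(3) open_slit_disc 0])
  qed
  ultimately have "M * (M - s) \<le> s * (norm (deriv G (cis \<theta>)) * (4 * cos (\<theta> / 2) / sin (\<theta> / 2)))"
    by (simp add: b(3,4) norm_mult M_def)
  also have "\<dots> = s * (norm (deriv G (cis \<theta>)) * sin \<theta>) * (2 / (sin (\<theta> / 2))\<^sup>2)"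
    using sc by (simp add: dbl field_simps power2_eq_square)
  also have "\<dots> \<le> s * (2 * M) * (2 / (sin (\<theta> / 2))\<^sup>2)"
    using K s by (intro mult_right_mono mult_left_mono) auto
  finally have "M * (M - s) \<le> M * (s * (4 / (sin (\<theta> / 2))\<^sup>2))" by (simp add: mult_ac)
  hence "M - s \<le> s * (4 / (sin (\<theta> / 2))\<^sup>2)" using M by (simp only: mult_le_cancel_left_pos)
  hence "M \<le> s * (1 + 4 / (sin (\<theta> / 2))\<^sup>2)" by (simp add: algebra_simps)
  thus ?thesis using K by simp
qed

section \<open>A derivative bound in the strip\<close>

text \<open>
  If \<open>F w = a\<close>, then by openness \<open>F\<close> takes all values near \<open>a\<close> close to \<open>w\<close>, and by injectivity
  nowhere else, in particular not close to \<open>z0\<close>.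
\<close>

lemma boundary_value_not_attained:
  fixes F :: "complex \<Rightarrow> complex"
  assumes S: "open S" and hol: "F holomorphic_on S" and inj: "inj_on F S"
    and lim: "(F \<longlongrightarrow> a) (at z0 within S)" and z0: "z0 \<notin> S" and nt: "at z0 within S \<noteq> bot"
  shows "a \<notin> F ` S"
proof
  assume "a \<in> F ` S"
  then obtain w where w: "w \<in> S" "a = F w" by blast
  obtain e0 where e0: "e0 > 0" "ball w e0 \<subseteq> S" using S w(1) openE by blast
  define e where "e = min e0 (dist z0 w / 2)"
  have "z0 \<noteq> w" using z0 w by auto
  hence e: "e > 0" "ball w e \<subseteq> S" "e < dist z0 w" using e0 by (auto simp: e_def min_less_iff_disj)
  have "open (F ` ball w e)"
    using open_mapping_thm3[OF holomorphic_on_subset[OF hol e(2)] open_ball inj_on_subset[OF inj e(2)]] .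
  moreover have "a \<in> F ` ball w e" using w e by auto
  ultimately have "eventually (\<lambda>z. F z \<in> F ` ball w e) (at z0 within S)"
    using lim topological_tendstoD by blast
  moreover have "eventually (\<lambda>z. z \<in> - cball w e) (at z0 within S)"
    using e by (intro eventually_at_in_open'[THEN filter_leD[OF at_le[OF subset_UNIV]]]) (auto simp: dist_commute)
  moreover have "eventually (\<lambda>z. z \<in> S) (at z0 within S)"
    by (simp add: eventually_at_filter)
  ultimately have "eventually (\<lambda>z. False) (at z0 within S)"
  proof eventually_elim
    case (elim z)
    then obtain z' where "z' \<in> ball w e" "F z = F z'" by blast
    moreover from this have "z = z'" using inj_onD[OF inj] e elim by blast
    ultimately show ?case using elim by auto
  qed
  thus False using nt by (simp add: trivial_limit_def)
qed

definition strip :: "complex set" where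
  "strip = {w. 0 < Im w \<and> Im w < pi}"

lemma open_strip: "open strip"
proof -
  have *: "strip = {w. 0 < Im w} \<inter> {w. Im w < pi}" by (auto simp: strip_def)
  show ?thesis unfolding * by (intro open_Int open_halfspace_Im_gt open_halfspace_Im_lt)
qed

lemma at_within_strip_top_nontrivial: "at (Complex x pi) within strip \<noteq> bot"
proof -
  have "((\<lambda>y. Complex x y) \<longlongrightarrow> Complex x pi) (at_left pi)"
    unfolding Complex_eq by (intro tendsto_intros)
  moreover have "eventually (\<lambda>y. y \<in> {0<..<pi}) (at_left pi)"
    by (rule eventually_at_left_real) simp
  hence "eventually (\<lambda>y. Complex x y \<in> strip \<and> Complex x y \<noteq> Complex x pi) (at_left pi)"
    by (rule eventually_mono) (auto simp: strip_def)
  ultimately have f: "filterlim (\<lambda>y. Complex x y) (at (Complex x pi) within strip) (at_left pi)"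
    by (simp add: filterlim_at)
  show ?thesis
  proof
    assume "at (Complex x pi) within strip = bot"
    hence "eventually (\<lambda>_. False) (at (Complex x pi) within strip)" by simp
    from eventually_compose_filterlim[OF this f] show False
      by (simp add: eventually_False trivial_limit_at_left_real)
  qed
qed

text \<open>
  Rotating by \<open>-\<i>\<close> before taking \<open>Ln\<close> gives a branch of the logarithm that is continuous up to the
  negative axis.
\<close>

lemma log_of_upper_half_plane:
  assumes "0 < Im u"
  shows "exp (Ln (- \<i> * u) + \<i> * pi / 2) = u" "Ln (- \<i> * u) + \<i> * pi / 2 \<in> strip"
proof -
  have nz: "- \<i> * u \<noteq> 0" using assms by auto
  show "exp (Ln (- \<i> * u) + \<i> * pi / 2) = u"
  proof -
    have "exp (\<i> * complex_of_real pi / 2) = \<i>" using cis_pi_half by (simp add: cis_conv_exp)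
    hence "exp (Ln (- \<i> * u) + \<i> * pi / 2) = - \<i> * u * \<i>" using nz by (simp add: exp_add)
    also have "\<dots> = u" by (simp add: complex_eq_iff)
    finally show ?thesis .
  qed
  have "\<bar>Im (Ln (- \<i> * u))\<bar> < pi / 2"
    using Re_Ln_pos_lt[OF nz] assms by simp
  thus "Ln (- \<i> * u) + \<i> * pi / 2 \<in> strip" by (auto simp: strip_def)
qed

text \<open>
  With \<open>u = exp (w - x0)\<close>, the map \<open>t = (4 u + 1) / (u + 4)\<close> carries the strip to the half-plane, the
  window of radius \<open>ln 4\<close> on the line \<open>Im w = \<pi>\<close> to the negative axis and the base point to the
  unit circle.  There \<open>half_plane_derivative_bound\<close> applies; the fraction in the bound is
  \<open>1 / sin\<^sup>2 (\<theta> / 2)\<close> for the angle \<open>\<theta>\<close> of the transformed base point.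
\<close>

theorem strip_derivative_bound:
  assumes hol: "F holomorphic_on strip" and inj: "inj_on F strip"
    and bdry: "\<And>x. (F \<longlongrightarrow> F (Complex x pi)) (at (Complex x pi) within strip)"
    and s: "0 < s" and osc: "\<And>x. \<bar>x - x0\<bar> < ln 4 \<Longrightarrow> dist (F (Complex x pi)) (F (Complex x0 pi)) \<le> s"
    and \<phi>: "0 < \<phi>" "\<phi> < pi"
  shows "norm (deriv F (Complex x0 \<phi>)) * sin \<phi> 
     \<le> 2 * s * (1 + 4 * ((17 + 8 * cos \<phi>) / (9 * (sin (\<phi> / 2))\<^sup>2)))"
proof -
  let ?H = "{t. 0 < Im t}"
  define a where "a = F (Complex x0 pi)"
  have a: "a \<notin> F ` strip"
    unfolding a_def 
    by (rule boundary_value_not_attained[OF open_strip hol inj bdry _ at_within_strip_top_nontrivial])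
       (auto simp: strip_def)
  define u where "u = (\<lambda>t::complex. (4 * t - 1) / (4 - t))"
  define L where "L = (\<lambda>t. of_real x0 + (Ln (- \<i> * u t) + \<i> * pi / 2))"
  have Imu: "Im (u t) = 15 * Im t / (norm (4 - t))\<^sup>2" for t
    unfolding u_def Im_divide cmod_power2 by (simp add: algebra_simps)
  have uH: "0 < Im (u t)" "t \<noteq> 4" if "t \<in> ?H" for t
  proof -
    show "t \<noteq> 4" using that by auto
    thus "0 < Im (u t)" using that by (simp add: Imu)
  qed
  have LS: "L ` ?H \<subseteq> strip"
    using log_of_upper_half_plane(2)[OF uH(1)] by (auto simp: L_def strip_def)
  have expL: "exp (L t) = exp (of_real x0) * u t" if "t \<in> ?H" for t
    unfolding L_def using log_of_upper_half_plane(1)[OF uH(1)[OF that]] by (simp only: exp_add)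
  have injL: "inj_on L ?H"
  proof (rule inj_onI)
    fix t t' assume t: "t \<in> ?H" "t' \<in> ?H" "L t = L t'"
    hence "u t = u t'" using expL[OF t(1)] expL[OF t(2)] by simp
    hence "(4 * t - 1) * (4 - t') = (4 * t' - 1) * (4 - t)"
      using uH(2)[OF t(1)] uH(2)[OF t(2)] by (simp add: u_def frac_eq_eq)
    thus "t = t'" by (simp add: algebra_simps)
  qed
  have uC: "- \<i> * u t \<notin> \<real>\<^sub>\<le>\<^sub>0" if "t \<in> ?H" for t
    using uH(1)[OF that] by (auto simp: complex_nonpos_Reals_iff)
  have holL: "L holomorphic_on ?H"
  proof -
    have "u holomorphic_on ?H" unfolding u_def using uH(2) by (intro holomorphic_intros) auto
    thus ?thesis unfolding L_def using uC by (intro holomorphic_intros) auto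
  qed
  define G where "G = F \<circ> L"
  define z where "z = cis \<phi>"
  \<comment> \<open>The transformed base point; it is unimodular because \<open>\<bar>4 z + 1\<bar> = \<bar>z + 4\<bar>\<close> on the unit circle.\<close>
  define t0 where "t0 = (4 * z + 1) / (z + 4)"
  have sin: "0 < sin \<phi>" using \<phi> by (intro sin_gt_zero) auto
  define N where "N = 17 + 8 * cos \<phi>"
  have N: "0 < N" unfolding N_def using cos_ge_minus_one[of \<phi>] by linarith
  have zN: "(norm (z + 4))\<^sup>2 = N" "(norm (4 * z + 1))\<^sup>2 = N"
  proof -
    have "(cos \<phi> + 4)\<^sup>2 + (sin \<phi>)\<^sup>2 = 17 + 8 * cos \<phi>" "(4 * cos \<phi> + 1)\<^sup>2 + (4 * sin \<phi>)\<^sup>2 = 17 + 8 * cos \<phi>"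
      using sin_cos_squared_add[of \<phi>] by algebra+
    thus "(norm (z + 4))\<^sup>2 = N" "(norm (4 * z + 1))\<^sup>2 = N"
      unfolding cmod_power2 z_def N_def by simp_all
  qed
  have z4: "z + 4 \<noteq> 0" using zN(1) N by auto
  have "(norm t0)\<^sup>2 = 1" unfolding t0_def using zN N by (simp add: norm_divide power_divide)
  hence nt0: "norm t0 = 1" using norm_ge_zero[of t0] unfolding power2_eq_1_iff by linarith
  have Ret0: "Re t0 = (8 + 17 * cos \<phi>) / N" and Imt0: "Im t0 = 15 * sin \<phi> / N"
  proof -
    have "(4 * cos \<phi> + 1) * (cos \<phi> + 4) + 4 * sin \<phi> * sin \<phi> = 8 + 17 * cos \<phi>"
      "4 * sin \<phi> * (cos \<phi> + 4) - (4 * cos \<phi> + 1) * sin \<phi> = 15 * sin \<phi>"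
      using sin_cos_squared_add[of \<phi>] by (algebra, simp add: algebra_simps)
    thus "Re t0 = (8 + 17 * cos \<phi>) / N" "Im t0 = 15 * sin \<phi> / N"
      unfolding t0_def Re_divide Im_divide zN(1)[unfolded cmod_power2] by (simp_all add: z_def)
  qed
  have "0 < Im t0" using Imt0 N sin by simp
  define \<theta> where "\<theta> = Arg t0"
  have t0\<theta>: "t0 = cis \<theta>" using nt0 cis_Arg[of t0] norm_zero[where 'a=complex] by (fastforce simp: \<theta>_def sgn_div_norm)
  have \<theta>: "0 < \<theta>" "\<theta> < pi" using \<open>0 < Im t0\<close> Arg_lt_pi[of t0] by (auto simp: \<theta>_def)
  have "norm (deriv G (cis \<theta>)) * sin \<theta> \<le> 2 * s * (1 + 4 / (sin (\<theta> / 2))\<^sup>2)"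
  proof (rule half_plane_derivative_bound[OF _ _ _ s _ \<theta>])
    show "G holomorphic_on ?H" unfolding G_def by (rule holomorphic_on_compose_gen[OF holL hol LS])
    show "inj_on G ?H" unfolding G_def by (rule comp_inj_on[OF injL inj_on_subset[OF inj LS]])
    show "a \<notin> G ` ?H" using a LS by (auto simp: G_def image_comp[symmetric])
    fix x s' :: real assume x: "x < 0" and s': "s < s'"
    define v where "v = (4 * x - 1) / (4 - x)"
    have v: "v < 0" "\<bar>ln (- v)\<bar> < ln 4"
    proof -
      show "v < 0" using x by (simp add: v_def divide_neg_pos)
      have "- v < 4" "1 / 4 < - v" using x by (simp_all add: v_def field_simps)
      hence "ln (- v) < ln 4" "ln (1 / 4) < ln (- v)" by (simp_all only: ln_less_cancel_iff)
      thus "\<bar>ln (- v)\<bar> < ln 4" by (simp add: ln_div abs_less_iff)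
    qed
    have ux: "u (of_real x) = of_real v" by (simp add: u_def v_def)
    have nx: "- \<i> * u (of_real x) \<notin> \<real>\<^sub>\<le>\<^sub>0" "complex_of_real x \<noteq> 4"
      using v x by (auto simp: ux complex_nonpos_Reals_iff complex_eq_iff)
    have "isCont u (of_real x)"
      unfolding u_def using nx(2) by (intro continuous_intros) auto
    hence cL: "isCont L (of_real x)"
      unfolding L_def using nx(1) by (intro continuous_intros) auto
    have Lx: "L (of_real x) = Complex (x0 + ln (- v)) pi"
    proof -
      have e: "- \<i> * u (of_real x) = of_real (- v) * \<i>" by (simp add: ux)
      have "Ln (of_real (- v) * \<i>) = of_real (ln (- v)) + Ln \<i>"
        by (subst Ln_times_of_real) (use v Ln_of_real[of "- v"] in simp_all)
      thus ?thesis unfolding L_def e by (simp only: Ln_ii) (simp add: complex_eq_iff)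
    qed
    have "(L \<longlongrightarrow> Complex (x0 + ln (- v)) pi) (at (of_real x) within ?H)"
      by (rule tendsto_within_subset[OF isContD[OF cL, unfolded Lx] subset_UNIV])
    moreover have "eventually (\<lambda>t. t \<in> ?H) (at (of_real x) within ?H)"
      by (simp add: eventually_at_filter)
    hence "eventually (\<lambda>t. L t \<in> strip \<and> L t \<noteq> Complex (x0 + ln (- v)) pi) (at (of_real x) within ?H)"
      by (rule eventually_mono) (use LS in \<open>force simp: strip_def\<close>)
    ultimately have "filterlim L (at (Complex (x0 + ln (- v)) pi) within strip) (at (of_real x) within ?H)"
      by (simp add: filterlim_at)
    from filterlim_compose[OF bdry this]
    have "(G \<longlongrightarrow> F (Complex (x0 + ln (- v)) pi)) (at (of_real x) within ?H)" by (simp add: G_def o_def)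
    hence "((\<lambda>t. norm (G t - a)) \<longlongrightarrow> norm (F (Complex (x0 + ln (- v)) pi) - a)) (at (of_real x) within ?H)"
      by (intro tendsto_intros)
    moreover have "norm (F (Complex (x0 + ln (- v)) pi) - a) < s'"
      using osc[of "x0 + ln (- v)"] v s' by (simp add: a_def dist_norm)
    ultimately show "eventually (\<lambda>t. norm (G t - a) < s') (at (of_real x) within ?H)"
      by (rule order_tendstoD)
  qed
  moreover have "norm (deriv G t0) * Im t0 = norm (deriv F (Complex x0 \<phi>)) * sin \<phi>"
  proof -
    have "4 * (z + 4) - (4 * z + 1) = 15" by simp
    hence t4: "4 - t0 = 15 / (z + 4)" using z4 by (simp add: t0_def field_simps)
    have "4 * (4 * z + 1) - (z + 4) = 15 * z" by simp
    hence "4 * t0 - 1 = 15 * z / (z + 4)" using z4 by (simp add: t0_def field_simps)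
    hence ut0: "u t0 = z" using t4 z4 by (simp add: u_def)
    have Lt0: "L t0 = Complex x0 \<phi>"
    proof -
      have e: "- \<i> * z = exp (\<i> * of_real (\<phi> - pi / 2))"
        unfolding cis_conv_exp[symmetric] by (simp add: z_def complex_eq_iff cos_diff sin_diff)
      have "Ln (exp (\<i> * of_real (\<phi> - pi / 2))) = \<i> * of_real (\<phi> - pi / 2)"
        using \<phi> by (intro Ln_exp) auto
      thus ?thesis unfolding L_def ut0 e by (simp only:) (simp add: complex_eq_iff)
    qed
    have "(u has_field_derivative 15 / (4 - t0)\<^sup>2) (at t0)"
      unfolding u_def using uH(2)[of t0] \<open>0 < Im t0\<close>
      by (auto intro!: derivative_eq_intros simp: power2_eq_square algebra_simps)
    hence "(L has_field_derivative (15 / (4 - t0)\<^sup>2) / z) (at t0)"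
      unfolding L_def using uC[of t0] \<open>0 < Im t0\<close>
      by (auto intro!: derivative_eq_intros simp: ut0 z_def field_simps)
    moreover have "(F has_field_derivative deriv F (Complex x0 \<phi>)) (at (L t0))"
      unfolding Lt0 by (rule holomorphic_derivI[OF hol open_strip]) (use \<phi> in \<open>simp add: strip_def\<close>)
    ultimately have "(G has_field_derivative deriv F (Complex x0 \<phi>) * ((15 / (4 - t0)\<^sup>2) / z)) (at t0)"
      unfolding G_def by (intro DERIV_chain)
    hence "norm (deriv G t0) = norm (deriv F (Complex x0 \<phi>)) * (15 / (norm (4 - t0))\<^sup>2)"
      by (simp add: DERIV_imp_deriv norm_mult norm_divide norm_power z_def)
    also have "(norm (4 - t0))\<^sup>2 = 225 / N"
      unfolding t4 by (simp add: norm_divide power_divide zN)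
    also have "15 / (225 / N) = N / 15" by simp
    finally show ?thesis using N by (simp only: Imt0) simp
  qed
  moreover have "sin \<theta> = Im t0" "cos \<theta> = Re t0" by (simp_all add: t0\<theta>)
  moreover have "(sin (\<theta> / 2))\<^sup>2 = 9 * (sin (\<phi> / 2))\<^sup>2 / N"
  proof -
    have half: "(sin (x / 2))\<^sup>2 = (1 - cos x) / 2" for x :: real
      using cos_double_sin[of "x / 2"] by simp
    have "1 - cos \<theta> = 9 * (1 - cos \<phi>) / N"
      using \<open>cos \<theta> = Re t0\<close> N unfolding Ret0 by (simp add: field_simps N_def)
    thus ?thesis by (simp add: half)
  qed
  ultimately show ?thesis by (simp add: t0\<theta>[symmetric] N_def)
qed

section \<open>Lengths of curves and the line estimate in the strip\<close>

abbreviation polygon_length :: "(real \<Rightarrow> 'a::metric_space) \<Rightarrow> real list \<Rightarrow> ennreal" where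
  "polygon_length \<gamma> ts \<equiv> (\<Sum>i<length ts - 1. ennreal (dist (\<gamma> (ts ! i)) (\<gamma> (ts ! Suc i))))"

lemma polygon_length_le_curve_length:
  "sorted ts \<Longrightarrow> set ts \<subseteq> I \<Longrightarrow> polygon_length \<gamma> ts \<le> curve_length I \<gamma>"
  unfolding curve_length_def by (rule SUP_upper) auto

lemma curve_length_leI:
  "(\<And>ts. sorted ts \<Longrightarrow> set ts \<subseteq> I \<Longrightarrow> polygon_length \<gamma> ts \<le> C) \<Longrightarrow> curve_length I \<gamma> \<le> C"
  unfolding curve_length_def by (rule SUP_least) auto

lemma curve_length_mono: "I \<subseteq> J \<Longrightarrow> curve_length I \<gamma> \<le> curve_length J \<gamma>"
  by (intro curve_length_leI polygon_length_le_curve_length) auto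

lemma dist_le_curve_length:
  assumes "x \<in> I" "y \<in> I"
  shows "ennreal (dist (\<gamma> x) (\<gamma> y)) \<le> curve_length I \<gamma>"
  using polygon_length_le_curve_length[of "[x, y]" I \<gamma>] polygon_length_le_curve_length[of "[y, x]" I \<gamma>] assms
  by (cases "x \<le> y") (auto simp: dist_commute)

lemma polygon_length_append:
  "polygon_length \<gamma> ts + polygon_length \<gamma> us \<le> polygon_length \<gamma> (ts @ us)"
proof (cases "ts = [] \<or> us = []")
  case False
  define n m where "n = length ts" and "m = length us"
  have nm: "0 < n" "0 < m" using False by (auto simp: n_def m_def)
  let ?f = "\<lambda>i. ennreal (dist (\<gamma> ((ts @ us) ! i)) (\<gamma> ((ts @ us) ! Suc i)))"
  have "polygon_length \<gamma> ts = (\<Sum>i<n - 1. ?f i)"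
    by (intro sum.cong) (auto simp: n_def nth_append)
  moreover have "polygon_length \<gamma> us = (\<Sum>i<m - 1. ?f (i + n))"
    by (intro sum.cong) (auto simp: n_def m_def nth_append)
  moreover have "(\<Sum>i<m - 1. ?f (i + n)) = (\<Sum>i\<in>{n..<m - 1 + n}. ?f i)"
    using sum.shift_bounds_nat_ivl[of ?f 0 n "m - 1"] by (simp add: atLeast0LessThan)
  moreover have "(\<Sum>i<n - 1. ?f i) + (\<Sum>i\<in>{n..<m - 1 + n}. ?f i) = (\<Sum>i\<in>{..<n - 1} \<union> {n..<m - 1 + n}. ?f i)"
    by (intro sum.union_disjoint[symmetric]) auto
  moreover have "\<dots> \<le> (\<Sum>i<length (ts @ us) - 1. ?f i)"
    using nm by (intro sum_mono2) (auto simp: n_def m_def)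
  ultimately show ?thesis by simp
qed auto

lemma curve_length_superadditive:
  assumes "\<And>x y. x \<in> A \<Longrightarrow> y \<in> B \<Longrightarrow> x \<le> y"
  shows "curve_length A \<gamma> + curve_length B \<gamma> \<le> curve_length (A \<union> B) \<gamma>"
proof -
  let ?L = "\<lambda>A. {ts. sorted ts \<and> set ts \<subseteq> A}"
  have ne: "?L A \<noteq> {}" for A by (auto intro: exI[of _ "[]"])
  have "curve_length A \<gamma> + curve_length B \<gamma> = 
     (SUP ts\<in>?L A. SUP us\<in>?L B. polygon_length \<gamma> ts + polygon_length \<gamma> us)"
    unfolding curve_length_def
    by (simp add: ennreal_SUP_add_left[OF ne, symmetric] ennreal_SUP_add_right[OF ne, symmetric])
  also have "\<dots> \<le> curve_length (A \<union> B) \<gamma>"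
  proof (intro SUP_least)
    fix ts us assume "ts \<in> ?L A" "us \<in> ?L B"
    hence "sorted (ts @ us)" "set (ts @ us) \<subseteq> A \<union> B"
      using assms by (auto simp: sorted_append subset_iff)
    from polygon_length_le_curve_length[OF this]
    show "polygon_length \<gamma> ts + polygon_length \<gamma> us \<le> curve_length (A \<union> B) \<gamma>"
      by (rule order_trans[OF polygon_length_append])
  qed
  finally show ?thesis .
qed

lemma sum_curve_length_le:
  fixes n :: nat
  assumes "\<And>j k x y. j < k \<Longrightarrow> k < n \<Longrightarrow> x \<in> I k \<Longrightarrow> y \<in> I j \<Longrightarrow> x \<le> y"
  shows "(\<Sum>k<n. curve_length (I k) \<gamma>) \<le> curve_length (\<Union>k<n. I k) \<gamma>"
  using assms
proof (induction n)
  case (Suc n)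
  have "(\<Sum>k<Suc n. curve_length (I k) \<gamma>) = curve_length (I n) \<gamma> + (\<Sum>k<n. curve_length (I k) \<gamma>)"
    by (simp add: add.commute)
  also have "\<dots> \<le> curve_length (I n) \<gamma> + curve_length (\<Union>k<n. I k) \<gamma>"
    using Suc by (intro add_left_mono) auto
  also have "\<dots> \<le> curve_length (I n \<union> (\<Union>k<n. I k)) \<gamma>"
    using Suc.prems by (intro curve_length_superadditive) auto
  also have "I n \<union> (\<Union>k<n. I k) = (\<Union>k<Suc n. I k)" by (auto simp: less_Suc_eq)
  finally show ?case .
qed simp

lemma curve_length_le_variation:
  assumes B: "\<And>x y. x \<in> I \<Longrightarrow> y \<in> I \<Longrightarrow> x \<le> y \<Longrightarrow> dist (\<gamma> x) (\<gamma> y) \<le> B y - B x"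
    and C: "\<And>x y. x \<in> I \<Longrightarrow> y \<in> I \<Longrightarrow> x \<le> y \<Longrightarrow> B y - B x \<le> C"
  shows "curve_length I \<gamma> \<le> ennreal C"
proof (rule curve_length_leI)
  fix ts :: "real list" assume ts: "sorted ts" "set ts \<subseteq> I"
  show "polygon_length \<gamma> ts \<le> ennreal C"
  proof (cases "ts = []")
    case False
    define n where "n = length ts - 1"
    have n: "length ts = Suc n" using False by (simp add: n_def)
    have "polygon_length \<gamma> ts = ennreal (\<Sum>i<n. dist (\<gamma> (ts ! i)) (\<gamma> (ts ! Suc i)))"
      by (simp add: n)
    also have "\<dots> \<le> ennreal (\<Sum>i<n. B (ts ! Suc i) - B (ts ! i))"
    proof (intro ennreal_leI sum_mono B)
      fix i assume i: "i \<in> {..<n}"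
      show "ts ! i \<in> I" "ts ! Suc i \<in> I" using i ts(2) n by auto
      show "ts ! i \<le> ts ! Suc i" using i ts(1) n by (intro sorted_nth_mono) auto
    qed
    also have "(\<Sum>i<n. B (ts ! Suc i) - B (ts ! i)) = B (ts ! n) - B (ts ! 0)"
      by (rule sum_lessThan_telescope)
    also have "ennreal \<dots> \<le> ennreal C"
    proof (intro ennreal_leI C)
      show "ts ! 0 \<in> I" "ts ! n \<in> I" using ts(2) n by auto
      show "ts ! 0 \<le> ts ! n" using ts(1) n by (intro sorted_nth_mono) auto
    qed
    finally show ?thesis .
  qed simp
qed

text \<open>
  The antiderivative \<open>B\<close> measures length along the image of the line \<open>Im w = \<phi>\<close>.  The derivative bound
  at \<open>x\<close> involves the length over the window of radius \<open>ln 4\<close> about \<open>x\<close>.  For the points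
  \<open>x + k ln 16\<close> these windows are disjoint, so the sum of their lengths is at most the total length,
  and integrating the sum over one period of length \<open>ln 16\<close> covers the whole line.  The
  parametrisation \<open>T\<close> decreases because the positive direction of the line \<open>Im w = \<pi>\<close> corresponds to
  the clockwise direction on the semicircle.
\<close>

theorem strip_line_length_bound:
  assumes hol: "F holomorphic_on strip" and inj: "inj_on F strip"
    and bdry: "\<And>x. (F \<longlongrightarrow> F (Complex x pi)) (at (Complex x pi) within strip)"
    and top: "\<And>x. F (Complex x pi) = \<gamma> (T x)" "\<And>x y. x < y \<Longrightarrow> T y < T x" "range T \<subseteq> J"
    and fin: "curve_length J \<gamma> < \<infinity>" and \<phi>: "0 < \<phi>" "\<phi> < pi"
    and C: "C = 2 * (1 + 4 * ((17 + 8 * cos \<phi>) / (9 * (sin (\<phi> / 2))\<^sup>2))) / sin \<phi>"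
  obtains B where "\<And>x. (B has_real_derivative norm (deriv F (Complex x \<phi>))) (at x)"
    "\<And>x y. x \<le> y \<Longrightarrow> B y - B x \<le> C * ln 16 * enn2real (curve_length J \<gamma>)"
proof -
  define g where "g = (\<lambda>x. norm (deriv F (Complex x \<phi>)))"
  have sin: "0 < sin \<phi>" using \<phi> by (intro sin_gt_zero) auto
  have Cpos: "0 < C"
  proof -
    have "0 < 17 + 8 * cos \<phi>" using cos_ge_minus_one[of \<phi>] by linarith
    thus ?thesis unfolding C using sin by (intro divide_pos_pos mult_pos_pos add_pos_nonneg) auto
  qed
  have inS: "Complex x \<phi> \<in> strip" for x using \<phi> by (simp add: strip_def)
  have cC: "continuous_on UNIV (\<lambda>x. Complex x \<phi>)"
    unfolding Complex_eq by (intro continuous_intros)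
  have cD: "continuous_on strip (deriv F)"
    by (intro holomorphic_on_imp_continuous_on holomorphic_deriv hol open_strip)
  have "continuous_on UNIV (\<lambda>x. deriv F (Complex x \<phi>))"
    by (rule continuous_on_compose2[OF cD cC]) (use inS in blast)
  hence "continuous_on UNIV g"
    unfolding g_def by (rule continuous_on_norm)
  hence "isCont g x" for x
    using continuous_on_eq_continuous_at[OF open_UNIV] by blast
  from einterval_antiderivative[of "- \<infinity>" "\<infinity>" g, OF _ this]
  obtain B where "\<And>x. (B has_vector_derivative g x) (at x)" by force
  hence B: "\<And>x. (B has_real_derivative g x) (at x)"
    by (simp only: has_real_derivative_iff_has_vector_derivative)
  define I where "I = (\<lambda>x. T ` {x - ln 4<..<x + ln 4})"
  define len where "len = (\<lambda>x. enn2real (curve_length (I x) \<gamma>))"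
  have Ile: "curve_length (I x) \<gamma> \<le> curve_length J \<gamma>" for x
    using top(3) by (intro curve_length_mono) (auto simp: I_def)
  have fin': "curve_length (I x) \<gamma> < \<infinity>" for x using Ile[of x] fin by (rule le_less_trans)
  have len: "curve_length (I x) \<gamma> = ennreal (len x)" "0 \<le> len x" for x
    using fin'[of x] by (simp_all add: len_def)
  have pt: "g x \<le> C * len x" for x
  proof -
    have *: "g x \<le> C * s" if s: "0 < s" "len x \<le> s" for s
    proof -
      have "norm (deriv F (Complex x \<phi>)) * sin \<phi> 
         \<le> 2 * s * (1 + 4 * ((17 + 8 * cos \<phi>) / (9 * (sin (\<phi> / 2))\<^sup>2)))"
      proof (rule strip_derivative_bound[OF hol inj bdry s(1) _ \<phi>])
        fix x' assume x': "\<bar>x' - x\<bar> < ln 4"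
        have "ennreal (dist (\<gamma> (T x')) (\<gamma> (T x))) \<le> curve_length (I x) \<gamma>"
          using x' by (intro dist_le_curve_length) (auto simp: I_def abs_less_iff)
        hence "dist (\<gamma> (T x')) (\<gamma> (T x)) \<le> len x" unfolding len using len(2) by (simp add: ennreal_le_iff)
        thus "dist (F (Complex x' pi)) (F (Complex x pi)) \<le> s" using s by (simp add: top)
      qed
      thus ?thesis using sin by (simp add: g_def C field_simps)
    qed
    show ?thesis
    proof (rule ccontr)
      assume n: "\<not> g x \<le> C * len x"
      define r where "r = g x / C"
      \<comment> \<open>The window length may be 0, whereas the pointwise bound needs \<open>s > 0\<close>: a value in between works.\<close>
      define s where "s = (len x + r) / 2"
      have "len x < r" using n Cpos by (simp add: r_def field_simps)
      hence "len x < s" "s < r" by (simp_all add: s_def)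
      hence "C * s < g x" using Cpos by (simp add: r_def pos_less_divide_eq mult.commute)
      with \<open>len x < s\<close> *[of s] len(2)[of x] show False by simp
    qed
  qed
  define \<Lambda> where "\<Lambda> = enn2real (curve_length J \<gamma>)"
  have ln16: "ln 16 = 2 * ln (4::real)" using ln_realpow[of 4 2] by simp
  have "0 < ln (4::real)" by simp
  have sumg: "(\<Sum>k<n. g (X + real k * ln 16)) \<le> C * \<Lambda>" for X n
  proof -
    let ?x = "\<lambda>k. X + real k * ln 16"
    have "(\<Sum>k<n. curve_length (I (?x k)) \<gamma>) \<le> curve_length (\<Union>k<n. I (?x k)) \<gamma>"
    proof (rule sum_curve_length_le)
      fix j k x y assume jk: "j < k" "k < n" "x \<in> I (?x k)" "y \<in> I (?x j)"
      then obtain a b where ab: "x = T a" "y = T b" "?x k - ln 4 < a" "b < ?x j + ln 4"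
        unfolding I_def by auto
      have "real j + 1 \<le> real k" using jk by simp
      hence "(real j + 1) * ln 16 \<le> real k * ln 16" by (intro mult_right_mono) auto
      hence "b < a" using ab ln16 by (simp add: algebra_simps)
      thus "x \<le> y" using top(2) ab by (simp add: less_imp_le)
    qed
    also have "\<dots> \<le> curve_length J \<gamma>"
      using top(3) by (intro curve_length_mono) (auto simp: I_def)
    finally have "ennreal (\<Sum>k<n. len (?x k)) \<le> ennreal \<Lambda>"
      using fin by (simp add: len \<Lambda>_def)
    hence le: "(\<Sum>k<n. len (?x k)) \<le> \<Lambda>" by (simp add: \<Lambda>_def ennreal_le_iff)
    have "(\<Sum>k<n. g (?x k)) \<le> (\<Sum>k<n. C * len (?x k))" by (intro sum_mono pt)
    also have "\<dots> = C * (\<Sum>k<n. len (?x k))" by (simp add: sum_distrib_left)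
    also have "\<dots> \<le> C * \<Lambda>" using le Cpos by simp
    finally show ?thesis .
  qed
  have mono: "B x \<le> B y" if "x \<le> y" for x y
  proof (rule DERIV_nonneg_imp_nondecreasing[OF that])
    fix z show "\<exists>d. (B has_real_derivative d) (at z) \<and> 0 \<le> d"
      using B[of z] by (intro exI[of _ "g z"]) (simp add: g_def)
  qed
  have total: "B y - B x \<le> C * ln 16 * \<Lambda>" if "x \<le> y" for x y
  proof -
    obtain n where n: "(y - x) / ln 16 \<le> real n" using real_arch_simple by blast
    hence n': "y \<le> x + real n * ln 16" by (simp add: field_simps)
    \<comment> \<open>Over one period the sum in \<open>D\<close> telescopes to the increment of \<open>B\<close> over \<open>n\<close> periods, while
      the sum of the derivatives never exceeds \<open>C \<Lambda>\<close>.\<close>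
    define D where "D = (\<lambda>t. C * \<Lambda> * t - (\<Sum>k<n. B (x + t + real k * ln 16)))"
    have "D 0 \<le> D (ln 16)"
    proof (rule DERIV_nonneg_imp_nondecreasing[of 0 "ln 16" D])
      fix t
      have "(D has_real_derivative C * \<Lambda> - (\<Sum>k<n. g (x + t + real k * ln 16))) (at t)"
        unfolding D_def by (auto intro!: derivative_eq_intros DERIV_chain2[OF B])
      thus "\<exists>d. (D has_real_derivative d) (at t) \<and> 0 \<le> d" using sumg[of "x + t" n] by auto
    qed simp
    moreover have "(\<Sum>k<n. B (x + ln 16 + real k * ln 16)) - (\<Sum>k<n. B (x + 0 + real k * ln 16)) 
        = B (x + real n * ln 16) - B x"
      using sum_lessThan_telescope[of "\<lambda>k. B (x + real k * ln 16)" n]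
      by (simp add: sum_subtractf[symmetric] algebra_simps)
    ultimately have "B (x + real n * ln 16) - B x \<le> C * \<Lambda> * ln 16" by (simp add: D_def)
    thus ?thesis using mono[OF n'] by (simp add: mult_ac)
  qed
  show thesis
  proof (rule that)
    show "(B has_real_derivative norm (deriv F (Complex x \<phi>))) (at x)" for x
      using B[of x] by (simp add: g_def)
    show "B y - B x \<le> C * ln 16 * enn2real (curve_length J \<gamma>)" if "x \<le> y" for x y
      using total[OF that] by (simp add: \<Lambda>_def)
  qed
qed

section \<open>The lens between the semicircle and the removed disc\<close>

text \<open>
  The angle at \<open>\<i>\<close> and at \<open>-\<i>\<close> between the diameter and the circular arc through \<open>\<i>\<close>, \<open>p\<close> and \<open>-\<i>\<close>.
\<close>

lemma lens_angle:
  fixes p :: real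
  assumes p: "0 < p" "p < 1"
  defines "\<beta> \<equiv> 2 * arctan p"
  shows "0 < \<beta>" "\<beta> < pi / 2" "sin \<beta> = alpha p" "cos \<beta> = (1 - p\<^sup>2) / (1 + p\<^sup>2)" "(sin (\<beta> / 2))\<^sup>2 = p\<^sup>2 / (1 + p\<^sup>2)"
    "- (pi / 2) \<le> \<beta>"
proof -
  have pos: "0 < 1 + p\<^sup>2" by (simp add: add_pos_nonneg)
  show "0 < \<beta>" using p by (simp add: \<beta>_def)
  thus "- (pi / 2) \<le> \<beta>" using pi_gt_zero by linarith
  have "arctan p < pi / 4" using p arctan_less_iff[of p 1] by (simp only: arctan_one)
  thus "\<beta> < pi / 2" by (simp add: \<beta>_def)
  have s: "sin (arctan p) = p / sqrt (1 + p\<^sup>2)" and c: "cos (arctan p) = 1 / sqrt (1 + p\<^sup>2)"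
    by (simp_all add: sin_arctan cos_arctan)
  show "sin \<beta> = alpha p"
    unfolding \<beta>_def sin_double s c alpha_def using pos by (simp add: real_sqrt_mult[symmetric] power2_eq_square)
  show "cos \<beta> = (1 - p\<^sup>2) / (1 + p\<^sup>2)"
    unfolding \<beta>_def cos_double s c using pos by (simp add: power_divide diff_divide_distrib)
  show "(sin (\<beta> / 2))\<^sup>2 = p\<^sup>2 / (1 + p\<^sup>2)"
    using pos by (simp add: \<beta>_def s power_divide)
qed

lemma alpha_bounds:
  assumes p: "0 < p" "p < 1"
  shows "0 < alpha p" "alpha p < 1"
proof -
  have pos: "0 < 1 + p\<^sup>2" by (simp add: add_pos_nonneg)
  show "0 < alpha p" using p pos by (simp add: alpha_def)
  have "(1 - p)\<^sup>2 > 0" using p by simp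
  thus "alpha p < 1" using pos by (simp add: alpha_def power2_eq_square algebra_simps)
qed

lemma closed_Delta_iff:
  assumes \<alpha>: "0 < alpha p" "alpha p < 1"
  shows "\<zeta> \<in> closed_Delta p \<longleftrightarrow> alpha p * ((norm \<zeta>)\<^sup>2 + 1) \<le> 2 * Re \<zeta>"
proof -
  define a where "a = inverse (alpha p)"
  have a: "1 < a" using \<alpha> by (simp add: a_def one_less_inverse)
  have "\<zeta> \<in> closed_Delta p \<longleftrightarrow> norm (\<zeta> - of_real a) \<le> sqrt (a\<^sup>2 - 1)"
    by (simp add: closed_Delta_def a_def)
  also have "\<dots> \<longleftrightarrow> (norm (\<zeta> - of_real a))\<^sup>2 \<le> a\<^sup>2 - 1"
    using abs_le_square_iff[of "norm (\<zeta> - of_real a)" "sqrt (a\<^sup>2 - 1)"] a by (simp add: one_le_power)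
  also have "\<dots> \<longleftrightarrow> (norm \<zeta>)\<^sup>2 + 1 \<le> 2 * a * Re \<zeta>"
    unfolding cmod_power2 by (simp add: power2_eq_square algebra_simps)
  also have "\<dots> \<longleftrightarrow> alpha p * ((norm \<zeta>)\<^sup>2 + 1) \<le> 2 * Re \<zeta>"
    using \<alpha> by (simp add: a_def field_simps)
  finally show ?thesis .
qed

text \<open>
  This Moebius map takes the positive axis to the diameter and the positive imaginary axis to the
  left semicircle.
\<close>

definition sector_to_disc :: "complex \<Rightarrow> complex" where
  "sector_to_disc u = - \<i> * cayley (- u)"

text \<open>
  In the coordinate \<open>u\<close> the removed disc is tangent to the ray of argument \<open>-2 arctan p\<close>: its
  complement is given by \<open>\<alpha> (\<bar>u\<bar>\<^sup>2 + 1) > -2 Im u\<close>, and on the sector this follows from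
  \<open>\<bar>u\<bar>\<^sup>2 + 1 \<ge> 2 \<bar>u\<bar>\<close> since \<open>\<alpha>\<close> is the sine of the angle.
\<close>

lemma sector_to_disc_outside_Delta:
  assumes p: "0 < p" "p < 1" and u: "u = exp W" "Im W \<in> {- (2 * arctan p)<..<pi/2}"
  shows "0 < Re u" "sector_to_disc u \<in> unit_disc - closed_Delta p"
proof -
  note \<beta> = lens_angle[OF p]
  have "0 < cos (Im W)" using u \<beta>(1,2) by (intro cos_gt_zero_pi) auto
  thus Re: "0 < Re u" by (simp add: u Re_exp)
  have "- sin (Im W) < alpha p"
  proof -
    have "sin (- (2 * arctan p)) < sin (Im W)"
      using u \<beta>(1,2) by (intro sin_monotone_2pi) auto
    thus ?thesis using \<beta>(3) by simp
  qed
  hence "norm u * (- sin (Im W)) < norm u * alpha p"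
    by (intro mult_strict_left_mono) (auto simp: u)
  hence Im: "- Im u < alpha p * norm u" by (simp add: u Im_exp norm_exp_eq_Re mult.commute)
  define k where "k = cayley (- u)"
  have ne: "1 + u \<noteq> 0" using Re by (auto simp: complex_eq_iff)
  have nk: "norm k = norm (1 - u) / norm (1 + u)" by (simp add: k_def cayley_def norm_divide)
  have "(norm (1 + u))\<^sup>2 - (norm (1 - u))\<^sup>2 = 4 * Re u"
    unfolding cmod_power2 by (simp add: power2_eq_square algebra_simps)
  hence "(norm (1 - u))\<^sup>2 < (norm (1 + u))\<^sup>2" using Re by linarith
  hence "norm (1 - u) < norm (1 + u)" by (rule power2_less_imp_less) simp
  hence "norm k < 1" using nk ne by simp
  hence 1: "sector_to_disc u \<in> unit_disc" by (simp add: sector_to_disc_def k_def norm_mult)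
  have "Re (sector_to_disc u) = - 2 * Im u / (norm (1 + u))\<^sup>2"
    using Re_Im_cayley(2)[of "- u"] by (simp add: sector_to_disc_def)
  moreover have "(norm (sector_to_disc u))\<^sup>2 + 1 = 2 * ((norm u)\<^sup>2 + 1) / (norm (1 + u))\<^sup>2"
  proof -
    have "(norm (1 + u))\<^sup>2 + (norm (1 - u))\<^sup>2 = 2 * ((norm u)\<^sup>2 + 1)"
      unfolding cmod_power2 by (simp add: power2_eq_square algebra_simps)
    moreover have "norm (sector_to_disc u) = norm (1 - u) / norm (1 + u)"
      using nk by (simp add: sector_to_disc_def k_def norm_mult)
    hence "(norm (sector_to_disc u))\<^sup>2 + 1 = ((norm (1 + u))\<^sup>2 + (norm (1 - u))\<^sup>2) / (norm (1 + u))\<^sup>2"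
      using ne by (simp add: power_divide add_divide_distrib)
    ultimately show ?thesis by simp
  qed
  moreover have "2 * (- 2 * Im u) < alpha p * (2 * ((norm u)\<^sup>2 + 1))"
  proof -
    have a0: "0 < alpha p" by (rule alpha_bounds[OF p])
    have "2 * norm u \<le> (norm u)\<^sup>2 + 1" using sum_squares_ge_zero[of "norm u - 1" 0]
      by (simp add: power2_eq_square algebra_simps)
    hence "alpha p * (2 * norm u) \<le> alpha p * ((norm u)\<^sup>2 + 1)" using a0 by (intro mult_left_mono) auto
    thus ?thesis using Im by (simp add: algebra_simps)
  qed
  hence "2 * (- 2 * Im u) / (norm (1 + u))\<^sup>2 < alpha p * (2 * ((norm u)\<^sup>2 + 1)) / (norm (1 + u))\<^sup>2"
    using ne by (intro divide_strict_right_mono) auto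
  ultimately have "2 * Re (sector_to_disc u) < alpha p * ((norm (sector_to_disc u))\<^sup>2 + 1)"
    by (simp add: times_divide_eq_right)
  hence "sector_to_disc u \<notin> closed_Delta p" using alpha_bounds[OF p] by (simp add: closed_Delta_iff)
  with 1 show "sector_to_disc u \<in> unit_disc - closed_Delta p" by simp
qed

text \<open>
  The bound of \<open>strip_line_length_bound\<close> decreases in \<open>\<phi>\<close> up to \<open>\<pi> / 2\<close>; at \<open>\<phi> = 2 arctan p\<close> it is
  rational in \<open>p\<close> up to the factor \<open>ln 2\<close>.
\<close>

lemma sector_constant_le:
  fixes p :: real
  assumes p: "0 < p" "p < 1" and \<phi>: "2 * arctan p \<le> \<phi>" "\<phi> \<le> pi / 2"
  shows "2 * (1 + 4 * ((17 + 8 * cos \<phi>) / (9 * (sin (\<phi> / 2))\<^sup>2))) / sin \<phi> * ln 16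
     \<le> (1 + p\<^sup>2) / p * (20 + 400 / (9 * p\<^sup>2)) * ln 2"
proof -
  note \<beta> = lens_angle[OF p]
  have pos: "0 < 1 + p\<^sup>2" by (simp add: add_pos_nonneg)
  have \<phi>0: "0 \<le> \<phi>" using \<beta>(1) \<phi>(1) by linarith
  have \<phi>1: "\<phi> \<le> pi" using \<phi>(2) pi_gt_zero by linarith
  have \<beta>1: "2 * arctan p \<le> pi" using \<phi>(1) \<phi>1 by linarith
  have \<beta>0: "0 \<le> 2 * arctan p" using \<beta>(1) by linarith
  have c: "cos \<phi> \<le> (1 - p\<^sup>2) / (1 + p\<^sup>2)"
    unfolding \<beta>(4)[symmetric] by (subst cos_mono_le_eq) (fact \<phi>0 \<phi>1 \<beta>1 \<beta>0 \<phi>(1))+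
  have s: "2 * p / (1 + p\<^sup>2) \<le> sin \<phi>"
    using sin_monotone_2pi_le[OF \<beta>(6) \<phi>] \<beta>(3) by (simp only: alpha_def)
  have h: "p\<^sup>2 / (1 + p\<^sup>2) \<le> (sin (\<phi> / 2))\<^sup>2"
  proof -
    have "- (pi / 2) \<le> 2 * arctan p / 2" "2 * arctan p / 2 \<le> \<phi> / 2" "\<phi> / 2 \<le> pi / 2"
      using arctan_lbound[of p] \<phi>(1) \<phi>1 by simp_all
    hence "sin (2 * arctan p / 2) \<le> sin (\<phi> / 2)"
      by (rule sin_monotone_2pi_le)
    moreover have "0 \<le> sin (2 * arctan p / 2)" using p by (simp add: sin_arctan)
    ultimately have "(sin (2 * arctan p / 2))\<^sup>2 \<le> (sin (\<phi> / 2))\<^sup>2" by (rule power_mono)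
    thus ?thesis by (simp only: \<beta>(5))
  qed
  have "(17 + 8 * cos \<phi>) / (9 * (sin (\<phi> / 2))\<^sup>2) \<le> (17 + 8 * ((1 - p\<^sup>2) / (1 + p\<^sup>2))) / (9 * (p\<^sup>2 / (1 + p\<^sup>2)))"
  proof (rule frac_le)
    have "0 \<le> 17 + 8 * cos \<phi>" using cos_ge_minus_one[of \<phi>] by linarith
    thus "0 \<le> 17 + 8 * ((1 - p\<^sup>2) / (1 + p\<^sup>2))" using c by linarith
    show "17 + 8 * cos \<phi> \<le> 17 + 8 * ((1 - p\<^sup>2) / (1 + p\<^sup>2))" using c by linarith
    show "9 * (p\<^sup>2 / (1 + p\<^sup>2)) \<le> 9 * (sin (\<phi> / 2))\<^sup>2" using h by linarith
    show "0 < 9 * (p\<^sup>2 / (1 + p\<^sup>2))" using p pos by simp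
  qed
  also have "17 + 8 * ((1 - p\<^sup>2) / (1 + p\<^sup>2)) = (25 + 9 * p\<^sup>2) / (1 + p\<^sup>2)"
    using pos by (simp add: field_simps)
  also have "\<dots> / (9 * (p\<^sup>2 / (1 + p\<^sup>2))) = (25 + 9 * p\<^sup>2) / (9 * p\<^sup>2)"
    using pos by simp
  finally have 1: "2 * (1 + 4 * ((17 + 8 * cos \<phi>) / (9 * (sin (\<phi> / 2))\<^sup>2))) \<le> 2 * (1 + 4 * ((25 + 9 * p\<^sup>2) / (9 * p\<^sup>2)))"
    by (intro mult_left_mono add_left_mono) simp_all
  have "2 * (1 + 4 * ((17 + 8 * cos \<phi>) / (9 * (sin (\<phi> / 2))\<^sup>2))) / sin \<phi> 
      \<le> 2 * (1 + 4 * ((25 + 9 * p\<^sup>2) / (9 * p\<^sup>2))) / (2 * p / (1 + p\<^sup>2))"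
    using 1 s p pos by (intro frac_le) auto
  also have "2 * (1 + 4 * ((25 + 9 * p\<^sup>2) / (9 * p\<^sup>2))) = 2 * (5 + 100 / (9 * p\<^sup>2))"
    using p by (simp add: add_divide_distrib)
  also have "\<dots> / (2 * p / (1 + p\<^sup>2)) = (1 + p\<^sup>2) / p * (5 + 100 / (9 * p\<^sup>2))"
  proof -
    have "2 * y / (2 * p / w) = w / p * y" for w y :: real using p by (simp add: field_simps)
    thus ?thesis .
  qed
  finally have "2 * (1 + 4 * ((17 + 8 * cos \<phi>) / (9 * (sin (\<phi> / 2))\<^sup>2))) / sin \<phi> * ln 16
      \<le> (1 + p\<^sup>2) / p * (5 + 100 / (9 * p\<^sup>2)) * ln 16"
    by (rule mult_right_mono) simp
  also have "\<dots> = (1 + p\<^sup>2) / p * (20 + 400 / (9 * p\<^sup>2)) * ln 2"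
  proof -
    have "ln (16::real) = 4 * ln 2" using ln_realpow[of 2 4] by simp
    moreover have "a * (5 + 100 / b) * (4 * l) = a * (20 + 400 / b) * l" for a b l :: real
      by (simp add: algebra_simps)
    ultimately show ?thesis by metis
  qed
  finally show ?thesis .
qed

text \<open>
  Both sides have the same term \<open>400 / (9 p\<^sup>2)\<close>; the mixed term of the square on the right
  exceeds \<open>80 / 3 > 20\<close>.
\<close>

lemma upper_constant_less:
  fixes p :: real
  assumes p: "0 < p" "p < 1"
  shows "(1 + p\<^sup>2) / p * (20 + 400 / (9 * p\<^sup>2)) * ln 2 < (1 + p\<^sup>2) / p * (1 + sqrt 2 + 20 / (3 * p))\<^sup>2 * ln 2"
proof -
  have r: "1 < sqrt (2::real)" by simp
  have "(1 + sqrt 2 + 20 / (3 * p))\<^sup>2 = (1 + sqrt 2)\<^sup>2 + 2 * (1 + sqrt 2) * (20 / (3 * p)) + (20 / (3 * p))\<^sup>2"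
    by (simp add: power2_sum)
  moreover have "(20 / (3 * p))\<^sup>2 = 400 / (9 * p\<^sup>2)" by (simp add: power_divide power_mult_distrib)
  moreover have "20 / 3 \<le> 20 / (3 * p)" using p by (simp add: field_simps)
  hence "2 * 2 * (20 / 3) \<le> 2 * (1 + sqrt 2) * (20 / (3 * p))" using r by (intro mult_mono) auto
  moreover have "0 \<le> (1 + sqrt (2::real))\<^sup>2" by simp
  ultimately have "20 + 400 / (9 * p\<^sup>2) < (1 + sqrt 2 + 20 / (3 * p))\<^sup>2" by linarith
  thus ?thesis using p by (intro mult_strict_right_mono mult_strict_left_mono) (auto intro!: divide_pos_pos add_pos_nonneg)
qed

text \<open>
  The exponential of \<open>(h / \<pi>) w - \<i> \<beta>\<close> maps the strip to the sector between the arguments \<open>-\<beta>\<close> and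
  \<open>\<pi> / 2\<close>, whose opening is \<open>h = \<pi> / 2 + \<beta>\<close>; the diameter becomes the line \<open>Im w = \<phi>\<close> with
  \<open>\<phi> = \<pi> \<beta> / h\<close>, which lies between \<open>\<beta>\<close> and \<open>\<pi> / 2\<close>.
\<close>

theorem Mt_diameter_le:
  fixes p :: real
  assumes p: "0 < p" "p < 1" and f: "f \<in> Mt0_class p"
  shows "length_image_diameter f \<le> ennreal ((1 + p\<^sup>2) / p * (20 + 400 / (9 * p\<^sup>2)) * ln 2) * length_image_semicircle f"
proof -
  let ?\<Omega> = "unit_disc - closed_Delta p"
  have hol: "f holomorphic_on ?\<Omega>" and inj: "inj_on f ?\<Omega>" and ext: "extends_continuously ?\<Omega> f"
    and fin: "length_image_semicircle f < \<infinity>"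
    using f by (auto simp: Mt0_class_def Mt_class_def)
  \<comment> \<open>The removed disc meets the lens only on its boundary arc, whose angle with the diameter is \<open>\<beta>\<close>.\<close>
  define \<beta> where "\<beta> = 2 * arctan p"
  note \<beta> = lens_angle[OF p, folded \<beta>_def]
  define h where "h = pi / 2 + \<beta>"
  have h: "0 < h" "h < pi" using \<beta>(1,2) by (auto simp: h_def)
  define \<phi> where "\<phi> = pi * \<beta> / h"
  have \<phi>: "\<beta> \<le> \<phi>" "\<phi> \<le> pi / 2" "h / pi * \<phi> = \<beta>"
  proof -
    have "\<beta> * h \<le> \<beta> * pi" using \<beta>(1) h by (intro mult_left_mono) auto
    thus "\<beta> \<le> \<phi>" using h by (simp add: \<phi>_def pos_le_divide_eq mult.commute)
    have "2 * \<beta> \<le> h" using \<beta>(2) by (simp add: h_def)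
    hence "pi * (2 * \<beta>) \<le> pi * h" by (intro mult_left_mono) auto
    thus "\<phi> \<le> pi / 2" using h by (simp add: \<phi>_def pos_divide_le_eq)
    show "h / pi * \<phi> = \<beta>" using h by (simp add: \<phi>_def)
  qed
  have \<phi>': "0 < \<phi>" "\<phi> < pi" using \<phi> \<beta> by auto
  define W where "W = (\<lambda>w. of_real (h / pi) * w - \<i> * of_real \<beta>)"
  define Z where "Z = (\<lambda>w. sector_to_disc (exp (W w)))"
  define F where "F = f \<circ> Z"
  have ImW: "Im (W w) \<in> {- \<beta><..<pi / 2}" if "w \<in> strip" for w
  proof -
    define v where "v = h / pi * Im w"
    have "v < h / pi * pi"
      unfolding v_def using that h by (intro mult_strict_left_mono) (auto simp: strip_def)
    moreover have "0 < v" unfolding v_def using that h by (intro mult_pos_pos) (auto simp: strip_def)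
    moreover have "Im (W w) = v - \<beta>" by (simp add: W_def v_def)
    ultimately show ?thesis by (simp add: h_def)
  qed
  note U = sector_to_disc_outside_Delta[OF p refl, folded \<beta>_def, OF ImW]
  have img: "Z ` strip \<subseteq> ?\<Omega>" using U(2) by (auto simp: Z_def)
  have ne: "- exp (W w) \<noteq> 1" if "w \<in> strip" for w
  proof
    assume "- exp (W w) = 1"
    hence "Re (- exp (W w)) = Re 1" by (rule arg_cong)
    thus False using U(1)[OF that] by simp
  qed
  have holZ: "Z holomorphic_on strip"
    unfolding Z_def sector_to_disc_def W_def using ne by (intro holomorphic_intros) (auto simp: W_def)
  have injZ: "inj_on Z strip"
  proof (rule inj_onI)
    fix w w' assume w: "w \<in> strip" "w' \<in> strip" "Z w = Z w'"
    have "cayley (- exp (W w)) = cayley (- exp (W w'))"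
      using w(3) by (simp only: Z_def sector_to_disc_def) simp
    hence "- exp (W w) = - exp (W w')"
      using cayley_eq_iff[OF ne[OF w(1)] ne[OF w(2)]] by (rule iffD1[rotated])
    hence eq: "exp (W w) = exp (W w')" by (simp only: neg_equal_iff_equal)
    have im: "\<bar>Im (W w) - Im (W w')\<bar> < 2 * pi"
      using ImW[OF w(1)] ImW[OF w(2)] \<beta>(2) unfolding greaterThanLessThan_iff abs_less_iff by linarith
    have "W w = W w'" by (rule exp_complex_eqI[OF im eq])
    thus "w = w'" using h by (simp add: W_def)
  qed
  \<comment> \<open>The point \<open>x + \<i> \<pi>\<close> of the strip corresponds to \<open>cis (T x)\<close>, and \<open>X v + \<i> \<phi>\<close> below to \<open>\<i> v\<close>.\<close>
  define T where "T = (\<lambda>x. 3 * pi / 2 - 2 * arctan (exp (h / pi * x)))"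
  have WT: "exp (W (Complex x pi)) = \<i> * of_real (exp (h / pi * x))" for x
  proof -
    have "W (Complex x pi) = of_real (h / pi * x) + \<i> * of_real (pi / 2)"
      by (simp add: W_def complex_eq_iff h_def)
    thus ?thesis
      by (simp only: exp_add exp_of_real cis_conv_exp[symmetric] cis_pi_half mult.commute)
  qed
  have ZT: "Z (Complex x pi) = cis (T x)" for x
  proof -
    let ?y = "exp (h / pi * x)"
    have "cayley (\<i> * of_real (tan (- arctan ?y))) = cis (2 * (- arctan ?y))"
      by (rule cayley_i_tan) simp
    hence "cayley (- (\<i> * of_real ?y)) = cis (- 2 * arctan ?y)" by (simp add: tan_arctan)
    hence "Z (Complex x pi) = - \<i> * cis (- 2 * arctan ?y)"
      unfolding Z_def sector_to_disc_def WT by simp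
    also have "- \<i> = cis (3 * pi / 2)" using cos_3over2_pi sin_3over2_pi by (simp add: complex_eq_iff)
    finally show ?thesis by (simp add: cis_mult T_def)
  qed
  have T1: "T y < T x" if "x < y" for x y
  proof -
    have "h / pi * x < h / pi * y" using that h by (intro mult_strict_left_mono) auto
    thus ?thesis by (simp add: T_def arctan_less_iff)
  qed
  have T2: "range T \<subseteq> {pi/2<..<3*pi/2}"
  proof
    fix t assume "t \<in> range T"
    then obtain x where x: "t = T x" by auto
    have "0 < arctan (exp (h / pi * x))" by simp
    moreover have "arctan (exp (h / pi * x)) < pi / 2" by (rule arctan_ubound)
    ultimately show "t \<in> {pi/2<..<3*pi/2}" by (simp add: x T_def)
  qed
  have "(F \<longlongrightarrow> F (Complex x pi)) (at (Complex x pi) within strip)" for x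
  proof -
    let ?\<zeta> = "Z (Complex x pi)"
    have "T x \<in> {pi/2<..<3*pi/2}" using T2 by blast
    hence "cos (T x) < 0" using cos_lt_zero_pi[of "T x"] cos_gt_zero_pi[of "T x - pi"] by (auto simp: cos_diff)
    hence \<zeta>: "?\<zeta> \<in> left_semicircle" by (simp add: ZT left_semicircle_def)
    have "1 - - exp (W (Complex x pi)) \<noteq> 0" unfolding WT by (simp add: complex_eq_iff)
    moreover have "isCont W (Complex x pi)"
      unfolding W_def by (intro continuous_intros)
    ultimately have "isCont Z (Complex x pi)"
      unfolding Z_def sector_to_disc_def cayley_def by (intro continuous_intros)
    hence "(Z \<longlongrightarrow> ?\<zeta>) (at (Complex x pi) within strip)"
      by (rule tendsto_within_subset[OF isContD subset_UNIV])
    moreover have "eventually (\<lambda>w. w \<in> strip) (at (Complex x pi) within strip)"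
      by (simp add: eventually_at_filter)
    hence "eventually (\<lambda>w. Z w \<in> ?\<Omega> \<union> left_semicircle \<and> Z w \<noteq> ?\<zeta>) (at (Complex x pi) within strip)"
    proof eventually_elim
      case (elim w)
      hence "Z w \<in> ?\<Omega>" using img by auto
      moreover have "norm ?\<zeta> = 1" by (simp add: ZT)
      ultimately show ?case by auto
    qed
    ultimately have "filterlim Z (at ?\<zeta> within ?\<Omega> \<union> left_semicircle) (at (Complex x pi) within strip)"
      by (simp add: filterlim_at)
    moreover have "(f \<longlongrightarrow> f ?\<zeta>) (at ?\<zeta> within ?\<Omega> \<union> left_semicircle)"
      using ext \<zeta> by (auto simp: extends_continuously_def continuous_within)
    ultimately show ?thesis unfolding F_def o_def by (rule filterlim_compose[rotated])
  qed
  note bdry = this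
  have holF: "F holomorphic_on strip" unfolding F_def by (rule holomorphic_on_compose_gen[OF holZ hol img])
  have injF: "inj_on F strip" unfolding F_def by (rule comp_inj_on[OF injZ inj_on_subset[OF inj img]])
  define C where "C = 2 * (1 + 4 * ((17 + 8 * cos \<phi>) / (9 * (sin (\<phi> / 2))\<^sup>2))) / sin \<phi>"
  define \<Lambda> where "\<Lambda> = enn2real (length_image_semicircle f)"
  have top: "F (Complex x pi) = f (cis (T x))" for x by (simp add: F_def ZT)
  obtain B where B: "\<And>x. (B has_real_derivative norm (deriv F (Complex x \<phi>))) (at x)"
    "\<And>x y. x \<le> y \<Longrightarrow> B y - B x \<le> C * ln 16 * \<Lambda>"
    using strip_line_length_bound[OF holF injF bdry top T1 T2 fin[unfolded length_image_semicircle_def] \<phi>' C_def]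
    unfolding \<Lambda>_def length_image_semicircle_def by blast
  define X where "X = (\<lambda>v. pi / h * ln ((1 + v) / (1 - v)))"
  have ZX: "Z (Complex (X v) \<phi>) = \<i> * of_real v" if v: "v \<in> {-1<..<1}" for v
  proof -
    have "W (Complex (X v) \<phi>) = of_real (ln ((1 + v) / (1 - v)))"
      using h \<phi>(3) by (simp add: W_def complex_eq_iff X_def)
    hence "exp (W (Complex (X v) \<phi>)) = of_real ((1 + v) / (1 - v))"
      using v by (simp only: exp_of_real) simp
    moreover have "cayley (- of_real ((1 + v) / (1 - v))) = of_real (- v)"
    proof -
      have "1 - (1 + v) / (1 - v) = - 2 * v / (1 - v)" "1 + (1 + v) / (1 - v) = 2 / (1 - v)" 
        using v by (simp_all add: field_simps)
      hence "(1 - (1 + v) / (1 - v)) / (1 + (1 + v) / (1 - v)) = - v" using v by simp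
      hence "complex_of_real ((1 - (1 + v) / (1 - v)) / (1 + (1 + v) / (1 - v))) = of_real (- v)" by (simp only:)
      thus ?thesis by (simp only: cayley_def of_real_divide of_real_add of_real_diff of_real_1) simp
    qed
    ultimately show ?thesis by (simp only: Z_def sector_to_disc_def) simp
  qed
  have dist: "dist (F (Complex x \<phi>)) (F (Complex y \<phi>)) \<le> B y - B x" if "x \<le> y" for x y
  proof (cases "x = y")
    case False
    have dF: "((\<lambda>x. F (Complex x \<phi>)) has_vector_derivative deriv F (Complex x \<phi>)) (at x)" for x
    proof -
      have "((\<lambda>x. Complex x \<phi>) has_vector_derivative 1) (at x)"
        unfolding Complex_eq by (auto intro!: derivative_eq_intros)
      moreover have "(F has_field_derivative deriv F (Complex x \<phi>)) (at (Complex x \<phi>))"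
        by (rule holomorphic_derivI[OF holF open_strip]) (use \<phi>' in \<open>simp add: strip_def\<close>)
      ultimately have "((F \<circ> (\<lambda>x. Complex x \<phi>)) has_vector_derivative 1 * deriv F (Complex x \<phi>)) (at x)"
        by (rule field_vector_diff_chain_at)
      thus ?thesis by (simp add: o_def)
    qed
    have "norm (F (Complex y \<phi>) - F (Complex x \<phi>)) \<le> B y - B x"
    proof (rule differentiable_bound_general)
      show "x < y" using that False by simp
      show "continuous_on {x..y} (\<lambda>x. F (Complex x \<phi>))"
        using dF by (intro continuous_at_imp_continuous_on ballI has_vector_derivative_continuous)
      show "continuous_on {x..y} B"
        using B(1) by (intro continuous_at_imp_continuous_on ballI DERIV_isCont)
      show "(B has_vector_derivative norm (deriv F (Complex z \<phi>))) (at z)" for z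
        using B(1) by (simp add: has_real_derivative_iff_has_vector_derivative)
    qed (use dF in auto)
    thus ?thesis by (simp add: dist_norm norm_minus_commute)
  qed simp
  have Xmono: "X x \<le> X y" if "x \<in> {-1<..<1}" "y \<in> {-1<..<1}" "x \<le> y" for x y
  proof -
    have "(1 + x) / (1 - x) \<le> (1 + y) / (1 - y)" using that by (intro frac_le) auto
    thus ?thesis unfolding X_def using h that by (intro mult_left_mono) auto
  qed
  have "length_image_diameter f \<le> ennreal (C * ln 16 * \<Lambda>)"
    unfolding length_image_diameter_def
  proof (rule curve_length_le_variation[where B = "\<lambda>v. B (X v)"])
    fix x y :: real assume xy: "x \<in> {-1<..<1}" "y \<in> {-1<..<1}" "x \<le> y"
    have "f (\<i> * of_real v) = F (Complex (X v) \<phi>)" if "v \<in> {-1<..<1}" for v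
      by (simp add: F_def ZX[OF that])
    thus "dist (f (\<i> * of_real x)) (f (\<i> * of_real y)) \<le> B (X y) - B (X x)"
      using dist[OF Xmono[OF xy]] xy by simp
    show "B (X y) - B (X x) \<le> C * ln 16 * \<Lambda>" by (rule B(2)[OF Xmono[OF xy]])
  qed
  also have "\<dots> \<le> ennreal ((1 + p\<^sup>2) / p * (20 + 400 / (9 * p\<^sup>2)) * ln 2 * \<Lambda>)"
    unfolding C_def by (intro ennreal_leI mult_right_mono sector_constant_le p) (use \<phi> in \<open>auto simp: \<beta>_def \<Lambda>_def\<close>)
  also have "\<dots> = ennreal ((1 + p\<^sup>2) / p * (20 + 400 / (9 * p\<^sup>2)) * ln 2) * ennreal \<Lambda>"
    by (rule ennreal_mult'') (simp add: \<Lambda>_def)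
  also have "ennreal \<Lambda> = length_image_semicircle f" using fin by (simp add: \<Lambda>_def)
  finally show ?thesis .
qed

lemma At_const_upper:
  assumes p: "0 < p" "p < 1"
  shows "At_const p \<le> ennreal ((1 + p\<^sup>2) / p * (20 + 400 / (9 * p\<^sup>2)) * ln 2)"
  unfolding At_const_def
proof (rule SUP_least)
  fix f assume "f \<in> Mt0_class p"
  note le = Mt_diameter_le[OF p this]
  show "length_image_diameter f / length_image_semicircle f \<le> ennreal ((1 + p\<^sup>2) / p * (20 + 400 / (9 * p\<^sup>2)) * ln 2)"
  proof (cases "length_image_semicircle f = 0")
    case True
    with le show ?thesis by simp
  next
    case False
    hence "0 < length_image_semicircle f" by (simp add: zero_less_iff_neq_zero)
    with le show ?thesis by (intro divide_le_posI_ennreal) (simp_all add: mult.commute)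
  qed
qed

section \<open>The extremal slit map and the final inequalities\<close>

lemma pole_in_closed_Delta:
  assumes p: "0 < p" "p < 1"
  shows "of_real p \<in> closed_Delta p"
proof -
  have pos: "0 < 1 + p\<^sup>2" by (simp add: add_pos_nonneg)
  have "alpha p * (p\<^sup>2 + 1) \<le> 2 * p" using pos by (simp add: alpha_def add.commute)
  thus ?thesis using alpha_bounds[OF p] by (simp add: closed_Delta_iff)
qed

lemma M0_subset_Mt0:
  assumes p: "0 < p" "p < 1"
  shows "M0_class p \<subseteq> Mt0_class p"
proof
  fix f assume "f \<in> M0_class p"
  hence mer: "f nicely_meromorphic_on unit_disc" and inj: "inj_on (sphere_value f) unit_disc"
    and pole: "is_pole f (of_real p)" and ext: "extends_continuously unit_disc f"
    and fin: "length_image_semicircle f < \<infinity>"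
    by (auto simp: M0_class_def M_class_def)
  let ?\<Omega> = "unit_disc - closed_Delta p"
  have pD: "of_real p \<in> unit_disc" using p by simp
  have np: "\<not> is_pole f z" if "z \<in> ?\<Omega>" for z
  proof
    assume "is_pole f z"
    hence "sphere_value f z = sphere_value f (of_real p)" using pole by (simp add: sphere_value_def)
    hence "z = of_real p" using inj_onD[OF inj] that pD by blast
    thus False using that pole_in_closed_Delta[OF p] by simp
  qed
  have "f analytic_on ?\<Omega>"
    using nicely_meromorphic_on_imp_analytic_at[OF mer _ np] by (subst analytic_on_analytic_at) auto
  hence "f holomorphic_on ?\<Omega>" by (rule analytic_imp_holomorphic)
  moreover have "inj_on f ?\<Omega>"
  proof (rule inj_onI)
    fix z w assume zw: "z \<in> ?\<Omega>" "w \<in> ?\<Omega>" "f z = f w"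
    hence "sphere_value f z = sphere_value f w" using np by (simp add: sphere_value_def)
    thus "z = w" using inj_onD[OF inj] zw by blast
  qed
  moreover have "extends_continuously ?\<Omega> f"
    using ext unfolding extends_continuously_def by (blast intro: continuous_within_subset)
  ultimately show "f \<in> Mt0_class p" using fin by (simp add: Mt0_class_def Mt_class_def)
qed

text \<open>
  Division by zero gives this function the value 0 at its pole, as nice meromorphy requires.
\<close>

definition slit_map :: "real \<Rightarrow> complex \<Rightarrow> complex" where
  "slit_map p z = of_real p * z / ((of_real p - z) * (1 - of_real p * z))"

text \<open>
  The function \<open>v / (1 - v\<^sup>2)\<close> is an increasing bijection from the open interval to the real line.
\<close>

lemma diameter_parameter_exists:
  obtains v where "v \<in> {-1<..<1}" "v / (1 - v\<^sup>2) = (k :: real)"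
proof
  define R where "R = sqrt (1 + 4 * k\<^sup>2)"
  have R: "1 \<le> R" "R\<^sup>2 = 1 + 4 * k\<^sup>2" by (simp_all add: R_def)
  define v where "v = 2 * k / (1 + R)"
  have v2: "v\<^sup>2 = (R - 1) / (1 + R)"
  proof -
    have "v\<^sup>2 = (R\<^sup>2 - 1) / (1 + R)\<^sup>2" by (simp add: v_def power_divide R)
    also have "R\<^sup>2 - 1 = (R - 1) * (1 + R)" by (simp add: power2_eq_square algebra_simps)
    finally show ?thesis using R by (simp add: power2_eq_square)
  qed
  have "v\<^sup>2 < 1" unfolding v2 using R by (simp add: divide_less_eq)
  thus "v \<in> {-1<..<1}" by (simp add: abs_square_less_1 abs_less_iff)
  have "1 - v\<^sup>2 = 2 / (1 + R)" unfolding v2 using R by (simp add: field_simps)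
  thus "v / (1 - v\<^sup>2) = k" using R by (simp add: v_def)
qed

lemma diameter_parameter_mono:
  assumes "v \<in> {-1<..<1}" "w \<in> {-1<..<1}" "v / (1 - v\<^sup>2) \<le> w / (1 - w\<^sup>2)"
  shows "v \<le> (w :: real)"
proof (rule ccontr)
  assume n: "\<not> v \<le> w"
  have pos: "0 < 1 - v\<^sup>2" "0 < 1 - w\<^sup>2" using assms by (auto simp: abs_square_less_1 abs_less_iff)
  have "v * (1 - w\<^sup>2) \<le> w * (1 - v\<^sup>2)" using assms(3) pos by (simp add: field_simps)
  hence "(v - w) * (1 + v * w) \<le> 0" by (simp add: power2_eq_square algebra_simps)
  moreover have "\<bar>v * w\<bar> < 1 * 1" unfolding abs_mult using assms by (intro mult_strict_mono') auto
  hence "0 < 1 + v * w" by linarith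
  ultimately show False using n by (simp add: mult_le_0_iff)
qed

lemma dist_cis: "dist (cis a) (cis b) = 2 * \<bar>sin ((a - b) / 2)\<bar>"
proof -
  have "(dist (cis a) (cis b))\<^sup>2 = 2 - 2 * cos (a - b)"
    unfolding dist_norm cmod_power2 using sin_cos_squared_add[of a] sin_cos_squared_add[of b]
    by (simp add: cos_diff power2_eq_square algebra_simps)
  also have "\<dots> = (2 * \<bar>sin ((a - b) / 2)\<bar>)\<^sup>2"
  proof -
    have "cos (a - b) = 1 - 2 * (sin ((a - b) / 2))\<^sup>2"
      using cos_double_sin[of "(a - b) / 2"] by (simp only: mult_2 field_sum_of_halves)
    thus ?thesis by (simp add: power_mult_distrib)
  qed
  finally show ?thesis by (rule power2_eq_imp_eq) auto
qed

context
  fixes p :: real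
  assumes p: "0 < p" "p < 1"
begin

lemma one_minus_pz: "norm z \<le> 1 \<Longrightarrow> 1 - of_real p * z \<noteq> (0 :: complex)"
proof
  assume "norm z \<le> 1" "1 - of_real p * z = 0"
  hence "norm (of_real p * z) = 1" by simp
  moreover have "p * norm z \<le> p * 1" using p \<open>norm z \<le> 1\<close> by (intro mult_left_mono) auto
  ultimately show False using p by (simp add: norm_mult)
qed

lemma slit_map_analytic_at:
  assumes "norm z \<le> 1" "z \<noteq> of_real p"
  shows "slit_map p analytic_on {z}"
  unfolding slit_map_def using assms one_minus_pz[OF assms(1)] by (intro analytic_intros) auto

lemma slit_map_pole: "is_pole (slit_map p) (of_real p)"
proof -
  have "1 - complex_of_real p * of_real p \<noteq> 0" using one_minus_pz[of "of_real p"] p by simp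
  hence "isCont (\<lambda>z. of_real p * z / (1 - of_real p * z)) (complex_of_real p)"
    by (intro continuous_intros)
  moreover have "filterlim (\<lambda>z. complex_of_real p - z) (at 0) (at (of_real p))"
    by (intro filterlim_atI) (auto intro!: tendsto_eq_intros simp: eventually_at_filter)
  ultimately have "is_pole (\<lambda>z. (of_real p * z / (1 - of_real p * z)) / (of_real p - z)) (complex_of_real p)"
    using \<open>1 - complex_of_real p * of_real p \<noteq> 0\<close> p by (intro is_pole_divide) auto
  also have "(\<lambda>z. (of_real p * z / (1 - of_real p * z)) / (of_real p - z)) = slit_map p"
    by (simp add: slit_map_def fun_eq_iff mult.commute)
  finally show ?thesis .
qed

lemma slit_map_pole_iff: "z \<in> unit_disc \<Longrightarrow> is_pole (slit_map p) z \<longleftrightarrow> z = of_real p"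
  using slit_map_pole slit_map_analytic_at[of z] by (force dest: analytic_at_imp_no_pole)

lemma slit_map_in_M: "slit_map p \<in> M_class p"
proof -
  have an: "slit_map p analytic_on {z}" if "z \<in> unit_disc" "z \<noteq> of_real p" for z
    using slit_map_analytic_at that by simp
  have "slit_map p meromorphic_on unit_disc"
    unfolding slit_map_def by (intro meromorphic_intros)
  moreover have "(is_pole (slit_map p) z \<and> slit_map p z = 0) \<or> slit_map p \<midarrow>z\<rightarrow> slit_map p z"
    if "z \<in> unit_disc" for z
  proof (cases "z = of_real p")
    case True
    thus ?thesis using slit_map_pole by (simp add: slit_map_def)
  next
    case False
    thus ?thesis using an[OF that] analytic_at_imp_isCont isContD by blast
  qed
  ultimately have 1: "slit_map p nicely_meromorphic_on unit_disc"
    by (simp add: nicely_meromorphic_on_def)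
  have 2: "inj_on (sphere_value (slit_map p)) unit_disc"
  proof (rule inj_onI)
    fix z w assume zw: "z \<in> unit_disc" "w \<in> unit_disc"
      and eq: "sphere_value (slit_map p) z = sphere_value (slit_map p) w"
    show "z = w"
    proof (cases "z = of_real p \<or> w = of_real p")
      case True
      thus ?thesis using eq zw by (auto simp: sphere_value_def slit_map_pole_iff split: if_splits)
    next
      case False
      hence e: "slit_map p z = slit_map p w" using eq zw by (simp add: sphere_value_def slit_map_pole_iff)
      let ?p = "complex_of_real p"
      have nz: "?p - z \<noteq> 0" "?p - w \<noteq> 0" "1 - ?p * z \<noteq> 0" "1 - ?p * w \<noteq> 0" "?p \<noteq> 0"
        using False zw one_minus_pz p by auto
      have "?p * z * ((?p - w) * (1 - ?p * w)) = ?p * w * ((?p - z) * (1 - ?p * z))"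
        using e nz by (simp add: slit_map_def frac_eq_eq)
      hence "?p * ?p * ((z - w) * (1 - z * w)) = 0" by (simp add: algebra_simps)
      moreover have "norm (z * w) < 1 * 1"
        unfolding norm_mult using zw by (intro mult_strict_mono') auto
      hence "1 - z * w \<noteq> 0" by auto
      ultimately show ?thesis using nz by simp
    qed
  qed
  have 3: "zorder (slit_map p) (of_real p) = -1"
  proof (rule zorder_eqI[of unit_disc _ "\<lambda>z. - (of_real p * z / (1 - of_real p * z))"])
    show "(\<lambda>z. - (of_real p * z / (1 - of_real p * z))) holomorphic_on unit_disc"
      using one_minus_pz by (intro holomorphic_intros) auto
    show "- (of_real p * of_real p / (1 - of_real p * of_real p)) \<noteq> (0::complex)"
      using one_minus_pz[of "of_real p"] p by simp
    fix w :: complex assume w: "w \<in> unit_disc" "w \<noteq> of_real p"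
    show "slit_map p w = - (of_real p * w / (1 - of_real p * w)) * (w - of_real p) powi - 1"
      using w one_minus_pz[of w] by (simp add: slit_map_def divide_simps) (simp add: algebra_simps)
  qed (use p in auto)
  have 4: "extends_continuously unit_disc (slit_map p)"
    unfolding extends_continuously_def
  proof
    fix \<zeta> assume "\<zeta> \<in> left_semicircle"
    hence "norm \<zeta> = 1" "\<zeta> \<noteq> of_real p" using p by (auto simp: left_semicircle_def)
    hence "isCont (slit_map p) \<zeta>" using slit_map_analytic_at analytic_at_imp_isCont by simp
    thus "continuous (at \<zeta> within unit_disc \<union> left_semicircle) (slit_map p)"
      by (rule continuous_at_imp_continuous_at_within)
  qed
  from 1 2 3 4 slit_map_pole show ?thesis by (simp add: M_class_def)
qed

text \<open>
  On the unit circle the map is real, with value \<open>p / (2 p cos t - (1 + p\<^sup>2))\<close>: it increases up to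
  \<open>t = \<pi>\<close> and decreases afterwards, so its total variation is twice its oscillation.
\<close>

lemma slit_map_semicircle_length:
  "length_image_semicircle (slit_map p) \<le> ennreal (4 * p\<^sup>2 / ((1 + p\<^sup>2) * (1 + p)\<^sup>2))"
proof -
  define r where "r = (\<lambda>t. p / (2 * p * cos t - (1 + p\<^sup>2)))"
  have pos: "0 < 1 + p\<^sup>2" by (simp add: add_pos_nonneg)
  have den: "2 * p * cos t - (1 + p\<^sup>2) < 0" for t
  proof -
    have "p * cos t \<le> p * 1" using p cos_le_one by (intro mult_left_mono) auto
    moreover have "(1 - p)\<^sup>2 > 0" using p by simp
    ultimately show ?thesis by (simp add: power2_eq_square algebra_simps)
  qed
  have f: "slit_map p (cis t) = of_real (r t)" for t
  proof -
    have "(P - e) * (1 - P * e) = e * (P * (e + e') - (1 + P\<^sup>2))" if "e * e' = 1" for P e e' :: complex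
      using that by algebra
    from this[of "cis t" "cis (- t)" "of_real p"]
    have "(of_real p - cis t) * (1 - of_real p * cis t) = cis t * (of_real p * (cis t + cis (- t)) - of_real (1 + p\<^sup>2))"
      by (simp add: cis_mult)
    also have "cis t + cis (- t) = of_real (2 * cos t)" by (simp add: complex_eq_iff)
    finally have "(of_real p - cis t) * (1 - of_real p * cis t) = cis t * of_real (2 * p * cos t - (1 + p\<^sup>2))"
      by (simp add: algebra_simps)
    thus ?thesis by (simp add: slit_map_def r_def)
  qed
  have mono: "r s \<le> r t" if "cos t \<le> cos s" for s t
    unfolding r_def using that p den[of s] den[of t] by (intro divide_left_mono) (auto simp: mult_neg_neg)
  have rpi: "r pi = - (p / (1 + p)\<^sup>2)"
  proof -
    have "2 * p * cos pi - (1 + p\<^sup>2) = - ((1 + p)\<^sup>2)" by (simp add: power2_eq_square algebra_simps)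
    thus ?thesis by (simp add: r_def)
  qed
  have top: "r t \<le> r pi" for t by (rule mono) simp
  have low: "- (p / (1 + p\<^sup>2)) \<le> r t" if "t \<in> {pi/2<..<3*pi/2}" for t
  proof -
    have "cos t \<le> 0" using that cos_gt_zero_pi[of "t - pi"] by (simp add: cos_diff)
    hence "r (pi / 2) \<le> r t" by (intro mono) simp
    moreover have "r (pi / 2) = p / (- (1 + p\<^sup>2))" by (simp add: r_def)
    hence "r (pi / 2) = - (p / (1 + p\<^sup>2))" by (simp only: minus_divide_right)
    ultimately show ?thesis by (simp only:)
  qed
  \<comment> \<open>The variation function of \<open>r\<close>, which turns at \<open>\<pi>\<close>.\<close>
  define B where "B = (\<lambda>t. if t \<le> pi then r t else 2 * r pi - r t)"
  have "length_image_semicircle (slit_map p) \<le> ennreal (2 * (r pi + p / (1 + p\<^sup>2)))"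
    unfolding length_image_semicircle_def
  proof (rule curve_length_le_variation[where B = B])
    fix s t :: real assume st: "s \<in> {pi/2<..<3*pi/2}" "t \<in> {pi/2<..<3*pi/2}" "s \<le> t"
    have d: "dist (slit_map p (cis s)) (slit_map p (cis t)) = \<bar>r s - r t\<bar>"
      unfolding f by (simp add: dist_of_real dist_real_def)
    consider "t \<le> pi" | "s \<le> pi" "pi < t" | "pi < s" by linarith
    thus "dist (slit_map p (cis s)) (slit_map p (cis t)) \<le> B t - B s"
    proof cases
      case 1
      have "cos t \<le> cos s" using 1 st by (subst cos_mono_le_eq) auto
      thus ?thesis using mono[of t s] 1 st d by (simp add: B_def)
    next
      case 2
      thus ?thesis using top[of s] top[of t] d by (simp add: B_def)
    next
      case 3
      have "cos (2 * pi - s) \<le> cos (2 * pi - t)" using 3 st by (subst cos_mono_le_eq) auto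
      hence "cos s \<le> cos t" by (simp add: cos_diff)
      thus ?thesis using mono[of s t] 3 st d by (simp add: B_def)
    qed
    show "B t - B s \<le> 2 * (r pi + p / (1 + p\<^sup>2))"
      using top[of s] top[of t] low[OF st(1)] low[OF st(2)] st(3) top[of pi] by (simp add: B_def)
  qed
  also have "2 * (r pi + p / (1 + p\<^sup>2)) = 4 * p\<^sup>2 / ((1 + p\<^sup>2) * (1 + p)\<^sup>2)"
  proof -
    have "1 + p \<noteq> 0" using p by simp
    have "p / (1 + p\<^sup>2) - p / (1 + p)\<^sup>2 = (p * (1 + p)\<^sup>2 - p * (1 + p\<^sup>2)) / ((1 + p\<^sup>2) * (1 + p)\<^sup>2)"
      using pos \<open>1 + p \<noteq> 0\<close> by (simp add: diff_frac_eq)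
    also have "p * (1 + p)\<^sup>2 - p * (1 + p\<^sup>2) = 2 * p\<^sup>2" by (simp add: power2_eq_square algebra_simps)
    finally show ?thesis by (simp add: rpi)
  qed
  finally show ?thesis .
qed

text \<open>
  The diameter is mapped to the circle through 0 and \<open>-p / (1 + p\<^sup>2)\<close> centred on the real axis; the
  parameter \<open>\<psi>\<close> is the angle at its centre.
\<close>

lemma slit_map_diameter_point:
  assumes \<psi>: "0 < \<psi>" "\<psi> < 2 * pi" and v: "v \<in> {-1<..<1}"
    and eq: "v / (1 - v\<^sup>2) = - (p / (1 + p\<^sup>2)) * cot (\<psi> / 2)"
  shows "slit_map p (\<i> * of_real v) = - of_real (p / (2 * (1 + p\<^sup>2))) * (1 + cis \<psi>)"
proof -
  define S where "S = sin (\<psi> / 2)"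
  define c where "c = cos (\<psi> / 2)"
  have S: "0 < S" unfolding S_def using \<psi> by (intro sin_gt_zero) auto
  have pos: "0 < 1 + p\<^sup>2" by (simp add: add_pos_nonneg)
  have v1: "0 < 1 - v\<^sup>2" using v by (simp add: abs_square_less_1 abs_less_iff)
  have vS: "v * (1 + p\<^sup>2) * S = - p * c * (1 - v\<^sup>2)"
  proof -
    have "x * w * s = - p * c * u" if "x / u = - (p / w) * (c / s)" "0 < u" "0 < w" "0 < s" for x u w s :: real
      using that by (simp add: field_simps)
    from this[OF _ v1 pos S] eq show ?thesis by (simp add: cot_def S_def c_def)
  qed
  have den: "(of_real p - \<i> * of_real v) * (1 - of_real p * (\<i> * of_real v)) = Complex (p * (1 - v\<^sup>2)) (- v * (1 + p\<^sup>2))"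
    by (simp add: complex_eq_iff power2_eq_square algebra_simps)
  have "of_real S * Complex (p * (1 - v\<^sup>2)) (- v * (1 + p\<^sup>2)) = of_real (p * (1 - v\<^sup>2)) * Complex S c"
    using vS by (simp add: complex_eq_iff algebra_simps)
  moreover have Sc: "Complex S c * cis (\<psi> / 2) = \<i>"
    using sin_cos_squared_add[of "\<psi> / 2"] by (simp add: complex_eq_iff S_def c_def power2_eq_square algebra_simps)
  ultimately have SD: "of_real S * Complex (p * (1 - v\<^sup>2)) (- v * (1 + p\<^sup>2)) * cis (\<psi> / 2) = of_real (p * (1 - v\<^sup>2)) * \<i>"
    by (simp add: mult.assoc)
  have half: "1 + cis \<psi> = of_real (2 * c) * cis (\<psi> / 2)"
    using cos_double_cos[of "\<psi> / 2"] sin_double[of "\<psi> / 2"]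
    by (simp add: complex_eq_iff c_def power2_eq_square)
  have key: "of_real S * (Complex (p * (1 - v\<^sup>2)) (- v * (1 + p\<^sup>2)) * (1 + cis \<psi>)) = of_real (2 * c * (p * (1 - v\<^sup>2))) * \<i>"
  proof -
    have "of_real S * (Complex (p * (1 - v\<^sup>2)) (- v * (1 + p\<^sup>2)) * (1 + cis \<psi>))
      = of_real (2 * c) * (of_real S * Complex (p * (1 - v\<^sup>2)) (- v * (1 + p\<^sup>2)) * cis (\<psi> / 2))"
      unfolding half by (simp only: mult_ac)
    also have "\<dots> = of_real (2 * c * (p * (1 - v\<^sup>2))) * \<i>"
      unfolding SD by (simp only: of_real_mult mult.assoc)
    finally show ?thesis .
  qed
  have ne: "Complex (p * (1 - v\<^sup>2)) (- v * (1 + p\<^sup>2)) \<noteq> 0" using p v1 by (simp add: complex_eq_iff)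
  have "of_real S * (of_real p * (\<i> * of_real v)) = 
      of_real S * (- of_real (p / (2 * (1 + p\<^sup>2))) * (1 + cis \<psi>) * Complex (p * (1 - v\<^sup>2)) (- v * (1 + p\<^sup>2)))"
  proof -
    have "of_real S * (- of_real (p / (2 * (1 + p\<^sup>2))) * (1 + cis \<psi>) * Complex (p * (1 - v\<^sup>2)) (- v * (1 + p\<^sup>2)))
       = - of_real (p / (2 * (1 + p\<^sup>2))) * (of_real (2 * c * (p * (1 - v\<^sup>2))) * \<i>)"
      unfolding key[symmetric] by (simp only: mult_ac)
    also have "\<dots> = of_real (- (p / (2 * (1 + p\<^sup>2))) * (2 * c * (p * (1 - v\<^sup>2)))) * \<i>" by simp
    also have "- (p / (2 * (1 + p\<^sup>2))) * (2 * c * (p * (1 - v\<^sup>2))) = p / (1 + p\<^sup>2) * (- p * c * (1 - v\<^sup>2))"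
    proof -
      have "- (p / (2 * w)) * (2 * c * (p * u)) = p / w * (- p * c * u)" for w u :: real by simp
      thus ?thesis .
    qed
    also have "\<dots> = p * v * S" unfolding vS[symmetric] using pos by simp
    finally show ?thesis by (simp add: mult_ac)
  qed
  hence "of_real p * (\<i> * of_real v) = - of_real (p / (2 * (1 + p\<^sup>2))) * (1 + cis \<psi>) * Complex (p * (1 - v\<^sup>2)) (- v * (1 + p\<^sup>2))"
    using S by (simp only: mult_cancel_left of_real_eq_0_iff) simp
  thus ?thesis unfolding slit_map_def den using ne by (simp only: nonzero_mult_div_cancel_right not_False_eq_True)
qed

text \<open>
  The vertices that divide the circle into \<open>n\<close> equal arcs, without the endpoint at angle 0, span a
  polygon of length \<open>(n - 2) 2 R sin (\<pi> / n)\<close>, which tends to the circumference.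
\<close>

lemma slit_map_diameter_length:
  "ennreal (pi * p / (1 + p\<^sup>2)) \<le> length_image_diameter (slit_map p)"
proof -
  define R where "R = p / (2 * (1 + p\<^sup>2))"
  have pos: "0 < 1 + p\<^sup>2" by (simp add: add_pos_nonneg)
  have R: "0 < R" using p pos by (simp add: R_def)
  have "\<exists>v. v \<in> {-1<..<1} \<and> v / (1 - v\<^sup>2) = - (p / (1 + p\<^sup>2)) * cot (\<psi> / 2)" for \<psi>
    by (rule diameter_parameter_exists[of "- (p / (1 + p\<^sup>2)) * cot (\<psi> / 2)"]) blast
  then obtain V where V: "\<And>\<psi>. V \<psi> \<in> {-1<..<1}" 
    "\<And>\<psi>. V \<psi> / (1 - (V \<psi>)\<^sup>2) = - (p / (1 + p\<^sup>2)) * cot (\<psi> / 2)" by metis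
  have Vmono: "V x \<le> V y" if xy: "0 < x" "x \<le> y" "y < 2 * pi" for x y
  proof (rule diameter_parameter_mono[OF V(1) V(1)])
    have "cot (y / 2) \<le> cot (x / 2)"
    proof -
      have s: "0 < sin (x / 2)" "0 < sin (y / 2)" using xy by (auto intro!: sin_gt_zero)
      have "0 \<le> sin (y / 2 - x / 2)" using xy by (intro sin_ge_zero) auto
      hence "cos (y / 2) * sin (x / 2) \<le> cos (x / 2) * sin (y / 2)" by (simp add: sin_diff mult.commute)
      thus ?thesis using s by (simp add: cot_def divide_le_eq) (simp add: field_simps)
    qed
    thus "V x / (1 - (V x)\<^sup>2) \<le> V y / (1 - (V y)\<^sup>2)"
      unfolding V(2) using p pos by (intro mult_left_mono_neg) auto
  qed
  have poly: "ennreal ((real n - 2) * (2 * R * sin (pi / real n))) \<le> length_image_diameter (slit_map p)"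
    if n: "3 \<le> n" for n :: nat
  proof -
    define \<psi> where "\<psi> = (\<lambda>j::nat. 2 * pi * real j / real n)"
    have \<psi>: "0 < \<psi> j" "\<psi> j < 2 * pi" if "0 < j" "j < n" for j
      using that by (auto simp: \<psi>_def field_simps)
    have \<psi>mono: "\<psi> i \<le> \<psi> j" if "i \<le> j" for i j
      unfolding \<psi>_def using that by (intro divide_right_mono mult_left_mono) auto
    define ts where "ts = map (\<lambda>j. V (\<psi> j)) [1..<n]"
    have lts: "length ts - 1 = n - 2" by (simp add: ts_def)
    have nth: "ts ! i = V (\<psi> (Suc i))" if "i < n - 1" for i
      using that by (simp add: ts_def)
    have "sorted ts"
      unfolding sorted_iff_nth_mono using n
      by (auto simp: ts_def intro!: Vmono \<psi> \<psi>mono)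
    moreover have "set ts \<subseteq> {-1<..<1}" using V(1) by (auto simp: ts_def)
    ultimately have "polygon_length (\<lambda>v. slit_map p (\<i> * of_real v)) ts \<le> length_image_diameter (slit_map p)"
      unfolding length_image_diameter_def by (rule polygon_length_le_curve_length)
    moreover have "polygon_length (\<lambda>v. slit_map p (\<i> * of_real v)) ts = (\<Sum>i<n - 2. ennreal (2 * R * sin (pi / real n)))"
      unfolding lts
    proof (intro sum.cong refl)
      fix i assume i: "i \<in> {..<n - 2}"
      have pt: "slit_map p (\<i> * of_real (V (\<psi> j))) = - of_real R * (1 + cis (\<psi> j))" if "0 < j" "j < n" for j
        unfolding R_def by (rule slit_map_diameter_point[OF \<psi>[OF that] V])
      have "dist (slit_map p (\<i> * of_real (ts ! i))) (slit_map p (\<i> * of_real (ts ! Suc i)))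
         = R * dist (cis (\<psi> (Suc i))) (cis (\<psi> (Suc (Suc i))))"
      proof -
        have "- of_real R * (1 + x) - - of_real R * (1 + y) = - of_real R * (x - y)" for x y :: complex
          by (simp add: algebra_simps)
        thus ?thesis using i R by (simp add: nth pt dist_norm norm_mult del: minus_mult_minus mult_minus_left)
      qed
      also have "(\<psi> (Suc i) - \<psi> (Suc (Suc i))) / 2 = - (pi / real n)"
        using n by (simp add: \<psi>_def field_simps)
      hence "dist (cis (\<psi> (Suc i))) (cis (\<psi> (Suc (Suc i)))) = 2 * \<bar>sin (pi / real n)\<bar>"
        by (simp add: dist_cis)
      also have "\<bar>sin (pi / real n)\<bar> = sin (pi / real n)"
        using n by (intro abs_of_nonneg sin_ge_zero) (auto simp: field_simps)
      finally show "ennreal (dist (slit_map p (\<i> * of_real (ts ! i))) (slit_map p (\<i> * of_real (ts ! Suc i))))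
          = ennreal (2 * R * sin (pi / real n))" by (simp add: mult_ac)
    qed
    moreover have "(\<Sum>i<n - 2. ennreal (2 * R * sin (pi / real n))) = ennreal ((real n - 2) * (2 * R * sin (pi / real n)))"
      using n by (simp add: ennreal_mult' ennreal_of_nat_eq_real_of_nat of_nat_diff)
    ultimately show ?thesis by simp
  qed
  have "(\<lambda>n. (real n - 2) * (2 * R * sin (pi / real n))) \<longlonglongrightarrow> 2 * R * pi"
    by real_asymp
  hence "(\<lambda>n. ennreal ((real n - 2) * (2 * R * sin (pi / real n)))) \<longlonglongrightarrow> ennreal (2 * R * pi)"
    by (rule tendsto_ennrealI)
  hence "ennreal (2 * R * pi) \<le> length_image_diameter (slit_map p)"
    by (rule LIMSEQ_le_const2) (use poly in blast)
  moreover have "2 * (a / (2 * w)) = a / w" for a w :: real by simp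
  hence "2 * R * pi = pi * p / (1 + p\<^sup>2)" by (simp only: R_def) simp
  ultimately show ?thesis by (simp only:)
qed

lemma A_const_lower: "ennreal ((1 + p)\<^sup>2 * pi / (4 * p)) \<le> A_const p"
proof -
  let ?l = "4 * p\<^sup>2 / ((1 + p\<^sup>2) * (1 + p)\<^sup>2)"
  have pos: "0 < 1 + p\<^sup>2" by (simp add: add_pos_nonneg)
  have l: "0 < ?l" using p pos by (intro divide_pos_pos mult_pos_pos) auto
  have M0: "slit_map p \<in> M0_class p"
    using slit_map_in_M slit_map_semicircle_length
    by (auto simp: M0_class_def intro: le_less_trans)
  have "q * pi / (4 * p) = (pi * p / w) / (4 * p\<^sup>2 / (w * q))" if "0 < w" "0 < q" for q w :: real
    using p that by (simp add: power2_eq_square field_simps)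
  from this[OF pos, of "(1 + p)\<^sup>2"]
  have "(1 + p)\<^sup>2 * pi / (4 * p) = (pi * p / (1 + p\<^sup>2)) / ?l"
    using p by simp
  hence "(1 + p)\<^sup>2 * pi / (4 * p) * ?l = pi * p / (1 + p\<^sup>2)"
    using l by (simp only: nonzero_eq_divide_eq less_imp_neq[symmetric] not_False_eq_True)
  moreover have "ennreal ((1 + p)\<^sup>2 * pi / (4 * p) * ?l) = ennreal ((1 + p)\<^sup>2 * pi / (4 * p)) * ennreal ?l"
    using l by (intro ennreal_mult'') simp
  ultimately have Kl: "ennreal ((1 + p)\<^sup>2 * pi / (4 * p)) * ennreal ?l = ennreal (pi * p / (1 + p\<^sup>2))"
    by simp
  have "ennreal ((1 + p)\<^sup>2 * pi / (4 * p)) \<le> length_image_diameter (slit_map p) / length_image_semicircle (slit_map p)"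
  proof (rule ccontr)
    let ?D = "length_image_diameter (slit_map p)" and ?S = "length_image_semicircle (slit_map p)"
    assume "\<not> ennreal ((1 + p)\<^sup>2 * pi / (4 * p)) \<le> ?D / ?S"
    hence less: "?D / ?S < ennreal ((1 + p)\<^sup>2 * pi / (4 * p))" by simp
    have "0 < pi * p / (1 + p\<^sup>2)" using p pos by simp
    hence "0 < ennreal (pi * p / (1 + p\<^sup>2))" by simp
    hence "?D \<noteq> 0" using slit_map_diameter_length by auto
    hence "?S \<noteq> 0" using less by auto
    moreover have "?S < top" using slit_map_semicircle_length by (rule le_less_trans) simp
    ultimately have "?D < ennreal ((1 + p)\<^sup>2 * pi / (4 * p)) * ?S" using less by (simp add: divide_less_ennreal)
    also have "\<dots> \<le> ennreal ((1 + p)\<^sup>2 * pi / (4 * p)) * ennreal ?l"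
      by (intro mult_left_mono slit_map_semicircle_length) simp
    also have "\<dots> \<le> ?D" unfolding Kl by (rule slit_map_diameter_length)
    finally show False by simp
  qed
  also have "\<dots> \<le> A_const p"
    unfolding A_const_def by (rule SUP_upper[OF M0])
  finally show ?thesis .
qed

end

theorem theorem1:
  fixes p :: real
  assumes "0 < p" and "p < 1"
  shows "ennreal ((1 + p)\<^sup>2 * pi / (4 * p)) \<le> A_const p
       \<and> A_const p \<le> At_const p
       \<and> At_const p < ennreal ((1 + p\<^sup>2) / p * (1 + sqrt 2 + 20 / (3 * p))\<^sup>2 * ln 2)"
proof (intro conjI)
  show "ennreal ((1 + p)\<^sup>2 * pi / (4 * p)) \<le> A_const p"
    by (rule A_const_lower[OF assms])
  show "A_const p \<le> At_const p"
    unfolding A_const_def At_const_def by (intro SUP_subset_mono M0_subset_Mt0 assms order_refl)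
  note At_const_upper[OF assms]
  also have "ennreal ((1 + p\<^sup>2) / p * (20 + 400 / (9 * p\<^sup>2)) * ln 2) 
      < ennreal ((1 + p\<^sup>2) / p * (1 + sqrt 2 + 20 / (3 * p))\<^sup>2 * ln 2)"
  proof (rule ennreal_lessI[OF le_less_trans upper_constant_less[OF assms]])
    show "0 \<le> (1 + p\<^sup>2) / p * (20 + 400 / (9 * p\<^sup>2)) * ln 2"
      using assms by (intro mult_nonneg_nonneg divide_nonneg_nonneg add_nonneg_nonneg) auto
  qed (rule upper_constant_less[OF assms])
  finally show "At_const p < ennreal ((1 + p\<^sup>2) / p * (1 + sqrt 2 + 20 / (3 * p))\<^sup>2 * ln 2)" .
qed

end
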